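(* Let $\mathscr{C},\mathscr{A}$ be categories, $P:\mathscr{C}\to\mathscr{A}$ a surjective functor, $E$ a section of $P$, and suppose that the corresponding germ $\Upsilon=\Upsilon_E(\mathscr{C},\mathscr{A},P,\mathfrak{B})$ is left-cancellative and left-associative. Let $\approx$ be the relation of deformation of paths by invertible elements, and consider the corresponding set of reductions $\overline{S}_\Upsilon(\mathfrak{B})$. The germ $\Upsilon$ is a Garside germ if and only if all ambiguities of the set $\overline{S}_\Upsilon(\mathfrak{B})$ are resolvable up to $\approx$. Moreover, the set of all irreducible elements $\mathrm{Irr}(\overline{S}_\Upsilon(\mathfrak{B}))$ coincides with the set of all $\Upsilon$-normal elements of the germ $\Upsilon$, and any two $\Upsilon$-normal decompositions of an element of $\mathsf{Cat}\langle\Upsilon\rangle$ are $\approx$-equivalent (i.e., are $\Upsilon^\times$-deformations of one another). Finally, if $\Upsilon$ is a solid generating family in $\mathscr{C}$, then $\mathscr{C}\cong\mathsf{Cat}\langle\Upsilon\rangle$.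
   Context: Conventions. All categories are small, and $fg$ is defined when the target of $f$ is the source of $g$. A precategory is a set of objects and a set of elements with source and target maps. A path of length $p$ in a precategory or category $X$ is a sequence $g_1\cdots g_p$ of $p$ elements of $X$ in which the target of each entry is the source of the next; $X^{[p]}$ is the set of such paths. In a category, $f\preccurlyeq g$ means $g=fg'$ for some $g'$. A category is left-cancellative if $fg=fh$ implies $g=h$. Germs. A germ is a triple $(\Upsilon,\bullet,\mathbf{1}_\Upsilon)$ with $\Upsilon$ a precategory, $\mathbf{1}_\Upsilon$ a family of elements $1_x$ with source and target $x$ (one for each object $x$), and $\bullet$ a partial map $\Upsilon^{[2]}\to\Upsilon$ such that: (1) if $\alpha\bullet\beta$ is defined, its source is that of $\alpha$ and its target that of $\beta$; (2) $1_x\bullet\alpha=\alpha=\alpha\bullet1_y$ for each $\alpha\in\Upsilon(x,y)$; (3) if $\alpha\bullet\beta$ and $\beta\bullet\gamma$ are defined, then $(\alpha\bullet\beta)\bullet\gamma$ is defined if and only if $\alpha\bullet(\beta\bullet\gamma)$ is, and then they are equal. It is left-associative if, whenever $(\alpha\bullet\beta)\bullet\gamma$ is defined, so is $\beta\bullet\gamma$. It is left-cancellative if $\alpha\bullet\beta=\alpha\bullet\gamma$ (both defined) implies $\beta=\gamma$. $\Upsilon^\times$ is the set of elements of $\Upsilon$ invertible with respect to $\bullet$. In $\Upsilon$, $\alpha\preccurlyeq\beta$ means $\beta=\alpha\bullet\gamma$ for some $\gamma\in\Upsilon$. $\mathsf{Cat}\langle\Upsilon\rangle$ is the category generated by $\Upsilon$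 with relations $\alpha\beta=\alpha\bullet\beta$ whenever $\alpha\bullet\beta$ is defined. Garside families. Let $\mathscr{D}$ be a left-cancellative category, $\mathscr{D}^\times$ its set of invertible elements, $\mathscr{S}\subseteq\mathscr{D}$, $\mathscr{S}^\sharp=\mathscr{S}\mathscr{D}^\times\cup\mathscr{D}^\times$. A path $b\cdot c\in\mathscr{D}^{[2]}$ is $\mathscr{S}$-greedy if for all $s\in\mathscr{S}$ and $a\in\mathscr{D}$, $s\preccurlyeq abc$ implies $s\preccurlyeq ab$; a path $a_1\cdots a_n$ is $\mathscr{S}$-greedy if each $a_i\cdot a_{i+1}$ is; it is $\mathscr{S}$-normal if it is $\mathscr{S}$-greedy and its entries lie in $\mathscr{S}^\sharp$. $\mathscr{S}$ is a Garside family in $\mathscr{D}$ if every element of $\mathscr{D}$ admits at least one $\mathscr{S}$-normal decomposition. $\Upsilon$ is a Garside germ if it is a Garside family in $\mathsf{Cat}\langle\Upsilon\rangle$. A subfamily of a category is solid if it contains all identity elements and is closed under right-divisors (every right-divisor of an element of the family is in the family). The germ $\Upsilon_E(\mathscr{C},\mathscr{A},P,\mathfrak{B})$. $P:\mathscr{C}\to\mathscr{A}$ is a functor surjective on objects and on morphisms. $\mathscr{A}=\mathsf{Cat}\langle\Gamma\,|\,R\rangle$ is a presentation of $\mathscr{A}$ by an oriented graph $\Gamma$ and relations $R$; an admissible (categorical) order on the free category $\mathsf{Cat}\langle\Gamma\rangle$ is fixed together with a Gröbner–Shirshov basis of the ideal $(R)$ for it; $\mathrm{Irr}(R)$ is the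 set of irreducible words, so each morphism $a$ of $\mathscr{A}$ has a unique representative $\mathrm{NF}(a)\in\mathrm{Irr}(R)$, and elements of $\mathrm{Irr}(R)$ are identified with the morphisms they represent. $E:\mathscr{A}\to\mathscr{C}$ is a map, not a functor in general, with $P\circ E=\mathrm{id}_{\mathscr{A}}$; write $E_a=E(a)$. For $\mathfrak{B}\subseteq\mathrm{Irr}(R)$, $\Upsilon_E(\mathscr{C},\mathscr{A},P,\mathfrak{B})=\{E_a: a\in\mathfrak{B}\}$ with partial product $E_a\bullet E_b:=E_{\mathrm{NF}(ab)}$, defined whenever $ab$ is defined, $\mathrm{NF}(ab)\in\mathfrak{B}$ and $E(ab)=E(a)E(b)$ in $\mathscr{C}$; it is assumed to be a germ. "$E_a\bullet E_b\in\Upsilon$" means that $E_a\bullet E_b$ is defined. Reductions. Write $E_x\gtrapprox E_y$ if $E_x\preccurlyeq E_y$ and $E_y\not\preccurlyeq E_x$ in $\Upsilon$. $E_xE_y\in\Upsilon^{[2]}$ is reducible if $y=y_1y_2$ with $E_x\bullet E_{y_1},\,E_{y_1}\bullet E_{y_2}\in\Upsilon$ and $E_x\gtrapprox E_{\mathrm{NF}(xy_1)}$; one then writes $E_xE_y\to E_{\mathrm{NF}(xy_1)}E_{y_2}$ ($E_{y_2}$ may be an identity); otherwise it is irreducible. $S_\Upsilon(\mathfrak{B})$ is the set of all these reductions, and $\overline{S}_\Upsilon(\mathfrak{B})\subseteq S_\Upsilon(\mathfrak{B})$ consists of those whose right-hand side $E_{\mathrm{NF}(xy_1)}E_{y_2}$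 is irreducible under $S_\Upsilon(\mathfrak{B})$. They are viewed as a reduction system on $\Upsilon$-paths (a set $S$ of pairs $\sigma=(W_\sigma,\omega_\sigma)$, where applying $\sigma$ replaces a subpath $W_\sigma$ by $\omega_\sigma$); $\mathrm{Irr}(S)$ is the set of paths containing no subpath $W_\sigma$. An overlap (resp. inclusion) ambiguity is a tuple $(\sigma,\tau,A,B,C)$ with $\sigma,\tau\in S$, $A,B,C$ non-identity paths, $W_\sigma=AB$, $W_\tau=BC$ (resp. $\sigma\neq\tau$, $W_\sigma=B$, $W_\tau=ABC$). It is resolvable up to $\approx$ if by finitely many steps, each an application of a reduction or a replacement by a $\approx$-equivalent path, one can pass from $\omega_\sigma C$ and $A\omega_\tau$ (resp. from $\omega_\sigma$ and $A\omega_\tau C$) to paths that are $\approx$-equivalent. Deformation. For $\Upsilon$-paths, $a_1\cdots a_n\approx b_1\cdots b_m$ if there are invertible elements $\epsilon_0,\dots,\epsilon_\ell\in\Upsilon^\times$, $\ell=\max(n,m)$, with $\epsilon_0,\epsilon_\ell$ identities and $\epsilon_{i-1}b_i=a_i\epsilon_i$ in $\mathsf{Cat}\langle\Upsilon\rangle$ for $1\le i\le\ell$, the shorter path being extended by identity elements.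
   Formalization: Irr = normal is claimed when Υ is a Garside germ, uniqueness when Cat⟨Υ⟩ is left-cancellative; the last claim also assumes that Υ is a Garside family in 𝒞 (false otherwise: {1,a,b} in ℕ²); in inclusion ambiguities A and C may be empty. *)

theory Defs
  imports Main "HOL-Library.Poly_Mapping"
begin

section \<open>Precategories, paths, categories\<close>

text \<open>Composition is written in diagrammatic order: \<open>Cmp D f g\<close> is the composite \<open>fg\<close>, and it is
  meaningful only if the target of \<open>f\<close> is the source of \<open>g\<close>.  The product of a germ is a
  partial map, hence option valued.\<close>

record ('o, 'e) precat =
  Obj :: "'o set"
  Elt :: "'e set"
  Src :: "'e \<Rightarrow> 'o"
  Tgt :: "'e \<Rightarrow> 'o"

record ('o, 'e) cat = "('o, 'e) precat" +
  Cmp :: "'e \<Rightarrow> 'e \<Rightarrow> 'e"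
  Idt :: "'o \<Rightarrow> 'e"

record ('o, 'e) germ = "('o, 'e) precat" +
  Mul :: "'e \<Rightarrow> 'e \<Rightarrow> 'e option"
  One :: "'o \<Rightarrow> 'e"

definition is_precat :: "('o, 'e, 'z) precat_scheme \<Rightarrow> bool" where
  "is_precat X \<longleftrightarrow> (\<forall>e\<in>Elt X. Src X e \<in> Obj X \<and> Tgt X e \<in> Obj X)"

definition is_category :: "('o, 'e, 'z) cat_scheme \<Rightarrow> bool" where
  "is_category D \<longleftrightarrow>
     is_precat D \<and>
     (\<forall>x\<in>Obj D. Idt D x \<in> Elt D \<and> Src D (Idt D x) = x \<and> Tgt D (Idt D x) = x) \<and>
     (\<forall>f\<in>Elt D. \<forall>g\<in>Elt D. Tgt D f = Src D g \<longrightarrow>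
        Cmp D f g \<in> Elt D \<and> Src D (Cmp D f g) = Src D f \<and> Tgt D (Cmp D f g) = Tgt D g) \<and>
     (\<forall>f\<in>Elt D. Cmp D (Idt D (Src D f)) f = f \<and> Cmp D f (Idt D (Tgt D f)) = f) \<and>
     (\<forall>f\<in>Elt D. \<forall>g\<in>Elt D. \<forall>h\<in>Elt D. Tgt D f = Src D g \<longrightarrow> Tgt D g = Src D h \<longrightarrow>
        Cmp D (Cmp D f g) h = Cmp D f (Cmp D g h))"

text \<open>A path carries its source, so that there is one path of length zero at every object.\<close>

type_synonym ('o, 'e) path = "'o \<times> 'e list"

fun chain :: "('o, 'e, 'z) precat_scheme \<Rightarrow> 'o \<Rightarrow> 'e list \<Rightarrow> bool" where
  "chain X x [] \<longleftrightarrow> x \<in> Obj X"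
| "chain X x (e # es) \<longleftrightarrow> x \<in> Obj X \<and> e \<in> Elt X \<and> Src X e = x \<and> chain X (Tgt X e) es"

definition paths :: "('o, 'e, 'z) precat_scheme \<Rightarrow> ('o, 'e) path set" where
  "paths X = {p. chain X (fst p) (snd p)}"

definition ptgt :: "('o, 'e, 'z) precat_scheme \<Rightarrow> ('o, 'e) path \<Rightarrow> 'o" where
  "ptgt X p = (if snd p = [] then fst p else Tgt X (last (snd p)))"

definition pcat :: "('o, 'e) path \<Rightarrow> ('o, 'e) path \<Rightarrow> ('o, 'e) path" (infixl "\<odot>" 70) where
  "p \<odot> q = (fst p, snd p @ snd q)"

definition composable :: "('o, 'e, 'z) precat_scheme \<Rightarrow> ('o, 'e) path \<Rightarrow> ('o, 'e) path \<Rightarrow> bool" where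
  "composable X p q \<longleftrightarrow> p \<in> paths X \<and> q \<in> paths X \<and> ptgt X p = fst q"

definition parallel :: "('o, 'e, 'z) precat_scheme \<Rightarrow> ('o, 'e) path \<Rightarrow> ('o, 'e) path \<Rightarrow> bool" where
  "parallel X p q \<longleftrightarrow> p \<in> paths X \<and> q \<in> paths X \<and> fst p = fst q \<and> ptgt X p = ptgt X q"

definition subpath :: "('o, 'e, 'z) precat_scheme \<Rightarrow> ('o, 'e) path \<Rightarrow> ('o, 'e) path \<Rightarrow> bool" where
  "subpath X u w \<longleftrightarrow> (\<exists>a b. composable X a u \<and> composable X u b \<and> w = a \<odot> u \<odot> b)"

definition avoiding_paths ::
    "('o, 'e, 'z) precat_scheme \<Rightarrow> ('o, 'e) path set \<Rightarrow> ('o, 'e) path set" where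
  "avoiding_paths X L = {p \<in> paths X. \<not> (\<exists>u\<in>L. subpath X u p)}"

definition path_value :: "('o, 'e, 'z) cat_scheme \<Rightarrow> ('o, 'e) path \<Rightarrow> 'e" where
  "path_value D p = foldr (Cmp D) (snd p) (Idt D (ptgt D p))"

definition is_functor ::
    "('o, 'e, 'z) cat_scheme \<Rightarrow> ('p, 'f, 'y) cat_scheme \<Rightarrow> ('o \<Rightarrow> 'p) \<Rightarrow> ('e \<Rightarrow> 'f) \<Rightarrow> bool" where
  "is_functor C D F\<^sub>o F\<^sub>m \<longleftrightarrow>
     (\<forall>x\<in>Obj C. F\<^sub>o x \<in> Obj D \<and> F\<^sub>m (Idt C x) = Idt D (F\<^sub>o x)) \<and>
     (\<forall>f\<in>Elt C. F\<^sub>m f \<in> Elt D \<and> Src D (F\<^sub>m f) = F\<^sub>o (Src C f) \<and> Tgt D (F\<^sub>m f) = F\<^sub>o (Tgt C f)) \<and>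
     (\<forall>f\<in>Elt C. \<forall>g\<in>Elt C. Tgt C f = Src C g \<longrightarrow> F\<^sub>m (Cmp C f g) = Cmp D (F\<^sub>m f) (F\<^sub>m g))"

definition surjective_functor ::
    "('o, 'e, 'z) cat_scheme \<Rightarrow> ('p, 'f, 'y) cat_scheme \<Rightarrow> ('o \<Rightarrow> 'p) \<Rightarrow> ('e \<Rightarrow> 'f) \<Rightarrow> bool" where
  "surjective_functor C D F\<^sub>o F\<^sub>m \<longleftrightarrow>
     is_functor C D F\<^sub>o F\<^sub>m \<and> F\<^sub>o ` Obj C = Obj D \<and> F\<^sub>m ` Elt C = Elt D"

definition isomorphic_cats :: "('o, 'e, 'z) cat_scheme \<Rightarrow> ('p, 'f, 'y) cat_scheme \<Rightarrow> bool" where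
  "isomorphic_cats C D \<longleftrightarrow>
     (\<exists>F\<^sub>o F\<^sub>m. is_functor C D F\<^sub>o F\<^sub>m \<and>
        bij_betw F\<^sub>o (Obj C) (Obj D) \<and> bij_betw F\<^sub>m (Elt C) (Elt D))"

section \<open>Presentations\<close>

definition is_relations ::
    "('o, 'e, 'z) precat_scheme \<Rightarrow> (('o, 'e) path \<times> ('o, 'e) path) set \<Rightarrow> bool" where
  "is_relations X R \<longleftrightarrow> (\<forall>(u, v)\<in>R. parallel X u v)"

inductive pcong ::
    "('o, 'e, 'z) precat_scheme \<Rightarrow> (('o, 'e) path \<times> ('o, 'e) path) set
      \<Rightarrow> ('o, 'e) path \<Rightarrow> ('o, 'e) path \<Rightarrow> bool"
  for X R where
  pcong_refl: "p \<in> paths X \<Longrightarrow> pcong X R p p"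
| pcong_rel: "(u, v) \<in> R \<Longrightarrow> pcong X R u v"
| pcong_sym: "pcong X R p q \<Longrightarrow> pcong X R q p"
| pcong_trans: "pcong X R p q \<Longrightarrow> pcong X R q r \<Longrightarrow> pcong X R p r"
| pcong_comp: "pcong X R p q \<Longrightarrow> pcong X R p' q' \<Longrightarrow> composable X p p'
    \<Longrightarrow> pcong X R (p \<odot> p') (q \<odot> q')"

definition pclass ::
    "('o, 'e, 'z) precat_scheme \<Rightarrow> (('o, 'e) path \<times> ('o, 'e) path) set
      \<Rightarrow> ('o, 'e) path \<Rightarrow> ('o, 'e) path set" where
  "pclass X R p = {q. pcong X R p q}"

definition presented_cat ::
    "('o, 'e, 'z) precat_scheme \<Rightarrow> (('o, 'e) path \<times> ('o, 'e) path) set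
      \<Rightarrow> ('o, ('o, 'e) path set) cat" where
  "presented_cat X R =
     \<lparr>Obj = Obj X,
      Elt = pclass X R ` paths X,
      Src = (\<lambda>c. fst (SOME p. p \<in> c)),
      Tgt = (\<lambda>c. ptgt X (SOME p. p \<in> c)),
      Cmp = (\<lambda>c d. pclass X R ((SOME p. p \<in> c) \<odot> (SOME q. q \<in> d))),
      Idt = (\<lambda>x. pclass X R (x, []))\<rparr>"

definition word_value ::
    "('o, 'e, 'z) cat_scheme \<Rightarrow> ('x \<Rightarrow> 'e) \<Rightarrow> ('o, 'x) path \<Rightarrow> 'e" where
  "word_value D \<gamma> w = path_value D (fst w, map \<gamma> (snd w))"

text \<open>\<open>A = Cat\<langle>\<Gamma> | R\<rangle>\<close>, the edges of \<open>\<Gamma>\<close> being interpreted in \<open>A\<close> by \<open>\<gamma>\<close>: the functor from the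
  free category on \<open>\<Gamma>\<close> to \<open>A\<close> is onto, and its kernel is the congruence generated by \<open>R\<close>.\<close>

definition presents ::
    "('o, 'e, 'z) cat_scheme \<Rightarrow> ('o, 'x) precat \<Rightarrow> (('o, 'x) path \<times> ('o, 'x) path) set
      \<Rightarrow> ('x \<Rightarrow> 'e) \<Rightarrow> bool" where
  "presents A \<Gamma> R \<gamma> \<longleftrightarrow>
     is_precat \<Gamma> \<and> is_relations \<Gamma> R \<and> Obj \<Gamma> = Obj A \<and>
     (\<forall>e\<in>Elt \<Gamma>. \<gamma> e \<in> Elt A \<and> Src A (\<gamma> e) = Src \<Gamma> e \<and> Tgt A (\<gamma> e) = Tgt \<Gamma> e) \<and>
     word_value A \<gamma> ` paths \<Gamma> = Elt A \<and>
     (\<forall>p\<in>paths \<Gamma>. \<forall>q\<in>paths \<Gamma>. word_value A \<gamma> p = word_value A \<gamma> q \<longleftrightarrow> pcong \<Gamma> R p q)"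

section \<open>Groebner--Shirshov bases in free categories\<close>

text \<open>Only parallel paths are ever compared, so the conditions on the order are imposed
  on each hom-set of the free category.\<close>

definition admissible_order ::
    "('o, 'x, 'z) precat_scheme \<Rightarrow> (('o, 'x) path \<Rightarrow> ('o, 'x) path \<Rightarrow> bool) \<Rightarrow> bool" where
  "admissible_order \<Gamma> lt \<longleftrightarrow>
     wfp (\<lambda>u v. parallel \<Gamma> u v \<and> lt u v) \<and>
     (\<forall>u v w. parallel \<Gamma> u v \<longrightarrow> parallel \<Gamma> v w \<longrightarrow> lt u v \<longrightarrow> lt v w \<longrightarrow> lt u w) \<and>
     (\<forall>u v. parallel \<Gamma> u v \<longrightarrow> u \<noteq> v \<longrightarrow> lt u v \<or> lt v u) \<and>
     (\<forall>a u v b. parallel \<Gamma> u v \<longrightarrow> composable \<Gamma> a u \<longrightarrow> composable \<Gamma> u b \<longrightarrow> lt u v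
        \<longrightarrow> lt (a \<odot> u \<odot> b) (a \<odot> v \<odot> b))"

text \<open>The ideal \<open>(R)\<close> of the free \<open>k\<close>-linear category on \<open>\<Gamma>\<close>, generated by the
  differences \<open>u - v\<close> for \<open>(u, v) \<in> R\<close>: \<open>rel_ideal \<Gamma> R x y\<close> is its part in the hom-space from
  \<open>x\<close> to \<open>y\<close>, whose elements are combinations of paths from \<open>x\<close> to \<open>y\<close>.  The sum in the last rule is
  \<open>c a f b\<close>.\<close>

inductive rel_ideal ::
    "('o, 'x, 'z) precat_scheme \<Rightarrow> (('o, 'x) path \<times> ('o, 'x) path) set
      \<Rightarrow> 'o \<Rightarrow> 'o \<Rightarrow> (('o, 'x) path \<Rightarrow>\<^sub>0 'k::field) \<Rightarrow> bool"
  for \<Gamma> R where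
  rel_ideal_zero: "x \<in> Obj \<Gamma> \<Longrightarrow> y \<in> Obj \<Gamma> \<Longrightarrow> rel_ideal \<Gamma> R x y 0"
| rel_ideal_rel: "(u, v) \<in> R \<Longrightarrow>
    rel_ideal \<Gamma> R (fst u) (ptgt \<Gamma> u) (Poly_Mapping.single u 1 - Poly_Mapping.single v 1)"
| rel_ideal_add: "rel_ideal \<Gamma> R x y f \<Longrightarrow> rel_ideal \<Gamma> R x y g \<Longrightarrow> rel_ideal \<Gamma> R x y (f + g)"
| rel_ideal_mult: "rel_ideal \<Gamma> R x y f \<Longrightarrow> a \<in> paths \<Gamma> \<Longrightarrow> ptgt \<Gamma> a = x \<Longrightarrow> b \<in> paths \<Gamma> \<Longrightarrow> fst b = y
    \<Longrightarrow> rel_ideal \<Gamma> R (fst a) (ptgt \<Gamma> b)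
          (\<Sum>w\<in>Poly_Mapping.keys f.
             Poly_Mapping.single (a \<odot> w \<odot> b) (c * Poly_Mapping.lookup f w))"

definition leading_word ::
    "(('o, 'x) path \<Rightarrow> ('o, 'x) path \<Rightarrow> bool) \<Rightarrow> (('o, 'x) path \<Rightarrow>\<^sub>0 'k::zero) \<Rightarrow> ('o, 'x) path" where
  "leading_word lt f =
     (THE w. w \<in> Poly_Mapping.keys f \<and> (\<forall>v\<in>Poly_Mapping.keys f. v \<noteq> w \<longrightarrow> lt v w))"

definition gs_basis ::
    "('o, 'x, 'z) precat_scheme \<Rightarrow> (('o, 'x) path \<times> ('o, 'x) path) set
      \<Rightarrow> (('o, 'x) path \<Rightarrow> ('o, 'x) path \<Rightarrow> bool) \<Rightarrow> (('o, 'x) path \<Rightarrow>\<^sub>0 'k::field) set \<Rightarrow> bool" where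
  "gs_basis \<Gamma> R lt G \<longleftrightarrow>
     (\<forall>g\<in>G. g \<noteq> 0 \<and> Poly_Mapping.lookup g (leading_word lt g) = 1 \<and> (\<exists>x y. rel_ideal \<Gamma> R x y g)) \<and>
     (\<forall>x y (f :: ('o, 'x) path \<Rightarrow>\<^sub>0 'k). rel_ideal \<Gamma> R x y f \<longrightarrow> f \<noteq> 0 \<longrightarrow>
        (\<exists>g\<in>G. subpath \<Gamma> (leading_word lt g) (leading_word lt f)))"

definition irr_words ::
    "('o, 'x, 'z) precat_scheme \<Rightarrow> (('o, 'x) path \<Rightarrow> ('o, 'x) path \<Rightarrow> bool)
      \<Rightarrow> (('o, 'x) path \<Rightarrow>\<^sub>0 'k::field) set \<Rightarrow> ('o, 'x) path set" where
  "irr_words \<Gamma> lt G = avoiding_paths \<Gamma> (leading_word lt ` G)"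

definition normal_form :: "('w \<Rightarrow> 'e) \<Rightarrow> 'w set \<Rightarrow> 'e \<Rightarrow> 'w" where
  "normal_form ev I a = (THE w. w \<in> I \<and> ev w = a)"

section \<open>Germs\<close>

definition is_germ :: "('o, 'e) germ \<Rightarrow> bool" where
  "is_germ \<Upsilon> \<longleftrightarrow>
     is_precat \<Upsilon> \<and>
     (\<forall>x\<in>Obj \<Upsilon>. One \<Upsilon> x \<in> Elt \<Upsilon> \<and> Src \<Upsilon> (One \<Upsilon> x) = x \<and> Tgt \<Upsilon> (One \<Upsilon> x) = x) \<and>
     (\<forall>\<alpha> \<beta> \<gamma>. Mul \<Upsilon> \<alpha> \<beta> = Some \<gamma> \<longrightarrow>
        \<alpha> \<in> Elt \<Upsilon> \<and> \<beta> \<in> Elt \<Upsilon> \<and> Tgt \<Upsilon> \<alpha> = Src \<Upsilon> \<beta> \<and>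
        \<gamma> \<in> Elt \<Upsilon> \<and> Src \<Upsilon> \<gamma> = Src \<Upsilon> \<alpha> \<and> Tgt \<Upsilon> \<gamma> = Tgt \<Upsilon> \<beta>) \<and>
     (\<forall>\<alpha>\<in>Elt \<Upsilon>. Mul \<Upsilon> (One \<Upsilon> (Src \<Upsilon> \<alpha>)) \<alpha> = Some \<alpha> \<and> Mul \<Upsilon> \<alpha> (One \<Upsilon> (Tgt \<Upsilon> \<alpha>)) = Some \<alpha>) \<and>
     (\<forall>\<alpha> \<beta> \<gamma> \<mu> \<nu>. Mul \<Upsilon> \<alpha> \<beta> = Some \<mu> \<longrightarrow> Mul \<Upsilon> \<beta> \<gamma> = Some \<nu> \<longrightarrow>
        Mul \<Upsilon> \<mu> \<gamma> = Mul \<Upsilon> \<alpha> \<nu>)"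

definition germ_left_associative :: "('o, 'e) germ \<Rightarrow> bool" where
  "germ_left_associative \<Upsilon> \<longleftrightarrow>
     (\<forall>\<alpha> \<beta> \<gamma> \<mu>. Mul \<Upsilon> \<alpha> \<beta> = Some \<mu> \<longrightarrow> Mul \<Upsilon> \<mu> \<gamma> \<noteq> None \<longrightarrow> Mul \<Upsilon> \<beta> \<gamma> \<noteq> None)"

definition germ_left_cancellative :: "('o, 'e) germ \<Rightarrow> bool" where
  "germ_left_cancellative \<Upsilon> \<longleftrightarrow>
     (\<forall>\<alpha> \<beta> \<gamma> \<mu>. Mul \<Upsilon> \<alpha> \<beta> = Some \<mu> \<longrightarrow> Mul \<Upsilon> \<alpha> \<gamma> = Some \<mu> \<longrightarrow> \<beta> = \<gamma>)"

definition germ_invertibles :: "('o, 'e) germ \<Rightarrow> 'e set" where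
  "germ_invertibles \<Upsilon> =
     {\<alpha> \<in> Elt \<Upsilon>. \<exists>\<beta>\<in>Elt \<Upsilon>. Mul \<Upsilon> \<alpha> \<beta> = Some (One \<Upsilon> (Src \<Upsilon> \<alpha>)) \<and> Mul \<Upsilon> \<beta> \<alpha> = Some (One \<Upsilon> (Tgt \<Upsilon> \<alpha>))}"

definition germ_divides :: "('o, 'e) germ \<Rightarrow> 'e \<Rightarrow> 'e \<Rightarrow> bool" where
  "germ_divides \<Upsilon> \<alpha> \<beta> \<longleftrightarrow> (\<exists>\<gamma>\<in>Elt \<Upsilon>. Mul \<Upsilon> \<alpha> \<gamma> = Some \<beta>)"

definition germ_strictly_divides :: "('o, 'e) germ \<Rightarrow> 'e \<Rightarrow> 'e \<Rightarrow> bool" where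
  "germ_strictly_divides \<Upsilon> \<alpha> \<beta> \<longleftrightarrow> germ_divides \<Upsilon> \<alpha> \<beta> \<and> \<not> germ_divides \<Upsilon> \<beta> \<alpha>"

text \<open>The second family of relations identifies the units of the germ with the identities
  (the paths of length zero) of the category it generates.\<close>

definition germ_relations :: "('o, 'e) germ \<Rightarrow> (('o, 'e) path \<times> ('o, 'e) path) set" where
  "germ_relations \<Upsilon> =
     {((Src \<Upsilon> \<alpha>, [\<alpha>, \<beta>]), (Src \<Upsilon> \<alpha>, [\<gamma>])) | \<alpha> \<beta> \<gamma>. Mul \<Upsilon> \<alpha> \<beta> = Some \<gamma>} \<union>
     {((x, [One \<Upsilon> x]), (x, [])) | x. x \<in> Obj \<Upsilon>}"

definition germ_cat :: "('o, 'e) germ \<Rightarrow> ('o, ('o, 'e) path set) cat" where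
  "germ_cat \<Upsilon> = presented_cat \<Upsilon> (germ_relations \<Upsilon>)"

definition germ_emb :: "('o, 'e) germ \<Rightarrow> 'e \<Rightarrow> ('o, 'e) path set" where
  "germ_emb \<Upsilon> \<alpha> = pclass \<Upsilon> (germ_relations \<Upsilon>) (Src \<Upsilon> \<alpha>, [\<alpha>])"

definition germ_emb_path ::
    "('o, 'e) germ \<Rightarrow> ('o, 'e) path \<Rightarrow> ('o, ('o, 'e) path set) path" where
  "germ_emb_path \<Upsilon> p = (fst p, map (germ_emb \<Upsilon>) (snd p))"

section \<open>Garside families\<close>

definition left_cancellative :: "('o, 'e, 'z) cat_scheme \<Rightarrow> bool" where
  "left_cancellative D \<longleftrightarrow>
     (\<forall>f\<in>Elt D. \<forall>g\<in>Elt D. \<forall>h\<in>Elt D. Tgt D f = Src D g \<longrightarrow> Tgt D f = Src D h \<longrightarrow>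
        Cmp D f g = Cmp D f h \<longrightarrow> g = h)"

definition cat_divides :: "('o, 'e, 'z) cat_scheme \<Rightarrow> 'e \<Rightarrow> 'e \<Rightarrow> bool" where
  "cat_divides D f g \<longleftrightarrow> (\<exists>h\<in>Elt D. Tgt D f = Src D h \<and> g = Cmp D f h)"

definition cat_invertibles :: "('o, 'e, 'z) cat_scheme \<Rightarrow> 'e set" where
  "cat_invertibles D =
     {f \<in> Elt D. \<exists>g\<in>Elt D. Tgt D f = Src D g \<and> Tgt D g = Src D f \<and>
        Cmp D f g = Idt D (Src D f) \<and> Cmp D g f = Idt D (Tgt D f)}"

definition sharp :: "('o, 'e, 'z) cat_scheme \<Rightarrow> 'e set \<Rightarrow> 'e set" where
  "sharp D S =
     {Cmp D s e | s e. s \<in> S \<and> e \<in> cat_invertibles D \<and> Tgt D s = Src D e} \<union> cat_invertibles D"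

definition greedy_pair :: "('o, 'e, 'z) cat_scheme \<Rightarrow> 'e set \<Rightarrow> 'e \<Rightarrow> 'e \<Rightarrow> bool" where
  "greedy_pair D S b c \<longleftrightarrow>
     (\<forall>s\<in>S. \<forall>a\<in>Elt D. Tgt D a = Src D b \<longrightarrow>
        cat_divides D s (Cmp D (Cmp D a b) c) \<longrightarrow> cat_divides D s (Cmp D a b))"

definition normal_path :: "('o, 'e, 'z) cat_scheme \<Rightarrow> 'e set \<Rightarrow> ('o, 'e) path \<Rightarrow> bool" where
  "normal_path D S p \<longleftrightarrow>
     p \<in> paths D \<and> set (snd p) \<subseteq> sharp D S \<and>
     (\<forall>i. Suc i < length (snd p) \<longrightarrow> greedy_pair D S (snd p ! i) (snd p ! Suc i))"

definition garside_family :: "('o, 'e, 'z) cat_scheme \<Rightarrow> 'e set \<Rightarrow> bool" where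
  "garside_family D S \<longleftrightarrow>
     is_category D \<and> left_cancellative D \<and> S \<subseteq> Elt D \<and>
     (\<forall>g\<in>Elt D. \<exists>p. normal_path D S p \<and> path_value D p = g)"

definition garside_germ :: "('o, 'e) germ \<Rightarrow> bool" where
  "garside_germ \<Upsilon> \<longleftrightarrow> garside_family (germ_cat \<Upsilon>) (germ_emb \<Upsilon> ` Elt \<Upsilon>)"

definition solid_family :: "('o, 'e, 'z) cat_scheme \<Rightarrow> 'e set \<Rightarrow> bool" where
  "solid_family D S \<longleftrightarrow>
     S \<subseteq> Elt D \<and> Idt D ` Obj D \<subseteq> S \<and>
     (\<forall>f\<in>Elt D. \<forall>h\<in>Elt D. Tgt D h = Src D f \<longrightarrow> Cmp D h f \<in> S \<longrightarrow> f \<in> S)"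

text \<open>Caution: a solid generating family need not present the category.  In the commutative monoid on
  two free generators \<open>a\<close>, \<open>b\<close>, the family \<open>{1, a, b}\<close> is solid and generating, and its induced
  germ is a Garside germ, but the monoid generated by this germ is the free monoid on \<open>a\<close>, \<open>b\<close>.
  A solid Garside family does present the category.\<close>

definition generating_family :: "('o, 'e, 'z) cat_scheme \<Rightarrow> 'e set \<Rightarrow> bool" where
  "generating_family D S \<longleftrightarrow>
     S \<subseteq> Elt D \<and> (\<forall>g\<in>Elt D. \<exists>p\<in>paths D. set (snd p) \<subseteq> S \<and> path_value D p = g)"

section \<open>Deformation of paths\<close>

text \<open>Here \<open>pad_nth D p i\<close> is entry number \<open>i\<close>, counted from zero, of the path \<open>p\<close> prolonged by identities.
  Deformation is defined for paths of \<open>Cat\<langle>\<Upsilon>\<rangle>\<close>, since the entries of an \<open>\<Upsilon>\<close>-normal path lie in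
  \<open>\<Upsilon>\<^sup>\<sharp>\<close> rather than in \<open>\<Upsilon>\<close>; paths in \<open>\<Upsilon>\<close> are compared through their images.  The
  clause on the sources matters only if both paths have length zero.\<close>

definition pad_nth :: "('o, 'e, 'z) cat_scheme \<Rightarrow> ('o, 'e) path \<Rightarrow> nat \<Rightarrow> 'e" where
  "pad_nth D p i = (if i < length (snd p) then snd p ! i else Idt D (ptgt D p))"

definition deformation ::
    "('o, 'e) germ \<Rightarrow> ('o, ('o, 'e) path set) path \<Rightarrow> ('o, ('o, 'e) path set) path \<Rightarrow> bool" where
  "deformation \<Upsilon> a b \<longleftrightarrow>
     a \<in> paths (germ_cat \<Upsilon>) \<and> b \<in> paths (germ_cat \<Upsilon>) \<and> fst a = fst b \<and>
     (let D = germ_cat \<Upsilon>; l = max (length (snd a)) (length (snd b)) in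
      \<exists>\<epsilon> :: nat \<Rightarrow> 'e.
        (\<forall>i\<le>l. \<epsilon> i \<in> germ_invertibles \<Upsilon>) \<and>
        \<epsilon> 0 \<in> One \<Upsilon> ` Obj \<Upsilon> \<and> \<epsilon> l \<in> One \<Upsilon> ` Obj \<Upsilon> \<and>
        (\<forall>i<l.
           Tgt D (germ_emb \<Upsilon> (\<epsilon> i)) = Src D (pad_nth D b i) \<and>
           Tgt D (pad_nth D a i) = Src D (germ_emb \<Upsilon> (\<epsilon> (Suc i))) \<and>
           Cmp D (germ_emb \<Upsilon> (\<epsilon> i)) (pad_nth D b i) =
             Cmp D (pad_nth D a i) (germ_emb \<Upsilon> (\<epsilon> (Suc i)))))"

definition germ_path_equiv ::
    "('o, 'e) germ \<Rightarrow> ('o, 'e) path \<Rightarrow> ('o, 'e) path \<Rightarrow> bool" where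
  "germ_path_equiv \<Upsilon> p q \<longleftrightarrow>
     p \<in> paths \<Upsilon> \<and> q \<in> paths \<Upsilon> \<and> deformation \<Upsilon> (germ_emb_path \<Upsilon> p) (germ_emb_path \<Upsilon> q)"

section \<open>Reduction systems on paths\<close>

inductive reduction_step ::
    "('o, 'e, 'z) precat_scheme \<Rightarrow> (('o, 'e) path \<times> ('o, 'e) path) set
      \<Rightarrow> ('o, 'e) path \<Rightarrow> ('o, 'e) path \<Rightarrow> bool"
  for X S where
  "(w, v) \<in> S \<Longrightarrow> composable X a w \<Longrightarrow> composable X w b
    \<Longrightarrow> reduction_step X S (a \<odot> w \<odot> b) (a \<odot> v \<odot> b)"

definition irr_paths ::
    "('o, 'e, 'z) precat_scheme \<Rightarrow> (('o, 'e) path \<times> ('o, 'e) path) set \<Rightarrow> ('o, 'e) path set" where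
  "irr_paths X S = avoiding_paths X (fst ` S)"

definition resolvable_upto ::
    "('o, 'e, 'z) precat_scheme \<Rightarrow> (('o, 'e) path \<times> ('o, 'e) path) set
      \<Rightarrow> (('o, 'e) path \<Rightarrow> ('o, 'e) path \<Rightarrow> bool)
      \<Rightarrow> ('o, 'e) path \<Rightarrow> ('o, 'e) path \<Rightarrow> bool" where
  "resolvable_upto X S eqv p q \<longleftrightarrow>
     (\<exists>p' q'. (\<lambda>u v. reduction_step X S u v \<or> eqv u v)\<^sup>*\<^sup>* p p' \<and>
              (\<lambda>u v. reduction_step X S u v \<or> eqv u v)\<^sup>*\<^sup>* q q' \<and> eqv p' q')"

definition overlap_ambiguity ::
    "('o, 'e, 'z) precat_scheme \<Rightarrow> (('o, 'e) path \<times> ('o, 'e) path) set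
      \<Rightarrow> ('o, 'e) path \<times> ('o, 'e) path \<Rightarrow> ('o, 'e) path \<times> ('o, 'e) path
      \<Rightarrow> ('o, 'e) path \<Rightarrow> ('o, 'e) path \<Rightarrow> ('o, 'e) path \<Rightarrow> bool" where
  "overlap_ambiguity X S \<sigma> \<tau> a b c \<longleftrightarrow>
     \<sigma> \<in> S \<and> \<tau> \<in> S \<and> composable X a b \<and> composable X b c \<and>
     snd a \<noteq> [] \<and> snd b \<noteq> [] \<and> snd c \<noteq> [] \<and>
     fst \<sigma> = a \<odot> b \<and> fst \<tau> = b \<odot> c"

text \<open>In an inclusion ambiguity the outer paths \<open>a\<close> and \<open>c\<close> may have length zero, as in Bergman's
  diamond lemma: this is what the condition \<open>\<sigma> \<noteq> \<tau>\<close> is for, and it is the only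
  way in which two reductions of one and the same path are compared.\<close>

definition inclusion_ambiguity ::
    "('o, 'e, 'z) precat_scheme \<Rightarrow> (('o, 'e) path \<times> ('o, 'e) path) set
      \<Rightarrow> ('o, 'e) path \<times> ('o, 'e) path \<Rightarrow> ('o, 'e) path \<times> ('o, 'e) path
      \<Rightarrow> ('o, 'e) path \<Rightarrow> ('o, 'e) path \<Rightarrow> ('o, 'e) path \<Rightarrow> bool" where
  "inclusion_ambiguity X S \<sigma> \<tau> a b c \<longleftrightarrow>
     \<sigma> \<in> S \<and> \<tau> \<in> S \<and> \<sigma> \<noteq> \<tau> \<and> composable X a b \<and> composable X b c \<and> snd b \<noteq> [] \<and>
     fst \<sigma> = b \<and> fst \<tau> = a \<odot> b \<odot> c"

definition all_ambiguities_resolvable ::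
    "('o, 'e, 'z) precat_scheme \<Rightarrow> (('o, 'e) path \<times> ('o, 'e) path) set
      \<Rightarrow> (('o, 'e) path \<Rightarrow> ('o, 'e) path \<Rightarrow> bool) \<Rightarrow> bool" where
  "all_ambiguities_resolvable X S eqv \<longleftrightarrow>
     (\<forall>\<sigma> \<tau> a b c. overlap_ambiguity X S \<sigma> \<tau> a b c \<longrightarrow>
        resolvable_upto X S eqv (snd \<sigma> \<odot> c) (a \<odot> snd \<tau>)) \<and>
     (\<forall>\<sigma> \<tau> a b c. inclusion_ambiguity X S \<sigma> \<tau> a b c \<longrightarrow>
        resolvable_upto X S eqv (a \<odot> snd \<sigma> \<odot> c) (snd \<tau>))"

section \<open>The germ of a section and its reductions\<close>

text \<open>Words \<open>w\<close> in the set \<open>I\<close> of irreducible words stand for the morphisms \<open>ev w\<close> of \<open>A\<close>, so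
  \<open>E\<^sub>w\<close> is \<open>E (ev w)\<close>.  Since \<open>P E\<^sub>a = a\<close>, the composite \<open>ab\<close> attached to two elements
  \<open>\<alpha> = E\<^sub>a\<close>, \<open>\<beta> = E\<^sub>b\<close> of the germ is \<open>Cmp A (P \<alpha>) (P \<beta>)\<close>.  The units are a parameter, but
  being units for the product determines them.\<close>

definition section_germ ::
    "('o, 'm) cat \<Rightarrow> ('p, 'n) cat \<Rightarrow> ('m \<Rightarrow> 'n) \<Rightarrow> ('n \<Rightarrow> 'm) \<Rightarrow> ('w \<Rightarrow> 'n) \<Rightarrow> 'w set \<Rightarrow> 'w set
      \<Rightarrow> ('o \<Rightarrow> 'm) \<Rightarrow> ('o, 'm) germ" where
  "section_germ C A P E ev I B one =
     (let S = (\<lambda>w. E (ev w)) ` B in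
      \<lparr>Obj = Src C ` S \<union> Tgt C ` S,
       Elt = S,
       Src = Src C,
       Tgt = Tgt C,
       Mul = (\<lambda>\<alpha> \<beta>.
         let ab = Cmp A (P \<alpha>) (P \<beta>); w = normal_form ev I ab in
         if \<alpha> \<in> S \<and> \<beta> \<in> S \<and> Tgt C \<alpha> = Src C \<beta> \<and> w \<in> B \<and> E ab = Cmp C \<alpha> \<beta>
         then Some (E (ev w)) else None),
       One = one\<rparr>)"

definition germ_reductions ::
    "('o, 'm) germ \<Rightarrow> ('p, 'n) cat \<Rightarrow> ('n \<Rightarrow> 'm) \<Rightarrow> ('w \<Rightarrow> 'n) \<Rightarrow> 'w set \<Rightarrow> 'w set
      \<Rightarrow> (('o, 'm) path \<times> ('o, 'm) path) set" where
  "germ_reductions \<Upsilon> A E ev I B =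
     {((Src \<Upsilon> (E (ev x)), [E (ev x), E (ev y)]), (Src \<Upsilon> (E (ev x)), [E (ev z), E (ev y\<^sub>2)]))
      | x y y\<^sub>1 y\<^sub>2 z.
        x \<in> B \<and> y \<in> B \<and> y\<^sub>1 \<in> B \<and> y\<^sub>2 \<in> B \<and>
        Tgt \<Upsilon> (E (ev x)) = Src \<Upsilon> (E (ev y)) \<and>
        Tgt A (ev y\<^sub>1) = Src A (ev y\<^sub>2) \<and> ev y = Cmp A (ev y\<^sub>1) (ev y\<^sub>2) \<and>
        Mul \<Upsilon> (E (ev x)) (E (ev y\<^sub>1)) \<noteq> None \<and> Mul \<Upsilon> (E (ev y\<^sub>1)) (E (ev y\<^sub>2)) \<noteq> None \<and>
        z = normal_form ev I (Cmp A (ev x) (ev y\<^sub>1)) \<and>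
        germ_strictly_divides \<Upsilon> (E (ev x)) (E (ev z))}"

definition germ_reductions_bar ::
    "('o, 'm) germ \<Rightarrow> ('p, 'n) cat \<Rightarrow> ('n \<Rightarrow> 'm) \<Rightarrow> ('w \<Rightarrow> 'n) \<Rightarrow> 'w set \<Rightarrow> 'w set
      \<Rightarrow> (('o, 'm) path \<times> ('o, 'm) path) set" where
  "germ_reductions_bar \<Upsilon> A E ev I B =
     {\<sigma> \<in> germ_reductions \<Upsilon> A E ev I B. snd \<sigma> \<in> irr_paths \<Upsilon> (germ_reductions \<Upsilon> A E ev I B)}"

end

theory Submission
  imports Defs
begin

text \<open>
  The proof turns on one property of the germ \<open>\<Upsilon>\<close>, the existence of full slides.  A slide rewrites a
  composable pair \<open>(a, d)\<close> as \<open>(a \<bullet> t, u)\<close>, where \<open>d = t \<bullet> u\<close> and \<open>a \<bullet> t\<close> is defined; a full slide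
  is one for which \<open>a \<bullet> t\<close> is largest for divisibility.  The reductions are the slides that change
  \<open>a\<close> by more than a unit.  Both sides of the equivalence in the theorem amount to the statement that
  every composable pair has a full slide.

  If \<open>\<Upsilon>\<close> is a Garside germ, the first entry of a normal decomposition of \<open>a d\<close> is its greatest divisor in
  the germ, and this is a full slide of \<open>(a, d)\<close> (\<open>garside_has_full_slides\<close>).

  Conversely, full slides define an action, up to units, of the germ on pairs consisting of a head in
  \<open>\<Upsilon>\<close> and a rest in \<open>Cat\<langle>\<Upsilon>\<rangle>\<close>: multiplying by \<open>a\<close> slides as much as possible from the head to \<open>a\<close> and
  leaves the remainder to the rest.  The compatibility with products is \<open>full_slide_mul\<close>, where
  left-associativity enters.  So each morphism of \<open>Cat\<langle>\<Upsilon>\<rangle>\<close> has a well-defined head up to units.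
  Comparing the heads of \<open>a g\<close> and \<open>a g'\<close> shows that \<open>Cat\<langle>\<Upsilon>\<rangle>\<close> is left-cancellative, and the head is a
  greatest divisor behind any left factor, which is greediness.  Inserting letters one by one, each by
  means of reductions, then brings every path into normal form (\<open>reduces_to_normal\<close>).  Normal paths
  with the same value are deformations of one another since the products of their first \<open>i\<close> entries
  divide each other for all \<open>i\<close> (\<open>normal_paths_deformation\<close>).  Hence \<open>\<Upsilon>\<close> is a Garside germ, all
  ambiguities are resolvable, and irreducible paths are the normal ones.

  It remains to find full slides if all ambiguities are resolvable.  Reductions and deformations
  never decrease the first entry of a path.  On the other hand, a path obtained from \<open>(a, d)\<close>, possibly
  with identities appended, remains a slide of \<open>(a, d)\<close> up to units, so its first entry is bounded by
  the results of the reductions of \<open>(a, d)\<close> (\<open>confined_steps\<close>).  For \<open>d = t \<bullet> u\<close> the two ways to start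
  reducing the path \<open>(a, t, u)\<close> lead to a path with first entry \<open>a \<bullet> t\<close> and to \<open>(a, d)\<close> with an identity
  appended.  If they can be joined, \<open>a \<bullet> t\<close> obeys the same bound (\<open>slide_bound\<close>).  The inclusion
  ambiguities show that all reductions of \<open>(a, d)\<close> with irreducible results have the same first
  entry up to units; this is the bound, so such a reduction is a full slide.

  The last assertion is proved for a germ embedded in any category as a solid generating Garside
  family (\<open>solid_garside_presents\<close>): the functor from \<open>Cat\<langle>\<Upsilon>\<rangle>\<close> preserves heads, so morphisms with the
  same image are equal by induction on the length of a path.

  The presentation of \<open>A\<close> enters through the bijection between its morphisms and the irreducible
  words (\<open>groebner_normal_form\<close>), which makes the reductions, stated in terms of words, the slides of
  the germ.
\<close>

section \<open>Paths and the categories they present\<close>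

lemma ptgt_Nil [simp]: "ptgt X (x, []) = x"
  by (simp add: ptgt_def)

lemma ptgt_Cons [simp]: "ptgt X (x, e # es) = ptgt X (Tgt X e, es)"
  by (simp add: ptgt_def)

lemma chain_start: "chain X x es \<Longrightarrow> x \<in> Obj X"
  by (cases es) auto

lemma chain_append:
  "chain X x (es @ fs) \<longleftrightarrow> chain X x es \<and> chain X (ptgt X (x, es)) fs"
  by (induction es arbitrary: x) (auto dest: chain_start)

lemma chain_target: "chain X x es \<Longrightarrow> ptgt X (x, es) \<in> Obj X"
  by (induction es arbitrary: x) auto

lemma ptgt_append: "ptgt X (x, es @ fs) = ptgt X (ptgt X (x, es), fs)"
  by (induction es arbitrary: x) auto

lemma in_paths [simp]: "(x, es) \<in> paths X \<longleftrightarrow> chain X x es"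
  by (simp add: paths_def)

lemma pcat_Pair [simp]: "(x, es) \<odot> (y, fs) = (x, es @ fs)"
  by (simp add: pcat_def)

lemma composable_Pair [simp]:
  "composable X (x, es) (y, fs) \<longleftrightarrow> chain X x es \<and> chain X y fs \<and> ptgt X (x, es) = y"
  by (simp add: composable_def)

lemma pcat_assoc: "p \<odot> q \<odot> r = p \<odot> (q \<odot> r)"
  by (simp add: pcat_def)

lemma fst_pcat [simp]: "fst (p \<odot> q) = fst p"
  by (simp add: pcat_def)

lemma pcat_path: "composable X p q \<Longrightarrow> p \<odot> q \<in> paths X"
  by (cases p; cases q) (auto simp: chain_append)

lemma ptgt_pcat: "composable X p q \<Longrightarrow> ptgt X (p \<odot> q) = ptgt X q"
  by (cases p; cases q) (auto simp: ptgt_append)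

lemma ptgt_obj: "p \<in> paths X \<Longrightarrow> ptgt X p \<in> Obj X"
  by (cases p) (auto intro: chain_target)

lemma fst_obj: "p \<in> paths X \<Longrightarrow> fst p \<in> Obj X"
  by (cases p) (auto intro: chain_start)

locale presentation =
  fixes X :: "('o, 'e, 'z) precat_scheme" and R :: "(('o, 'e) path \<times> ('o, 'e) path) set"
  assumes relations: "is_relations X R"
begin

abbreviation cong (infix "\<simeq>" 50) where "p \<simeq> q \<equiv> pcong X R p q"
abbreviation "cls \<equiv> pclass X R"

lemma cong_parallel: "p \<simeq> q \<Longrightarrow> parallel X p q"
proof (induction rule: pcong.induct)
  case (pcong_rel u v)
  then show ?case using relations by (auto simp: is_relations_def)
next
  case (pcong_comp p q p' q')
  then have "composable X p p'" "composable X q q'"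
    by (auto simp: parallel_def composable_def)
  then show ?case using pcong_comp
    by (auto simp: parallel_def pcat_path ptgt_pcat)
qed (auto simp: parallel_def)

lemma cong_paths: "p \<simeq> q \<Longrightarrow> p \<in> paths X \<and> q \<in> paths X \<and> fst p = fst q \<and> ptgt X p = ptgt X q"
  using cong_parallel by (auto simp: parallel_def)

lemma cls_eqI: "p \<simeq> q \<Longrightarrow> cls p = cls q"
  by (auto simp: pclass_def intro: pcong_sym pcong_trans)

lemma cls_eq_iff: "q \<in> paths X \<Longrightarrow> cls p = cls q \<longleftrightarrow> p \<simeq> q"
  by (metis cls_eqI mem_Collect_eq pclass_def pcong_refl)

lemma some_cls:
  assumes "p \<in> paths X"
  shows "p \<simeq> (SOME q. q \<in> cls p)"
proof -
  have "p \<in> cls p"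
    using assms by (simp add: pclass_def pcong_refl)
  then have "(SOME q. q \<in> cls p) \<in> cls p"
    by (rule someI)
  then show ?thesis
    by (simp add: pclass_def)
qed

lemma presented_simps [simp]:
  "Obj (presented_cat X R) = Obj X"
  "Idt (presented_cat X R) x = cls (x, [])"
  "Elt (presented_cat X R) = cls ` paths X"
  by (simp_all add: presented_cat_def)

lemma Src_cls: "p \<in> paths X \<Longrightarrow> Src (presented_cat X R) (cls p) = fst p"
  using cong_paths[OF some_cls, of p] by (simp add: presented_cat_def)

lemma Tgt_cls: "p \<in> paths X \<Longrightarrow> Tgt (presented_cat X R) (cls p) = ptgt X p"
  using cong_paths[OF some_cls, of p] by (simp add: presented_cat_def)

lemma Cmp_cls:
  assumes "composable X p q"
  shows "Cmp (presented_cat X R) (cls p) (cls q) = cls (p \<odot> q)"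
proof -
  have "p \<odot> q \<simeq> (SOME r. r \<in> cls p) \<odot> (SOME r. r \<in> cls q)"
    using assms by (intro pcong_comp some_cls) (auto simp: composable_def)
  then show ?thesis
    by (simp add: presented_cat_def cls_eqI)
qed

lemma category_presented: "is_category (presented_cat X R)"
proof -
  let ?D = "presented_cat X R"
  have "is_precat ?D"
    by (auto simp: is_precat_def Src_cls Tgt_cls ptgt_obj fst_obj)
  moreover have "\<forall>x\<in>Obj ?D. Idt ?D x \<in> Elt ?D \<and> Src ?D (Idt ?D x) = x \<and> Tgt ?D (Idt ?D x) = x"
    by (auto simp: Src_cls Tgt_cls)
  moreover have "\<forall>f\<in>Elt ?D. \<forall>g\<in>Elt ?D. Tgt ?D f = Src ?D g \<longrightarrow>
      Cmp ?D f g \<in> Elt ?D \<and> Src ?D (Cmp ?D f g) = Src ?D f \<and> Tgt ?D (Cmp ?D f g) = Tgt ?D g"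
  proof (intro ballI impI)
    fix f g assume "f \<in> Elt ?D" "g \<in> Elt ?D" "Tgt ?D f = Src ?D g"
    then obtain p q where "f = cls p" "g = cls q" and pq: "composable X p q"
      by (auto simp: Src_cls Tgt_cls composable_def)
    moreover have "p \<in> paths X" "q \<in> paths X"
      using pq by (auto simp: composable_def)
    ultimately show "Cmp ?D f g \<in> Elt ?D \<and> Src ?D (Cmp ?D f g) = Src ?D f \<and> Tgt ?D (Cmp ?D f g) = Tgt ?D g"
      by (auto simp: Cmp_cls Src_cls Tgt_cls pcat_path ptgt_pcat)
  qed
  moreover have "\<forall>f\<in>Elt ?D. Cmp ?D (Idt ?D (Src ?D f)) f = f \<and> Cmp ?D f (Idt ?D (Tgt ?D f)) = f"
  proof
    fix f assume "f \<in> Elt ?D"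
    then obtain p where p: "p \<in> paths X" "f = cls p"
      by auto
    have "composable X (fst p, []) p" "composable X p (ptgt X p, [])"
      using p by (auto simp: composable_def fst_obj ptgt_obj)
    moreover have "(fst p, []) \<odot> p = p" "p \<odot> (ptgt X p, []) = p"
      by (simp_all add: pcat_def)
    ultimately show "Cmp ?D (Idt ?D (Src ?D f)) f = f \<and> Cmp ?D f (Idt ?D (Tgt ?D f)) = f"
      using p by (simp add: Src_cls Tgt_cls Cmp_cls)
  qed
  moreover have "\<forall>f\<in>Elt ?D. \<forall>g\<in>Elt ?D. \<forall>h\<in>Elt ?D. Tgt ?D f = Src ?D g \<longrightarrow> Tgt ?D g = Src ?D h \<longrightarrow>
      Cmp ?D (Cmp ?D f g) h = Cmp ?D f (Cmp ?D g h)"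
  proof (intro ballI impI)
    fix f g h
    assume "f \<in> Elt ?D" "g \<in> Elt ?D" "h \<in> Elt ?D" "Tgt ?D f = Src ?D g" "Tgt ?D g = Src ?D h"
    then obtain p q r where fgh: "f = cls p" "g = cls q" "h = cls r"
      and pqr: "composable X p q" "composable X q r"
      by (auto simp: Src_cls Tgt_cls composable_def)
    moreover have "composable X (p \<odot> q) r" "composable X p (q \<odot> r)"
      using pqr by (auto simp: composable_def pcat_path ptgt_pcat)
    ultimately show "Cmp ?D (Cmp ?D f g) h = Cmp ?D f (Cmp ?D g h)"
      by (simp add: Cmp_cls pcat_assoc)
  qed
  ultimately show ?thesis
    by (simp add: is_category_def)
qed

end

section \<open>Divisibility and greedy paths in a category\<close>

locale category =
  fixes D :: "('o, 'e, 'z) cat_scheme"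
  assumes category: "is_category D"
begin

abbreviation cmp (infixl "\<cdot>" 70) where "f \<cdot> g \<equiv> Cmp D f g"

lemma src_obj: "f \<in> Elt D \<Longrightarrow> Src D f \<in> Obj D"
  and tgt_obj: "f \<in> Elt D \<Longrightarrow> Tgt D f \<in> Obj D"
  using category by (auto simp: is_category_def is_precat_def)

lemma idt [simp]:
  "x \<in> Obj D \<Longrightarrow> Idt D x \<in> Elt D"
  "x \<in> Obj D \<Longrightarrow> Src D (Idt D x) = x"
  "x \<in> Obj D \<Longrightarrow> Tgt D (Idt D x) = x"
  using category by (auto simp: is_category_def)

lemma cmp [simp]:
  "\<lbrakk>f \<in> Elt D; g \<in> Elt D; Tgt D f = Src D g\<rbrakk> \<Longrightarrow> f \<cdot> g \<in> Elt D"
  "\<lbrakk>f \<in> Elt D; g \<in> Elt D; Tgt D f = Src D g\<rbrakk> \<Longrightarrow> Src D (f \<cdot> g) = Src D f"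
  "\<lbrakk>f \<in> Elt D; g \<in> Elt D; Tgt D f = Src D g\<rbrakk> \<Longrightarrow> Tgt D (f \<cdot> g) = Tgt D g"
  using category by (auto simp: is_category_def)

lemma cmp_idt [simp]:
  "\<lbrakk>f \<in> Elt D; Src D f = x\<rbrakk> \<Longrightarrow> Idt D x \<cdot> f = f"
  "\<lbrakk>f \<in> Elt D; Tgt D f = x\<rbrakk> \<Longrightarrow> f \<cdot> Idt D x = f"
  using category by (auto simp: is_category_def)

lemma cmp_assoc:
  "\<lbrakk>f \<in> Elt D; g \<in> Elt D; h \<in> Elt D; Tgt D f = Src D g; Tgt D g = Src D h\<rbrakk>
    \<Longrightarrow> f \<cdot> g \<cdot> h = f \<cdot> (g \<cdot> h)"
  using category by (auto simp: is_category_def)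

lemma lcancel:
  "\<lbrakk>left_cancellative D; f \<cdot> g = f \<cdot> h; f \<in> Elt D; g \<in> Elt D; h \<in> Elt D;
    Tgt D f = Src D g; Tgt D f = Src D h\<rbrakk> \<Longrightarrow> g = h"
  unfolding left_cancellative_def by blast

lemma dividesI: "\<lbrakk>h \<in> Elt D; Tgt D f = Src D h\<rbrakk> \<Longrightarrow> cat_divides D f (f \<cdot> h)"
  by (auto simp: cat_divides_def)

lemma divides_refl: "f \<in> Elt D \<Longrightarrow> cat_divides D f f"
  by (auto simp: cat_divides_def tgt_obj intro!: bexI[of _ "Idt D (Tgt D f)"])

lemma divides_trans:
  assumes "cat_divides D f g" "cat_divides D g h" "f \<in> Elt D"
  shows "cat_divides D f h"
proof -
  obtain k l where "k \<in> Elt D" "Tgt D f = Src D k" "g = f \<cdot> k" "l \<in> Elt D" "Tgt D g = Src D l" "h = g \<cdot> l"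
    using assms by (auto simp: cat_divides_def)
  then show ?thesis
    using assms(3) by (auto simp: cat_divides_def cmp_assoc intro!: bexI[of _ "k \<cdot> l"])
qed

lemma divides_src: "\<lbrakk>cat_divides D f g; f \<in> Elt D\<rbrakk> \<Longrightarrow> Src D f = Src D g"
  by (auto simp: cat_divides_def)

lemma divides_mult:
  assumes "cat_divides D f g" "f \<in> Elt D" "a \<in> Elt D" "Tgt D a = Src D f"
  shows "cat_divides D (a \<cdot> f) (a \<cdot> g)"
proof -
  obtain k where "k \<in> Elt D" "Tgt D f = Src D k" "g = f \<cdot> k"
    using assms by (auto simp: cat_divides_def)
  then show ?thesis
    using assms by (auto simp: cat_divides_def cmp_assoc intro!: bexI[of _ k])
qed

lemma divides_cancel:
  assumes "left_cancellative D" "cat_divides D (a \<cdot> f) (a \<cdot> g)"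
    "f \<in> Elt D" "g \<in> Elt D" "a \<in> Elt D" "Tgt D a = Src D f" "Tgt D a = Src D g"
  shows "cat_divides D f g"
proof -
  obtain k where k: "k \<in> Elt D" "Tgt D (a \<cdot> f) = Src D k" "a \<cdot> g = a \<cdot> f \<cdot> k"
    using assms by (auto simp: cat_divides_def)
  then have "g = f \<cdot> k"
    using assms by - (rule lcancel[of a], auto simp: cmp_assoc)
  then show ?thesis
    using k assms by (auto simp: cat_divides_def)
qed

lemma invertibleE:
  assumes "e \<in> cat_invertibles D"
  obtains e' where "e \<in> Elt D" "e' \<in> Elt D" "Tgt D e = Src D e'" "Tgt D e' = Src D e"
    "e \<cdot> e' = Idt D (Src D e)" "e' \<cdot> e = Idt D (Tgt D e)"
  using assms by (auto simp: cat_invertibles_def)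

lemma idt_invertible: "x \<in> Obj D \<Longrightarrow> Idt D x \<in> cat_invertibles D"
  by (auto simp: cat_invertibles_def intro!: bexI[of _ "Idt D x"])

lemma divides_unit_cancel:
  assumes "cat_divides D s (f \<cdot> e)" "e \<in> cat_invertibles D" "s \<in> Elt D" "f \<in> Elt D" "Tgt D f = Src D e"
  shows "cat_divides D s f"
proof -
  obtain e' where e: "e \<in> Elt D" "e' \<in> Elt D" "Tgt D e = Src D e'" "Tgt D e' = Src D e"
    "e \<cdot> e' = Idt D (Src D e)"
    using assms(2) by (elim invertibleE)
  then have "f = f \<cdot> e \<cdot> e'"
    using assms by (simp add: cmp_assoc)
  then have "cat_divides D (f \<cdot> e) f"
    using e assms by (metis cmp(3) dividesI)
  then show ?thesis
    using assms divides_trans by blast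
qed

text \<open>In a left-cancellative category two elements that divide each other differ by an invertible
  factor, which is how the units of a deformation arise.\<close>

lemma mutual_divides:
  assumes "left_cancellative D" "cat_divides D f g" "cat_divides D g f" "f \<in> Elt D"
  obtains e where "e \<in> cat_invertibles D" "Tgt D f = Src D e" "g = f \<cdot> e"
proof -
  obtain k where k: "k \<in> Elt D" "Tgt D f = Src D k" "g = f \<cdot> k"
    using assms by (auto simp: cat_divides_def)
  obtain l where l: "l \<in> Elt D" "Tgt D g = Src D l" "f = g \<cdot> l"
    using assms by (auto simp: cat_divides_def)
  have g: "g \<in> Elt D" "Tgt D g = Tgt D k"
    using k assms(4) by auto
  have types: "Tgt D k = Src D l" "Tgt D l = Src D k"
    using k(2) l(1,2) g cmp(3)[of g l] by (simp_all flip: l(3))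
  have "f \<cdot> (k \<cdot> l) = f \<cdot> k \<cdot> l"
    using k(1,2) l(1,2) types assms(4) by (intro cmp_assoc[symmetric])
  also have "\<dots> = f \<cdot> Idt D (Src D k)"
    using k(2) assms(4) by (simp flip: k(3) l(3))
  finally have kl: "k \<cdot> l = Idt D (Src D k)"
    using k(1,2) l(1) types assms(4)
    by - (rule lcancel[OF assms(1), of f "k \<cdot> l"], auto simp: src_obj)
  have "g \<cdot> (l \<cdot> k) = g \<cdot> l \<cdot> k"
    using k(1) l(1,2) g types by (intro cmp_assoc[symmetric])
  also have "\<dots> = g \<cdot> Idt D (Src D l)"
    using l(2) g by (simp flip: k(3) l(3))
  finally have "l \<cdot> k = Idt D (Src D l)"
    using k(1) l(1,2) g types
    by - (rule lcancel[OF assms(1), of g "l \<cdot> k"], auto simp: src_obj)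
  then have "k \<in> cat_invertibles D"
    using k(1) l(1) types kl by (auto simp: cat_invertibles_def)
  then show ?thesis
    using k that by blast
qed

lemma path_value_Nil [simp]: "path_value D (x, []) = Idt D x"
  by (simp add: path_value_def)

lemma path_value_Cons [simp]: "path_value D (x, e # es) = e \<cdot> path_value D (Tgt D e, es)"
  by (simp add: path_value_def)

lemma path_value_in:
  "chain D x es \<Longrightarrow> path_value D (x, es) \<in> Elt D \<and> Src D (path_value D (x, es)) = x \<and>
     Tgt D (path_value D (x, es)) = ptgt D (x, es)"
  by (induction es arbitrary: x) auto

lemma path_value_append:
  "chain D x (es @ fs) \<Longrightarrow>
     path_value D (x, es @ fs) = path_value D (x, es) \<cdot> path_value D (ptgt D (x, es), fs)"
proof (induction es arbitrary: x)
  case Nil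
  then show ?case using path_value_in[of x fs] by simp
next
  case (Cons e es)
  then have "chain D (Tgt D e) es" "chain D (ptgt D (Tgt D e, es)) fs"
    by (auto simp: chain_append)
  then show ?case
    using Cons path_value_in[of "Tgt D e" es] path_value_in[of "ptgt D (Tgt D e, es)" fs]
    by (simp add: cmp_assoc)
qed

lemma greedy_pair_sharp:
  assumes "greedy_pair D S b c" "S \<subseteq> Elt D" "s \<in> sharp D S" "a \<in> Elt D" "b \<in> Elt D" "c \<in> Elt D"
    "Tgt D a = Src D b" "Tgt D b = Src D c" "cat_divides D s (a \<cdot> b \<cdot> c)"
  shows "cat_divides D s (a \<cdot> b)"
  using assms(3) unfolding sharp_def
proof
  assume "s \<in> {Cmp D s e | s e. s \<in> S \<and> e \<in> cat_invertibles D \<and> Tgt D s = Src D e}"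
  then obtain s' e where s': "s = s' \<cdot> e" "s' \<in> S" "e \<in> cat_invertibles D" "Tgt D s' = Src D e"
    by blast
  obtain e' where e: "e \<in> Elt D" "e' \<in> Elt D" "Tgt D e = Src D e'" "Tgt D e' = Src D e"
    "e \<cdot> e' = Idt D (Src D e)"
    using s'(3) by (elim invertibleE)
  have "s' \<in> Elt D"
    using s' assms by blast
  then have "cat_divides D s' (a \<cdot> b \<cdot> c)"
    using divides_trans[OF _ assms(9), of s'] dividesI[of e s'] s' e by simp
  then have "cat_divides D s' (a \<cdot> b)"
    using assms s' by (auto simp: greedy_pair_def)
  then obtain k where k: "k \<in> Elt D" "Tgt D s' = Src D k" "a \<cdot> b = s' \<cdot> k"
    by (auto simp: cat_divides_def)
  have "s \<cdot> (e' \<cdot> k) = s' \<cdot> (e \<cdot> (e' \<cdot> k))"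
    using \<open>s' \<in> Elt D\<close> s'(1,4) e(1-4) k(1,2) by (simp add: cmp_assoc)
  also have "e \<cdot> (e' \<cdot> k) = e \<cdot> e' \<cdot> k"
    using s'(4) e(1-4) k(1,2) by (simp add: cmp_assoc)
  also have "\<dots> = k"
    using k(1,2) e(5) s'(4) by simp
  also have "s' \<cdot> k = a \<cdot> b"
    by (simp add: k(3))
  finally show ?thesis
    using \<open>s' \<in> Elt D\<close> s'(1,4) e(1-4) k(1,2)
    by (auto simp: cat_divides_def intro!: bexI[of _ "e' \<cdot> k"])
next
  assume "s \<in> cat_invertibles D"
  then obtain e' where e: "s \<in> Elt D" "e' \<in> Elt D" "Tgt D s = Src D e'" "Tgt D e' = Src D s"
    "s \<cdot> e' = Idt D (Src D s)"
    by (elim invertibleE)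
  have "Src D s = Src D a"
    using divides_src[OF assms(9)] e assms by simp
  have "s \<cdot> (e' \<cdot> (a \<cdot> b)) = s \<cdot> e' \<cdot> (a \<cdot> b)"
    using e(1-4) assms(4-8) \<open>Src D s = Src D a\<close> by (intro cmp_assoc[symmetric]) auto
  also have "\<dots> = a \<cdot> b"
    using e(5) assms(4-8) \<open>Src D s = Src D a\<close> by simp
  finally show ?thesis
    using e(1-4) assms(4-8) \<open>Src D s = Src D a\<close>
    unfolding cat_divides_def by (intro bexI[of _ "e' \<cdot> (a \<cdot> b)"]) auto
qed

text \<open>Greediness of consecutive pairs propagates along a path because it is tested behind an
  arbitrary left factor: drop the last entry, absorb the first one into the left factor, repeat.\<close>

lemma greedy_path_head:
  assumes "successively (greedy_pair D S) (b # bs)" "S \<subseteq> Elt D" "s \<in> sharp D S"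
    "a \<in> Elt D" "chain D (Tgt D a) (b # bs)"
    "cat_divides D s (a \<cdot> path_value D (Tgt D a, b # bs))"
  shows "cat_divides D s (a \<cdot> b)"
  using assms
proof (induction bs arbitrary: a b)
  case Nil
  then show ?case by simp
next
  case (Cons c cs)
  have types: "b \<in> Elt D" "c \<in> Elt D" "Tgt D a = Src D b" "Tgt D b = Src D c"
    "path_value D (Tgt D c, cs) \<in> Elt D" "Src D (path_value D (Tgt D c, cs)) = Tgt D c"
    using Cons.prems path_value_in[of "Tgt D c" cs] by auto
  have "cat_divides D s (a \<cdot> b \<cdot> c)"
    using Cons.prems types by - (rule Cons.IH, auto simp: cmp_assoc)
  then show ?case
    using greedy_pair_sharp[of S b c s a] Cons.prems types by simp
qed

end

section \<open>Left-associative and left-cancellative germs\<close>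

locale cancellative_germ =
  fixes Y :: "('o, 'e) germ"
  assumes germ: "is_germ Y"
    and left_cancellative_germ: "germ_left_cancellative Y"
    and left_associative_germ: "germ_left_associative Y"
begin

abbreviation mul (infixl "\<bullet>" 70) where "a \<bullet> b \<equiv> Mul Y a b"
abbreviation divides (infix "\<preceq>" 50) where "a \<preceq> b \<equiv> germ_divides Y a b"
abbreviation "units \<equiv> germ_invertibles Y"

lemma mulD:
  assumes "a \<bullet> b = Some c"
  shows "a \<in> Elt Y" "b \<in> Elt Y" "c \<in> Elt Y" "Tgt Y a = Src Y b"
    "Src Y c = Src Y a" "Tgt Y c = Tgt Y b"
  using assms germ unfolding is_germ_def by blast+

lemma one [simp]:
  assumes "x \<in> Obj Y"
  shows "One Y x \<in> Elt Y" "Src Y (One Y x) = x" "Tgt Y (One Y x) = x"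
  using assms germ unfolding is_germ_def by blast+

lemma src_tgt_obj [simp]:
  assumes "a \<in> Elt Y"
  shows "Src Y a \<in> Obj Y" "Tgt Y a \<in> Obj Y"
  using assms germ unfolding is_germ_def is_precat_def by blast+

lemma one_left: "\<lbrakk>a \<in> Elt Y; Src Y a = x\<rbrakk> \<Longrightarrow> One Y x \<bullet> a = Some a"
  and one_right: "\<lbrakk>a \<in> Elt Y; Tgt Y a = x\<rbrakk> \<Longrightarrow> a \<bullet> One Y x = Some a"
  using germ unfolding is_germ_def by blast+

lemma mul_assoc: "\<lbrakk>a \<bullet> b = Some ab; b \<bullet> c = Some bc\<rbrakk> \<Longrightarrow> ab \<bullet> c = a \<bullet> bc"
  using germ unfolding is_germ_def by metis

text \<open>Left-associativity turns a product bracketed to the left into one bracketed to the right; the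
  reverse passage may fail.\<close>

lemma mul_assocE:
  assumes "a \<bullet> b = Some ab" "ab \<bullet> c = Some d"
  obtains bc where "b \<bullet> c = Some bc" "a \<bullet> bc = Some d"
proof -
  obtain bc where "b \<bullet> c = Some bc"
    using assms left_associative_germ unfolding germ_left_associative_def by blast
  then show ?thesis
    using mul_assoc assms that by metis
qed

lemma mul_cancel: "\<lbrakk>a \<bullet> b = Some d; a \<bullet> c = Some d\<rbrakk> \<Longrightarrow> b = c"
  using left_cancellative_germ unfolding germ_left_cancellative_def by blast

lemma divides_iff: "a \<preceq> b \<longleftrightarrow> (\<exists>c. a \<bullet> c = Some b)"
  using mulD by (auto simp: germ_divides_def)

lemma gdvd_refl: "a \<in> Elt Y \<Longrightarrow> a \<preceq> a"
  using one_right divides_iff by blast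

lemma gdvd_trans: "\<lbrakk>a \<preceq> b; b \<preceq> c\<rbrakk> \<Longrightarrow> a \<preceq> c"
  by (auto simp: divides_iff elim: mul_assocE)

lemma gdvd_in: "a \<preceq> b \<Longrightarrow> a \<in> Elt Y \<and> b \<in> Elt Y \<and> Src Y a = Src Y b"
  using mulD by (metis divides_iff)

lemma mul_assoc_cancel:
  assumes "a \<bullet> b = Some ab" "ab \<bullet> c = Some d" "a \<bullet> x = Some d"
  shows "b \<bullet> c = Some x"
proof -
  obtain bc where "b \<bullet> c = Some bc" "a \<bullet> bc = Some d"
    using assms(1,2) by (rule mul_assocE) blast
  then show ?thesis
    using mul_cancel[OF _ assms(3)] by blast
qed

text \<open>Cancellation turns a right inverse into a two-sided one.\<close>

lemma right_inverse_unit: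
  assumes "a \<bullet> b = Some (One Y x)" "x \<in> Obj Y"
  shows "a \<in> units" "b \<in> units" "b \<bullet> a = Some (One Y (Tgt Y a))"
proof -
  have types: "a \<in> Elt Y" "b \<in> Elt Y" "Src Y a = x" "Tgt Y b = x" "Tgt Y a = Src Y b"
    using mulD[OF assms(1)] assms(2) by auto
  have "One Y x \<bullet> a = Some a"
    using types by (simp add: one_left)
  then obtain c where c: "b \<bullet> a = Some c" "a \<bullet> c = Some a"
    using mul_assocE assms(1) by metis
  then show ba: "b \<bullet> a = Some (One Y (Tgt Y a))"
    using mul_cancel one_right types by metis
  show "a \<in> units" "b \<in> units"
    using ba assms types by (auto simp: germ_invertibles_def)
qed

lemma unitE:
  assumes "e \<in> units"
  obtains e' where "e' \<in> units" "e \<bullet> e' = Some (One Y (Src Y e))" "e' \<bullet> e = Some (One Y (Tgt Y e))"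
    "e \<in> Elt Y" "e' \<in> Elt Y" "Src Y e' = Tgt Y e" "Tgt Y e' = Src Y e"
proof -
  obtain e' where e': "e \<bullet> e' = Some (One Y (Src Y e))" "e' \<bullet> e = Some (One Y (Tgt Y e))"
    using assms by (auto simp: germ_invertibles_def)
  then have "e \<in> Elt Y" "e' \<in> Elt Y" "Src Y e' = Tgt Y e" "Tgt Y e' = Src Y e"
    using mulD[OF e'(1)] mulD[OF e'(2)] by auto
  then show ?thesis
    using that e' right_inverse_unit(2)[OF e'(1)] by auto
qed

lemma unit_in: "e \<in> units \<Longrightarrow> e \<in> Elt Y"
  by (simp add: germ_invertibles_def)

lemma one_unit: "x \<in> Obj Y \<Longrightarrow> One Y x \<in> units"
  by (rule right_inverse_unit(1)[OF one_left, of _ x]) auto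

text \<open>Left-associativity makes the product of a unit with anything on its right defined:
  \<open>(e\<^sup>-\<^sup>1 \<bullet> e) \<bullet> a\<close> is defined, hence so is \<open>e \<bullet> a\<close>.  The product in the
  other order may be undefined.\<close>

lemma unit_mul:
  assumes "e \<in> units" "a \<in> Elt Y" "Tgt Y e = Src Y a"
  obtains b where "e \<bullet> a = Some b"
proof -
  obtain e' where "e' \<bullet> e = Some (One Y (Tgt Y e))"
    using assms(1) by (rule unitE) blast
  moreover have "One Y (Tgt Y e) \<bullet> a = Some a"
    using assms(2,3) by (simp add: one_left)
  ultimately show ?thesis
    using that by (rule mul_assocE)
qed

lemma unit_right_inverse:
  assumes "d \<bullet> e = Some d'" "e \<in> units"
  obtains e' where "e' \<in> units" "d' \<bullet> e' = Some d" "e \<bullet> e' = Some (One Y (Src Y e))"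
proof -
  obtain e' where e': "e' \<in> units" "e \<bullet> e' = Some (One Y (Src Y e))"
    using assms(2) by (rule unitE) blast
  then have "d' \<bullet> e' = Some d"
    using mul_assoc[OF assms(1) e'(2)] mulD[OF assms(1)] by (simp add: one_right)
  then show ?thesis
    using that e' by blast
qed

lemma mul_unit_dvd: "\<lbrakk>a \<bullet> e = Some b; e \<in> units\<rbrakk> \<Longrightarrow> b \<preceq> a"
  by (auto simp: divides_iff elim: unit_right_inverse)

lemma unit_factor:
  assumes "a \<bullet> b = Some c" "c \<in> units"
  shows "a \<in> units" "b \<in> units"
proof -
  obtain c' where c': "c \<bullet> c' = Some (One Y (Src Y c))" "c \<in> Elt Y"
    using assms(2) by (rule unitE) blast
  obtain d where d: "b \<bullet> c' = Some d" "a \<bullet> d = Some (One Y (Src Y c))"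
    using assms(1) c'(1) by (rule mul_assocE) blast
  then show "a \<in> units"
    using right_inverse_unit(1)[OF d(2)] c' by simp
  have "d \<in> units"
    using right_inverse_unit(2)[OF d(2)] c' by simp
  then obtain d' where d': "d \<bullet> d' = Some (One Y (Src Y d))" "d \<in> Elt Y"
    by (rule unitE) blast
  obtain x where "b \<bullet> x = Some (One Y (Src Y d))"
    using d(1) d'(1) by (rule mul_assocE) blast
  then show "b \<in> units"
    using right_inverse_unit(1)[of b x] d'(2) by simp
qed

lemma unit_mul_unit: "\<lbrakk>a \<bullet> b = Some c; a \<in> units; b \<in> units\<rbrakk> \<Longrightarrow> c \<in> units"
proof -
  assume a: "a \<bullet> b = Some c" "a \<in> units" "b \<in> units"
  obtain a' where a': "a \<bullet> a' = Some (One Y (Src Y a))" "a' \<in> Elt Y" "Src Y a' = Tgt Y a"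
    "a \<in> Elt Y"
    using a(2) by (rule unitE) blast
  obtain b' where b': "b \<bullet> b' = Some (One Y (Src Y b))" "b' \<in> units" "Tgt Y b' = Src Y b"
    using a(3) by (rule unitE) blast
  obtain d where d: "b' \<bullet> a' = Some d"
    using unit_mul[of b' a'] b' a' mulD[OF a(1)] by auto
  have "b \<bullet> d = Some a'"
    using mul_assoc[OF b'(1) d] one_left[of a'] a' mulD[OF a(1)] by simp
  then have "c \<bullet> d = Some (One Y (Src Y a))"
    using mul_assoc[OF a(1)] a' by simp
  then show "c \<in> units"
    using right_inverse_unit(1)[of c d] a' by simp
qed

lemma mutual_dvd:
  assumes "a \<preceq> b" "b \<preceq> a"
  obtains e where "e \<in> units" "a \<bullet> e = Some b"
proof -
  obtain e e' where e: "a \<bullet> e = Some b" "b \<bullet> e' = Some a"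
    using assms divides_iff by auto
  then obtain d where d: "e \<bullet> e' = Some d" "a \<bullet> d = Some a"
    by (rule mul_assocE) blast
  then have "d = One Y (Tgt Y a)"
    using mul_cancel[OF d(2) one_right] mulD(1)[OF d(2)] by simp
  then show ?thesis
    using that e d right_inverse_unit(1)[of e e' "Tgt Y a"] mulD(1)[OF d(2)] by simp
qed

subsection \<open>Sliding a factor to the left\<close>

text \<open>\<open>slide a d m u\<close> rewrites a composable pair \<open>(a, d)\<close> as \<open>(m, u)\<close> by moving a left factor of
  \<open>d\<close> over to \<open>a\<close>.  A reduction of the germ is a slide that changes \<open>a\<close> by more than a unit, a
  tight pair is an irreducible one, and a full slide moves as much as possible.\<close>

definition slide :: "'e \<Rightarrow> 'e \<Rightarrow> 'e \<Rightarrow> 'e \<Rightarrow> bool" where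
  "slide a d m u \<longleftrightarrow> (\<exists>t. a \<bullet> t = Some m \<and> t \<bullet> u = Some d)"

definition tight :: "'e \<Rightarrow> 'e \<Rightarrow> bool" where
  "tight a d \<longleftrightarrow> (\<forall>m u. slide a d m u \<longrightarrow> m \<preceq> a)"

definition full_slide :: "'e \<Rightarrow> 'e \<Rightarrow> 'e \<Rightarrow> 'e \<Rightarrow> bool" where
  "full_slide a d m u \<longleftrightarrow> slide a d m u \<and> (\<forall>m' u'. slide a d m' u' \<longrightarrow> m' \<preceq> m)"

definition has_full_slides :: bool where
  "has_full_slides \<longleftrightarrow>
     (\<forall>a\<in>Elt Y. \<forall>d\<in>Elt Y. Tgt Y a = Src Y d \<longrightarrow> (\<exists>m u. full_slide a d m u))"

lemma slideD:
  assumes "slide a d m u"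
  shows "a \<in> Elt Y" "d \<in> Elt Y" "m \<in> Elt Y" "u \<in> Elt Y" "Tgt Y a = Src Y d"
    "Src Y m = Src Y a" "Tgt Y m = Src Y u" "Tgt Y u = Tgt Y d" "a \<preceq> m"
proof -
  obtain t where t: "a \<bullet> t = Some m" "t \<bullet> u = Some d"
    using assms by (auto simp: slide_def)
  show "a \<in> Elt Y" "d \<in> Elt Y" "m \<in> Elt Y" "u \<in> Elt Y" "Tgt Y a = Src Y d"
    "Src Y m = Src Y a" "Tgt Y m = Src Y u" "Tgt Y u = Tgt Y d" "a \<preceq> m"
    using mulD[OF t(1)] mulD[OF t(2)] t by (auto simp: divides_iff)
qed

lemma slide_trans:
  assumes "slide a d m u" "slide m u m' u'"
  shows "slide a d m' u'"
proof -
  obtain t where t: "a \<bullet> t = Some m" "t \<bullet> u = Some d"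
    using assms by (auto simp: slide_def)
  obtain s where s: "m \<bullet> s = Some m'" "s \<bullet> u' = Some u"
    using assms by (auto simp: slide_def)
  obtain ts where ts: "t \<bullet> s = Some ts" "a \<bullet> ts = Some m'"
    using t(1) s(1) by (rule mul_assocE) blast
  have "ts \<bullet> u' = Some d"
    using mul_assoc[OF ts(1) s(2)] t(2) by simp
  then show ?thesis
    using ts by (auto simp: slide_def)
qed

text \<open>Whatever could still be slid out of the result of a full slide could have been slid in the first
  place.\<close>

lemma full_slide_tight: "full_slide a d m u \<Longrightarrow> tight m u"
  unfolding full_slide_def tight_def using slide_trans by blast

text \<open>Replacing \<open>d\<close> by \<open>d \<bullet> e\<close> with a unit \<open>e\<close> does not change what can be slid out of it.\<close>

lemma slide_unit_right:
  assumes "slide a d m u" "d \<bullet> e = Some d'"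
  obtains u' where "u \<bullet> e = Some u'" "slide a d' m u'"
proof -
  obtain t where t: "a \<bullet> t = Some m" "t \<bullet> u = Some d"
    using assms by (auto simp: slide_def)
  obtain u' where "u \<bullet> e = Some u'" "t \<bullet> u' = Some d'"
    using t(2) assms(2) by (rule mul_assocE) blast
  then show ?thesis
    using t that by (auto simp: slide_def)
qed

lemma tight_unit_right:
  assumes "tight a d'" "d \<bullet> e = Some d'"
  shows "tight a d"
  unfolding tight_def
proof (intro allI impI)
  fix m u assume "slide a d m u"
  then obtain u' where "slide a d' m u'"
    using assms(2) by (rule slide_unit_right) blast
  then show "m \<preceq> a"
    using assms(1) by (auto simp: tight_def)
qed

lemma full_slide_unit_right:
  assumes "full_slide a d m u" "d \<bullet> e = Some d'" "e \<in> units"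
  obtains u' where "u \<bullet> e = Some u'" "full_slide a d' m u'"
proof -
  have "slide a d m u"
    using assms(1) by (simp add: full_slide_def)
  then obtain u' where u': "u \<bullet> e = Some u'" "slide a d' m u'"
    using assms(2) by (rule slide_unit_right) blast
  obtain e' where e': "d' \<bullet> e' = Some d"
    using assms(2,3) by (rule unit_right_inverse) blast
  have "n \<preceq> m" if "slide a d' n v" for n v
  proof -
    obtain v' where "slide a d n v'"
      using \<open>slide a d' n v\<close> e' by (rule slide_unit_right) blast
    then show ?thesis
      using assms(1) by (auto simp: full_slide_def)
  qed
  then have "full_slide a d' m u'"
    using u' by (auto simp: full_slide_def)
  then show ?thesis
    using that u' by blast
qed

lemma full_slide_unique:
  assumes "full_slide a d m u" "full_slide a d m' u'"
  obtains e where "e \<in> units" "m \<bullet> e = Some m'" "e \<bullet> u' = Some u"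
proof -
  have "m \<preceq> m'" "m' \<preceq> m"
    using assms by (auto simp: full_slide_def)
  then obtain e where e: "e \<in> units" "m \<bullet> e = Some m'"
    by (rule mutual_dvd) blast
  obtain t where t: "a \<bullet> t = Some m" "t \<bullet> u = Some d"
    using assms by (auto simp: slide_def full_slide_def)
  obtain t' where t': "a \<bullet> t' = Some m'" "t' \<bullet> u' = Some d"
    using assms by (auto simp: slide_def full_slide_def)
  have "t \<bullet> e = Some t'"
    using mul_assoc_cancel[OF t(1) e(2) t'(1)] .
  then have "e \<bullet> u' = Some u"
    by (rule mul_assoc_cancel[OF _ t'(2) t(2)])
  then show ?thesis
    using that e by blast
qed

lemma full_slide_one_left:
  assumes "d \<in> Elt Y" "Src Y d = x"
  shows "full_slide (One Y x) d d (One Y (Tgt Y d))"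
proof -
  have "m \<preceq> d" if "slide (One Y x) d m u" for m u
  proof -
    obtain t where t: "One Y x \<bullet> t = Some m" "t \<bullet> u = Some d"
      using \<open>slide (One Y x) d m u\<close> by (auto simp: slide_def)
    have "t \<in> Elt Y" "Src Y t = x"
      using mulD[OF t(2)] assms by auto
    then have "m = t"
      using t(1) one_left[of t x] by simp
    then show ?thesis
      using t(2) divides_iff by auto
  qed
  moreover have "slide (One Y x) d d (One Y (Tgt Y d))"
    unfolding slide_def using assms one_left[of d x] one_right[of d]
    by (intro exI[of _ d]) auto
  ultimately show ?thesis
    by (simp add: full_slide_def)
qed

lemma full_slide_one_right:
  assumes "a \<in> Elt Y" "Tgt Y a = x"
  shows "full_slide a (One Y x) a (One Y x)"
proof -
  have "m \<preceq> a" if "slide a (One Y x) m u" for m u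
    using that right_inverse_unit(1)[of _ u x] mul_unit_dvd assms by (auto simp: slide_def)
  moreover have "slide a (One Y x) a (One Y x)"
    unfolding slide_def using assms one_right[of a x] one_left[of "One Y x" x]
    by (intro exI[of _ "One Y x"]) auto
  ultimately show ?thesis
    by (simp add: full_slide_def)
qed

text \<open>Full slides are compatible with the product: sliding into \<open>b\<close> and then into \<open>a\<close> amounts to
  one full slide into \<open>a \<bullet> b\<close>.  Whatever slides into \<open>a \<bullet> b\<close> slides into \<open>b\<close> by
  left-associativity, so nothing is missed by the two-stage process.  This makes the germ act on
  the pairs consisting of a head and a remainder.\<close>

lemma full_slide_mul:
  assumes "a \<bullet> b = Some c" "full_slide b d n u" "full_slide a n m v"
  obtains w where "v \<bullet> u = Some w" "full_slide c d m w"
proof -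
  obtain t where t: "b \<bullet> t = Some n" "t \<bullet> u = Some d"
    using assms by (auto simp: slide_def full_slide_def)
  obtain s where s: "a \<bullet> s = Some m" "s \<bullet> v = Some n"
    using assms by (auto simp: slide_def full_slide_def)
  have "slide a n c t"
    using assms(1) t(1) by (auto simp: slide_def)
  then have "c \<preceq> m"
    using assms(3) by (auto simp: full_slide_def)
  then obtain y where y: "c \<bullet> y = Some m"
    by (auto simp: divides_iff)
  have by_s: "b \<bullet> y = Some s"
    using mul_assoc_cancel[OF assms(1) y s(1)] .
  have yv: "y \<bullet> v = Some t"
    using mul_assoc_cancel[OF by_s s(2) t(1)] .
  obtain w where w: "v \<bullet> u = Some w" "y \<bullet> w = Some d"
    using yv t(2) by (rule mul_assocE) blast
  have "m' \<preceq> m" if "slide c d m' w'" for m' w'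
  proof -
    obtain t' where t': "c \<bullet> t' = Some m'" "t' \<bullet> w' = Some d"
      using \<open>slide c d m' w'\<close> by (auto simp: slide_def)
    obtain n' where n': "b \<bullet> t' = Some n'" "a \<bullet> n' = Some m'"
      using assms(1) t'(1) by (rule mul_assocE) blast
    have "slide b d n' w'"
      using n'(1) t'(2) by (auto simp: slide_def)
    then obtain x where "n' \<bullet> x = Some n"
      using assms(2) by (auto simp: full_slide_def divides_iff)
    then have "slide a n m' x"
      using n'(2) by (auto simp: slide_def)
    then show ?thesis
      using assms(3) by (auto simp: full_slide_def)
  qed
  then have "full_slide c d m w"
    using y w by (auto simp: full_slide_def slide_def)
  then show ?thesis
    using that w by blast
qed

end

section \<open>Germs embedded in a category as solid families\<close>

text \<open>Two instances matter: the category generated by the germ, and a category whose own product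
  induces that of the germ on a solid family.  The category and the germ have the same objects.\<close>

locale solid_embedding = cancellative_germ Y + category D
  for Y :: "('o, 'e) germ" and D :: "('o, 'f, 'z) cat_scheme" +
  fixes emb :: "'e \<Rightarrow> 'f"
  assumes obj_eq: "Obj D = Obj Y"
    and emb: "a \<in> Elt Y \<Longrightarrow> emb a \<in> Elt D" "a \<in> Elt Y \<Longrightarrow> Src D (emb a) = Src Y a"
      "a \<in> Elt Y \<Longrightarrow> Tgt D (emb a) = Tgt Y a"
    and emb_one: "x \<in> Obj Y \<Longrightarrow> emb (One Y x) = Idt D x"
    and emb_mul_iff: "\<lbrakk>a \<in> Elt Y; b \<in> Elt Y; c \<in> Elt Y; Tgt Y a = Src Y b\<rbrakk>
      \<Longrightarrow> Cmp D (emb a) (emb b) = emb c \<longleftrightarrow> Mul Y a b = Some c"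
    and emb_solid: "\<lbrakk>f \<in> Elt D; g \<in> Elt D; Tgt D f = Src D g; Cmp D f g \<in> emb ` Elt Y\<rbrakk>
      \<Longrightarrow> g \<in> emb ` Elt Y"
begin

declare emb [simp]

lemma emb_subset: "emb ` Elt Y \<subseteq> Elt D"
  by auto

lemma emb_mul: "a \<bullet> b = Some c \<Longrightarrow> emb a \<cdot> emb b = emb c"
  using emb_mul_iff mulD(1-4) by blast

lemma emb_inj: "\<lbrakk>emb a = emb b; a \<in> Elt Y; b \<in> Elt Y\<rbrakk> \<Longrightarrow> a = b"
proof -
  assume "emb a = emb b" and ab: "a \<in> Elt Y" "b \<in> Elt Y"
  have "emb (One Y (Src Y a)) \<cdot> emb a = emb b"
    using ab(1) by (simp add: emb_one flip: \<open>emb a = emb b\<close>)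
  then have "One Y (Src Y a) \<bullet> a = Some b"
    using ab emb_mul_iff[of "One Y (Src Y a)" a b] by simp
  then show "a = b"
    using ab one_left[of a] by simp
qed

text \<open>Solidity puts the cofactor of a division inside the family, so divisibility of elements of the
  germ means the same in the category.\<close>

lemma emb_divides_iff:
  assumes "a \<in> Elt Y" "b \<in> Elt Y"
  shows "cat_divides D (emb a) (emb b) \<longleftrightarrow> a \<preceq> b"
proof
  assume "cat_divides D (emb a) (emb b)"
  then obtain h where h: "h \<in> Elt D" "Tgt D (emb a) = Src D h" "emb b = emb a \<cdot> h"
    by (auto simp: cat_divides_def)
  then have "h \<in> emb ` Elt Y"
    using emb_solid[of "emb a" h] assms by (metis emb(1) imageI)
  then obtain c where c: "h = emb c" "c \<in> Elt Y"
    by blast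
  then have "a \<bullet> c = Some b"
    using h assms emb_mul_iff[of a c b] by simp
  then show "a \<preceq> b"
    by (auto simp: divides_iff)
next
  assume "a \<preceq> b"
  then obtain c where "a \<bullet> c = Some b"
    by (auto simp: divides_iff)
  then have "emb b = emb a \<cdot> emb c" "c \<in> Elt Y" "Tgt Y a = Src Y c"
    using emb_mul mulD by auto
  then show "cat_divides D (emb a) (emb b)"
    using assms by (auto intro: dividesI)
qed

lemma invertible_in_emb:
  assumes "f \<in> cat_invertibles D"
  obtains e where "e \<in> units" "f = emb e"
proof -
  obtain f' where f: "f \<in> Elt D" "f' \<in> Elt D" "Tgt D f = Src D f'" "Tgt D f' = Src D f"
    "f \<cdot> f' = Idt D (Src D f)" "f' \<cdot> f = Idt D (Tgt D f)"
    using assms by (rule invertibleE) blast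
  have obj: "Src D f \<in> Obj Y" "Tgt D f \<in> Obj Y"
    using f src_obj tgt_obj obj_eq by auto
  have "Idt D (Src D f) \<in> emb ` Elt Y" "Idt D (Tgt D f) \<in> emb ` Elt Y"
    using obj by (metis emb_one imageI one(1))+
  then have "f' \<in> emb ` Elt Y" "f \<in> emb ` Elt Y"
    using emb_solid f by metis+
  then obtain e e' where e: "f = emb e" "f' = emb e'" "e \<in> Elt Y" "e' \<in> Elt Y"
    by blast
  have "e \<bullet> e' = Some (One Y (Src Y e))"
    using emb_mul_iff[of e e' "One Y (Src Y e)"] e f by (simp add: emb_one)
  then have "e \<in> units"
    using right_inverse_unit(1)[of e e'] e by simp
  then show ?thesis
    using that e by blast
qed

lemma emb_in_sharp: "a \<in> Elt Y \<Longrightarrow> emb a \<in> sharp D (emb ` Elt Y)"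
proof -
  assume "a \<in> Elt Y"
  then have "emb a = emb a \<cdot> Idt D (Tgt Y a)" "Idt D (Tgt Y a) \<in> cat_invertibles D"
    "Tgt D (emb a) = Src D (Idt D (Tgt Y a))"
    by (auto simp: obj_eq intro: idt_invertible)
  then show ?thesis
    using \<open>a \<in> Elt Y\<close> unfolding sharp_def by blast
qed

text \<open>Identities belong to the family, so an invertible element is of the first of the two kinds of
  elements of \<open>S\<^sup>\<sharp>\<close> as well.\<close>

lemma sharpE:
  assumes "b \<in> sharp D (emb ` Elt Y)"
  obtains a e where "a \<in> Elt Y" "e \<in> cat_invertibles D" "Tgt Y a = Src D e" "b = emb a \<cdot> e"
  using assms unfolding sharp_def
proof
  assume "b \<in> {Cmp D s e | s e. s \<in> emb ` Elt Y \<and> e \<in> cat_invertibles D \<and> Tgt D s = Src D e}"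
  then show ?thesis
    using that by auto
next
  assume b: "b \<in> cat_invertibles D"
  then have "b \<in> Elt D" "Src D b \<in> Obj Y"
    using src_obj[of b] by (auto simp: cat_invertibles_def obj_eq)
  then show ?thesis
    using that[of "One Y (Src D b)" b] b by (simp add: emb_one)
qed

text \<open>The first entry of a normal decomposition of \<open>g\<close> is the largest divisor of \<open>g\<close> in the family,
  up to a unit, and greediness makes this persist behind an arbitrary left factor.\<close>

definition greatest_divisor :: "'e \<Rightarrow> 'f \<Rightarrow> bool" where
  "greatest_divisor s g \<longleftrightarrow> s \<in> Elt Y \<and> cat_divides D (emb s) g \<and>
     (\<forall>a\<in>Elt D. \<forall>r\<in>Elt Y. Tgt D a = Src D g \<longrightarrow> cat_divides D (emb r) (a \<cdot> g)
        \<longrightarrow> cat_divides D (emb r) (a \<cdot> emb s))"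

lemma garside_greatest_divisor:
  assumes "garside_family D (emb ` Elt Y)" "g \<in> Elt D"
  obtains s where "greatest_divisor s g"
proof -
  obtain x es where p: "normal_path D (emb ` Elt Y) (x, es)" "path_value D (x, es) = g"
    using assms unfolding garside_family_def by (metis surj_pair)
  then have chain: "chain D x es" and sharp: "set es \<subseteq> sharp D (emb ` Elt Y)"
    and greedy: "successively (greedy_pair D (emb ` Elt Y)) es"
    by (auto simp: normal_path_def successively_conv_nth)
  show ?thesis
  proof (cases es)
    case Nil
    then have "g = emb (One Y x)" "One Y x \<in> Elt Y"
      using p chain by (auto simp: emb_one obj_eq)
    then have "greatest_divisor (One Y x) g"
      using divides_refl assms(2) by (auto simp: greatest_divisor_def)
    then show ?thesis
      by (rule that)
  next
    case (Cons b bs)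
    obtain s e where s: "s \<in> Elt Y" "e \<in> cat_invertibles D" "Tgt Y s = Src D e" "b = emb s \<cdot> e"
      using sharp Cons by (auto elim: sharpE)
    have e: "e \<in> Elt D"
      using s(2) by (simp add: cat_invertibles_def)
    let ?g' = "path_value D (Tgt D b, bs)"
    have g: "g = b \<cdot> ?g'" "?g' \<in> Elt D" "Src D ?g' = Tgt D b" "b \<in> Elt D" "Src D b = x" "Src D g = x"
      using p chain Cons path_value_in[of "Tgt D b" bs] by auto
    have "cat_divides D (emb s) b"
      using s e by (auto intro: dividesI)
    then have "cat_divides D (emb s) g"
      using s g divides_trans[of "emb s" b g] dividesI[of ?g' b] by simp
    moreover have "cat_divides D (emb r) (a \<cdot> emb s)"
      if a: "a \<in> Elt D" "r \<in> Elt Y" "Tgt D a = Src D g" "cat_divides D (emb r) (a \<cdot> g)" for a r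
    proof -
      have "cat_divides D (emb r) (a \<cdot> b)"
        using greedy_path_head[of "emb ` Elt Y" b bs "emb r" a] greedy chain Cons a g p(2)
          emb_subset emb_in_sharp[of r] by simp
      moreover have "a \<cdot> b = a \<cdot> emb s \<cdot> e"
        using s e a g cmp_assoc[of a "emb s" e] by simp
      ultimately show ?thesis
        using divides_unit_cancel[of "emb r" "a \<cdot> emb s" e] s e a g by simp
    qed
    ultimately have "greatest_divisor s g"
      using s by (auto simp: greatest_divisor_def)
    then show ?thesis
      by (rule that)
  qed
qed

lemma slide_cmp:
  assumes "slide a d m u"
  shows "emb a \<cdot> emb d = emb m \<cdot> emb u"
proof -
  obtain t where t: "a \<bullet> t = Some m" "t \<bullet> u = Some d"
    using assms by (auto simp: slide_def)
  show ?thesis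
    using mulD[OF t(1)] mulD[OF t(2)]
    by (simp add: cmp_assoc flip: emb_mul[OF t(1)] emb_mul[OF t(2)])
qed

text \<open>A slide \<open>(m, u)\<close> of \<open>(a, d)\<close> is the same as a factorization \<open>a d = m u\<close> with \<open>a\<close> dividing \<open>m\<close>
  and \<open>m\<close> in the germ: cancelling \<open>a\<close> exhibits \<open>u\<close> as a right divisor of \<open>d\<close>.  So the greatest
  divisor of \<open>a d\<close> in the germ is what a full slide produces.\<close>

lemma greatest_divisor_full_slide:
  assumes "left_cancellative D" "greatest_divisor s (emb a \<cdot> emb d)"
    "a \<in> Elt Y" "d \<in> Elt Y" "Tgt Y a = Src Y d"
  obtains u where "full_slide a d s u"
proof -
  let ?g = "emb a \<cdot> emb d" and ?x = "Src Y a"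
  have greatest: "r \<preceq> s" if "r \<in> Elt Y" "cat_divides D (emb r) ?g" for r
  proof -
    have "Src D (emb s) = ?x"
      using divides_src[of "emb s" ?g] assms by (auto simp: greatest_divisor_def)
    then have "cat_divides D (emb r) (Idt D ?x \<cdot> emb s)"
      using assms that unfolding greatest_divisor_def
      by (metis cmp(1) cmp(2) cmp_idt(1) emb idt(1,3) obj_eq src_tgt_obj(1))
    then show ?thesis
      using that assms \<open>Src D (emb s) = ?x\<close> by (simp add: greatest_divisor_def emb_divides_iff)
  qed
  have "a \<preceq> s"
    using assms by (intro greatest) (auto intro: dividesI)
  then obtain t where t: "a \<bullet> t = Some s"
    by (auto simp: divides_iff)
  note t' = mulD[OF t]
  obtain h where h: "h \<in> Elt D" "Tgt D (emb s) = Src D h" "?g = emb s \<cdot> h"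
    using assms(2) by (auto simp: greatest_divisor_def cat_divides_def)
  have "emb a \<cdot> (emb t \<cdot> h) = emb s \<cdot> h"
    using t' h by (simp add: cmp_assoc[symmetric] emb_mul[OF t])
  then have th: "emb d = emb t \<cdot> h"
    using assms t' h by - (rule lcancel[of "emb a"], auto)
  then have "h \<in> emb ` Elt Y"
    using emb_solid[of "emb t" h] t' h(1,2) assms(4) by (simp flip: th)
  then obtain u where u: "h = emb u" "u \<in> Elt Y"
    by blast
  then have "t \<bullet> u = Some d"
    using emb_mul_iff[of t u d] th t' h assms by simp
  then have "slide a d s u"
    using t by (auto simp: slide_def)
  moreover have "m \<preceq> s" if "slide a d m v" for m v
    using slideD[OF that] slide_cmp[OF that] by (intro greatest) (auto intro: dividesI)
  ultimately have "full_slide a d s u"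
    by (simp add: full_slide_def)
  then show ?thesis
    by (rule that)
qed

theorem garside_has_full_slides:
  assumes "garside_family D (emb ` Elt Y)"
  shows "has_full_slides"
  unfolding has_full_slides_def
proof (intro ballI impI)
  fix a d assume ad: "a \<in> Elt Y" "d \<in> Elt Y" "Tgt Y a = Src Y d"
  then have "emb a \<cdot> emb d \<in> Elt D"
    by simp
  then obtain s where s: "greatest_divisor s (emb a \<cdot> emb d)"
    using assms by (blast elim: garside_greatest_divisor)
  have "left_cancellative D"
    using assms by (simp add: garside_family_def)
  then obtain u where "full_slide a d s u"
    using s ad by (rule greatest_divisor_full_slide) blast
  then show "\<exists>m u. full_slide a d m u"
    by blast
qed

text \<open>Two slides of the same pair that are both full agree up to a unit, so the head of a full slide
  is the greatest divisor of the product.\<close>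

lemma full_slide_greatest_divisor:
  assumes "garside_family D (emb ` Elt Y)" "full_slide a d m u"
  shows "greatest_divisor m (emb a \<cdot> emb d)"
proof -
  have slide: "slide a d m u"
    using assms by (simp add: full_slide_def)
  note ad = slideD[OF slide]
  have "emb a \<cdot> emb d \<in> Elt D"
    using ad by simp
  then obtain s where s: "greatest_divisor s (emb a \<cdot> emb d)"
    using assms(1) by (blast elim: garside_greatest_divisor)
  have "left_cancellative D"
    using assms by (simp add: garside_family_def)
  then obtain v where "full_slide a d s v"
    using s ad(1,2,5) by (rule greatest_divisor_full_slide) blast
  then have "s \<preceq> m"
    using assms(2) by (auto simp: full_slide_def)
  then have sm: "cat_divides D (emb s) (emb m)" "Src Y s = Src Y m" "s \<in> Elt Y"
    using gdvd_in[of s m] by (auto simp: emb_divides_iff)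
  have "cat_divides D (emb m) (emb a \<cdot> emb d)"
    unfolding slide_cmp[OF slide] using ad by (auto intro: dividesI)
  moreover have "cat_divides D (emb r) (c \<cdot> emb m)"
    if c: "c \<in> Elt D" "r \<in> Elt Y" "Tgt D c = Src D (emb a \<cdot> emb d)"
      "cat_divides D (emb r) (c \<cdot> (emb a \<cdot> emb d))" for c r
  proof -
    have "cat_divides D (emb r) (c \<cdot> emb s)"
      using s c by (auto simp: greatest_divisor_def)
    moreover have "cat_divides D (c \<cdot> emb s) (c \<cdot> emb m)"
      using c ad sm by (intro divides_mult) auto
    ultimately show ?thesis
      using divides_trans c by auto
  qed
  ultimately show ?thesis
    using ad by (auto simp: greatest_divisor_def)
qed

lemma emb_chain: "chain Y x es \<Longrightarrow> chain D x (map emb es) \<and> ptgt D (x, map emb es) = ptgt Y (x, es)"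
  by (induction es arbitrary: x) (auto simp: obj_eq)

end

section \<open>The category generated by a germ\<close>

lemma (in cancellative_germ) fold_in:
  assumes "\<And>a z. \<lbrakk>a \<in> Elt Y; z \<in> Z (Tgt Y a)\<rbrakk> \<Longrightarrow> act a z \<in> Z (Src Y a)"
  shows "\<lbrakk>chain Y x es; z \<in> Z (ptgt Y (x, es))\<rbrakk> \<Longrightarrow> List.foldr act es z \<in> Z x"
  by (induction es arbitrary: x) (auto intro: assms)

locale germ_category = cancellative_germ
begin

abbreviation "D \<equiv> germ_cat Y"
abbreviation "emb \<equiv> germ_emb Y"
abbreviation cat_cmp (infixl "\<cdot>" 70) where "f \<cdot> g \<equiv> Cmp (germ_cat Y) f g"
abbreviation path_cong (infix "\<simeq>" 50) where "p \<simeq> q \<equiv> pcong Y (germ_relations Y) p q"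

lemma germ_relationsE:
  assumes "(u, v) \<in> germ_relations Y"
  obtains a b c where "u = (Src Y a, [a, b])" "v = (Src Y a, [c])" "a \<bullet> b = Some c"
  | x where "u = (x, [One Y x])" "v = (x, [])" "x \<in> Obj Y"
  using assms unfolding germ_relations_def by blast

lemma is_relations_germ: "is_relations Y (germ_relations Y)"
  unfolding is_relations_def
proof (clarify)
  fix x es y fs assume "((x, es), (y, fs)) \<in> germ_relations Y"
  then show "parallel Y (x, es) (y, fs)"
  proof (cases rule: germ_relationsE)
    case (1 a b c)
    then show ?thesis using mulD[OF 1(3)] by (auto simp: parallel_def)
  next
    case (2 x)
    then show ?thesis by (auto simp: parallel_def)
  qed
qed

sublocale presentation Y "germ_relations Y"
  by unfold_locales (rule is_relations_germ)

sublocale category "germ_cat Y"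
  by unfold_locales (simp add: germ_cat_def category_presented)

lemma germ_cat_simps:
  "Obj D = Obj Y" "Elt D = cls ` paths Y" "Idt D x = cls (x, [])"
  by (simp_all add: germ_cat_def)

lemma germ_cat_cls:
  assumes "p \<in> paths Y"
  shows "cls p \<in> Elt D" "Src D (cls p) = fst p" "Tgt D (cls p) = ptgt Y p"
  using assms by (simp_all add: germ_cat_def Src_cls Tgt_cls)

lemma germ_cat_cmp: "composable Y p q \<Longrightarrow> cls p \<cdot> cls q = cls (p \<odot> q)"
  by (simp add: germ_cat_def Cmp_cls)

lemma emb_simps:
  assumes "a \<in> Elt Y"
  shows "emb a \<in> Elt D" "Src D (emb a) = Src Y a" "Tgt D (emb a) = Tgt Y a"
  using germ_cat_cls[of "(Src Y a, [a])"] assms by (simp_all add: germ_emb_def)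

lemma cls_Cons:
  assumes "chain Y x (a # es)"
  shows "cls (x, a # es) = emb a \<cdot> cls (Tgt Y a, es)"
proof -
  have "emb a \<cdot> cls (Tgt Y a, es) = cls ((Src Y a, [a]) \<odot> (Tgt Y a, es))"
    unfolding germ_emb_def using assms by (intro germ_cat_cmp) auto
  then show ?thesis
    using assms by simp
qed

lemma cls_emb_path: "p \<in> paths Y \<Longrightarrow> path_value D (germ_emb_path Y p) = cls p"
proof (cases p)
  fix x es assume "p \<in> paths Y" "p = (x, es)"
  then have "chain Y x es"
    by simp
  then have "path_value D (x, map emb es) = cls (x, es)"
    by (induction es arbitrary: x) (simp_all add: germ_cat_simps cls_Cons emb_simps del: cls_eqI)
  then show ?thesis
    by (simp add: \<open>p = (x, es)\<close> germ_emb_path_def)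
qed

lemma germ_cat_induct [consumes 1, case_names idt cmp]:
  assumes "f \<in> Elt D"
    and "\<And>x. x \<in> Obj Y \<Longrightarrow> Q (Idt D x)"
    and "\<And>a g. \<lbrakk>a \<in> Elt Y; g \<in> Elt D; Tgt Y a = Src D g; Q g\<rbrakk> \<Longrightarrow> Q (emb a \<cdot> g)"
  shows "Q f"
proof -
  obtain x es where f: "f = cls (x, es)" "chain Y x es"
    using assms(1) by (auto simp: germ_cat_simps)
  show ?thesis
    unfolding f(1) using f(2)
  proof (induction es arbitrary: x)
    case Nil
    then show ?case using assms(2)[of x] by (simp add: germ_cat_simps)
  next
    case (Cons a es)
    then have "Q (emb a \<cdot> cls (Tgt Y a, es))"
      using germ_cat_cls[of "(Tgt Y a, es)"] by (intro assms(3)) auto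
    then show ?case
      using Cons.prems by (simp add: cls_Cons)
  qed
qed

text \<open>Two paths are congruent only if they cannot be told apart by any action of the germ: whatever
  is computed from a path by letting its entries act one after the other, in a way compatible with
  the product and the units up to \<open>sim\<close>, is an invariant of the class of the path.\<close>

lemma cong_fold:
  assumes act_in: "\<And>a z. \<lbrakk>a \<in> Elt Y; z \<in> Z (Tgt Y a)\<rbrakk> \<Longrightarrow> act a z \<in> Z (Src Y a)"
    and sim_refl: "\<And>x z. z \<in> Z x \<Longrightarrow> sim z z"
    and sim_sym: "\<And>z z'. sim z z' \<Longrightarrow> sim z' z"
    and sim_trans: "\<And>z z' z''. \<lbrakk>sim z z'; sim z' z''\<rbrakk> \<Longrightarrow> sim z z''"
    and act_sim: "\<And>a z z'. \<lbrakk>a \<in> Elt Y; z \<in> Z (Tgt Y a); z' \<in> Z (Tgt Y a); sim z z'\<rbrakk>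
      \<Longrightarrow> sim (act a z) (act a z')"
    and act_mul: "\<And>a b c z. \<lbrakk>a \<bullet> b = Some c; z \<in> Z (Tgt Y b)\<rbrakk> \<Longrightarrow> sim (act a (act b z)) (act c z)"
    and act_one: "\<And>x z. \<lbrakk>x \<in> Obj Y; z \<in> Z x\<rbrakk> \<Longrightarrow> sim (act (One Y x) z) z"
    and "p \<simeq> q" "z \<in> Z (ptgt Y p)"
  shows "sim (List.foldr act (snd p) z) (List.foldr act (snd q) z)"
proof -
  have fold_in': "List.foldr act (snd p) z \<in> Z (fst p)" if "p \<in> paths Y" "z \<in> Z (ptgt Y p)" for p z
    using fold_in[of Z act "fst p" "snd p" z] act_in that by (cases p) auto
  have fold_sim: "sim (List.foldr act es z) (List.foldr act es z')"
    if "chain Y x es" "z \<in> Z (ptgt Y (x, es))" "z' \<in> Z (ptgt Y (x, es))" "sim z z'" for x es z z'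
    using that
  proof (induction es arbitrary: x)
    case (Cons a es)
    then show ?case
      using fold_in[of Z act "Tgt Y a" es] act_in by (auto intro!: act_sim)
  qed simp
  show ?thesis
    using \<open>p \<simeq> q\<close> \<open>z \<in> Z (ptgt Y p)\<close>
  proof (induction arbitrary: z rule: pcong.induct)
    case (pcong_refl p)
    then show ?case
      using sim_refl fold_in' by blast
  next
    case (pcong_rel u v)
    from pcong_rel(1) show ?case
    proof (cases rule: germ_relationsE)
      case (1 a b c)
      then show ?thesis
        using act_mul pcong_rel(2) by simp
    next
      case (2 x)
      then show ?thesis
        using act_one pcong_rel(2) by simp
    qed
  next
    case (pcong_sym p q)
    then show ?case
      using sim_sym cong_paths by metis
  next
    case (pcong_trans p q r)
    then show ?case
      using sim_trans cong_paths by metis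
  next
    case (pcong_comp p q p' q')
    note pq = cong_paths[OF pcong_comp(1)] and pq' = cong_paths[OF pcong_comp(2)]
    have z: "z \<in> Z (ptgt Y p')" "z \<in> Z (ptgt Y q')"
      using pcong_comp.prems pcong_comp(3) pq' by (simp_all add: ptgt_pcat)
    let ?z = "List.foldr act (snd p') z" and ?z' = "List.foldr act (snd q') z"
    have in_Z: "?z \<in> Z (ptgt Y p)" "?z' \<in> Z (ptgt Y p)"
      using fold_in'[of p' z] fold_in'[of q' z] z pq pq' pcong_comp(3) by (simp_all add: composable_def)
    have "sim (List.foldr act (snd p) ?z) (List.foldr act (snd p) ?z')"
    proof (cases p)
      case (Pair x es)
      then show ?thesis
        using fold_sim[of x es ?z ?z'] in_Z pq pcong_comp.IH(2)[OF z(1)] by auto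
    qed
    moreover have "sim (List.foldr act (snd p) ?z') (List.foldr act (snd q) ?z')"
      using pcong_comp.IH(1) in_Z by simp
    ultimately show ?case
      using sim_trans by (simp add: pcat_def)
  qed
qed

text \<open>Evaluating a path in the germ from the right, as far as the products are defined, is such an
  invariant: by left-associativity \<open>a \<bullet> (b \<bullet> d)\<close> is defined as soon as \<open>(a \<bullet> b) \<bullet> d\<close> is.
  So nothing in the germ is identified in the category it generates, and every right divisor of
  an element of the germ comes from the germ.\<close>

definition germ_value :: "('a, 'b) path \<Rightarrow> 'b option" where
  "germ_value p = List.foldr (\<lambda>a z. Option.bind z (\<lambda>d. a \<bullet> d)) (snd p) (Some (One Y (ptgt Y p)))"

lemma germ_value_Nil [simp]: "germ_value (x, []) = Some (One Y x)"
  by (simp add: germ_value_def)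

lemma germ_value_Cons [simp]:
  "germ_value (x, a # es) = Option.bind (germ_value (Tgt Y a, es)) (\<lambda>d. a \<bullet> d)"
  by (simp add: germ_value_def)

lemma germ_value_cong:
  assumes "p \<simeq> q"
  shows "germ_value p = germ_value q"
proof -
  let ?act = "\<lambda>a z. Option.bind z (\<lambda>d. a \<bullet> d)"
    and ?Z = "\<lambda>x. {z. \<forall>d. z = Some d \<longrightarrow> d \<in> Elt Y \<and> Src Y d = x}"
  have "List.foldr ?act (snd p) (Some (One Y (ptgt Y p))) = List.foldr ?act (snd q) (Some (One Y (ptgt Y p)))"
  proof (rule cong_fold[of ?Z _ "(=)", OF _ _ _ _ _ _ _ assms])
    show "?act a z \<in> ?Z (Src Y a)" if "a \<in> Elt Y" "z \<in> ?Z (Tgt Y a)" for a z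
      using mulD by (cases z) auto
  next
    show "?act a (?act b z) = ?act c z" if "a \<bullet> b = Some c" "z \<in> ?Z (Tgt Y b)" for a b c z
    proof (cases z)
      case (Some d)
      show ?thesis
      proof (cases "b \<bullet> d")
        case None
        then have "c \<bullet> d = None"
          using left_associative_germ that(1) unfolding germ_left_associative_def by blast
        then show ?thesis
          using Some None by simp
      next
        case (Some e)
        then show ?thesis
          using \<open>z = Some d\<close> mul_assoc[OF that(1) Some] by simp
      qed
    qed simp
  next
    show "?act (One Y x) z = z" if "x \<in> Obj Y" "z \<in> ?Z x" for x z
      using that one_left by (cases z) auto
  qed (use cong_paths[OF assms] in \<open>auto simp: ptgt_obj\<close>)
  then show ?thesis
    using cong_paths[OF assms] by (simp add: germ_value_def)
qed

lemma germ_value_cls: "\<lbrakk>cls p = cls q; q \<in> paths Y\<rbrakk> \<Longrightarrow> germ_value p = germ_value q"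
  using germ_value_cong cls_eq_iff by blast

lemma germ_emb_mul: "a \<bullet> b = Some c \<Longrightarrow> emb a \<cdot> emb b = emb c"
proof -
  assume ab: "a \<bullet> b = Some c"
  then have "(Src Y a, [a, b]) \<simeq> (Src Y a, [c])"
    by (auto intro!: pcong_rel simp: germ_relations_def)
  then show "emb a \<cdot> emb b = emb c"
    using mulD[OF ab] cls_Cons[of "Src Y a" a "[b]"] cls_eqI by (simp add: germ_emb_def)
qed

lemma germ_emb_one: "x \<in> Obj Y \<Longrightarrow> emb (One Y x) = Idt D x"
  unfolding germ_emb_def germ_cat_simps
  by (intro cls_eqI pcong_rel) (auto simp: germ_relations_def)

lemma germ_value_eq_Some:
  "\<lbrakk>chain Y x es; germ_value (x, es) = Some d\<rbrakk>
    \<Longrightarrow> cls (x, es) = emb d \<and> d \<in> Elt Y \<and> Src Y d = x"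
proof (induction es arbitrary: x d)
  case Nil
  then show ?case using germ_emb_one[of x] by (auto simp: germ_cat_simps)
next
  case (Cons a es)
  then obtain d' where d': "germ_value (Tgt Y a, es) = Some d'" "a \<bullet> d' = Some d"
    by (auto simp: bind_eq_Some_conv)
  then have "cls (Tgt Y a, es) = emb d'"
    using Cons by auto
  then show ?case
    using cls_Cons[OF Cons.prems(1)] germ_emb_mul[OF d'(2)] mulD[OF d'(2)] Cons.prems(1) by auto
qed

lemma germ_value_append_None:
  "germ_value (ptgt Y (x, es), fs) = None \<Longrightarrow> germ_value (x, es @ fs) = None"
  by (induction es arbitrary: x) auto

lemma germ_emb_solid:
  assumes "f \<in> Elt D" "g \<in> Elt D" "Tgt D f = Src D g" "f \<cdot> g \<in> emb ` Elt Y"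
  shows "g \<in> emb ` Elt Y"
proof -
  obtain x es where f: "f = cls (x, es)" "chain Y x es"
    using assms(1) by (auto simp: germ_cat_simps)
  obtain y fs where g: "g = cls (y, fs)" "chain Y y fs"
    using assms(2) by (auto simp: germ_cat_simps)
  obtain c where c: "f \<cdot> g = emb c" "c \<in> Elt Y"
    using assms(4) by blast
  have comp: "composable Y (x, es) (y, fs)"
    using assms(3) f g germ_cat_cls[of "(x, es)"] germ_cat_cls[of "(y, fs)"] by simp
  then have "cls (x, es @ fs) = cls (Src Y c, [c])"
    using c(1) f g germ_cat_cmp[OF comp] by (simp add: germ_emb_def)
  then have "germ_value (x, es @ fs) = Some c"
    using germ_value_cls[of "(x, es @ fs)" "(Src Y c, [c])"] c(2) by (simp add: one_right)
  then obtain d where "germ_value (y, fs) = Some d"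
    using germ_value_append_None[of x es fs] comp by (cases "germ_value (y, fs)") auto
  then show ?thesis
    using germ_value_eq_Some[OF g(2)] g(1) by auto
qed

sublocale solid_embedding Y "germ_cat Y" "germ_emb Y"
proof
  fix a b c assume abc: "a \<in> Elt Y" "b \<in> Elt Y" "c \<in> Elt Y" "Tgt Y a = Src Y b"
  show "emb a \<cdot> emb b = emb c \<longleftrightarrow> a \<bullet> b = Some c"
  proof
    assume "emb a \<cdot> emb b = emb c"
    then have "cls (Src Y a, [a, b]) = cls (Src Y c, [c])"
      using abc cls_Cons[of "Src Y a" a "[b]"] by (simp add: germ_emb_def)
    then show "a \<bullet> b = Some c"
      using germ_value_cls[of "(Src Y a, [a, b])" "(Src Y c, [c])"] abc by (simp add: one_right)
  qed (rule germ_emb_mul)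
qed (simp_all add: emb_simps germ_emb_one germ_cat_simps(1) germ_emb_solid)

end

section \<open>Heads of morphisms and Garside germs\<close>

locale full_slide_germ = germ_category +
  assumes full_slides: "has_full_slides"
begin

lemma germ_cat_obj [simp]: "f \<in> Elt D \<Longrightarrow> Src D f \<in> Obj Y" "f \<in> Elt D \<Longrightarrow> Tgt D f \<in> Obj Y"
  using src_obj tgt_obj by (simp_all add: obj_eq)

lemma full_slide_ex:
  assumes "a \<in> Elt Y" "d \<in> Elt Y" "Tgt Y a = Src Y d"
  obtains m u where "full_slide a d m u"
  using full_slides assms unfolding has_full_slides_def by blast

text \<open>A morphism is split into a head \<open>d\<close>, which will turn out to be its greatest divisor in the
  germ, and a rest \<open>f\<close>.  Multiplying by \<open>a\<close> on the left only concerns the head: a full slide moves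
  part of \<open>d\<close> to \<open>a\<close> and leaves the remainder to the rest.\<close>

inductive head_rest where
  head_rest_idt: "x \<in> Obj Y \<Longrightarrow> head_rest (Idt (germ_cat Y) x) (One Y x) (Idt (germ_cat Y) x)"
| head_rest_cmp: "\<lbrakk>head_rest g d f; full_slide a d m u\<rbrakk>
    \<Longrightarrow> head_rest (Cmp (germ_cat Y) (germ_emb Y a) g) m (Cmp (germ_cat Y) (germ_emb Y u) f)"

lemma head_restD:
  assumes "head_rest g d f"
  shows "g \<in> Elt D" "d \<in> Elt Y" "f \<in> Elt D" "Tgt Y d = Src D f" "Src Y d = Src D g"
    "emb d \<cdot> f = g"
proof -
  have "g \<in> Elt D \<and> d \<in> Elt Y \<and> f \<in> Elt D \<and> Tgt Y d = Src D f \<and> Src Y d = Src D g \<and> emb d \<cdot> f = g"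
    using assms
  proof induction
    case (head_rest_idt x)
    then show ?case by (simp add: obj_eq emb_one)
  next
    case (head_rest_cmp g d f a m u)
    have s: "slide a d m u"
      using head_rest_cmp by (simp add: full_slide_def)
    note ad = slideD[OF s]
    have "emb m \<cdot> (emb u \<cdot> f) = emb m \<cdot> emb u \<cdot> f"
      using ad head_rest_cmp by (intro cmp_assoc[symmetric]) auto
    also have "\<dots> = emb a \<cdot> (emb d \<cdot> f)"
      unfolding slide_cmp[OF s, symmetric] using ad head_rest_cmp by (intro cmp_assoc) auto
    finally have "emb m \<cdot> (emb u \<cdot> f) = emb a \<cdot> (emb d \<cdot> f)" .
    then show ?case
      using ad head_rest_cmp by auto
  qed
  then show "g \<in> Elt D" "d \<in> Elt Y" "f \<in> Elt D" "Tgt Y d = Src D f" "Src Y d = Src D g"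
    "emb d \<cdot> f = g" by auto
qed

text \<open>Splittings of a morphism are compared up to a unit carried over from the rest to the head.\<close>

definition splittings where
  "splittings x = {(d, f). d \<in> Elt Y \<and> f \<in> Elt D \<and> Tgt Y d = Src D f \<and> Src Y d = x}"

definition unit_equiv (infix "\<sim>" 50) where
  "z \<sim> z' \<longleftrightarrow> z \<in> splittings (Src Y (fst z)) \<and> z' \<in> splittings (Src Y (fst z)) \<and>
     (\<exists>e\<in>units. fst z \<bullet> e = Some (fst z') \<and> snd z = emb e \<cdot> snd z')"

lemma splittingsD:
  "(d, f) \<in> splittings x \<Longrightarrow> d \<in> Elt Y \<and> f \<in> Elt D \<and> Tgt Y d = Src D f \<and> Src Y d = x"
  by (simp add: splittings_def)

lemma unit_equivE:
  assumes "(d, f) \<sim> (d', f')"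
  obtains e where "e \<in> units" "d \<bullet> e = Some d'" "f = emb e \<cdot> f'"
    "f \<in> Elt D" "f' \<in> Elt D" "Tgt Y d = Src D f" "Tgt Y d' = Src D f'"
  using assms unfolding unit_equiv_def by (auto dest: splittingsD)

lemma unit_equivI:
  assumes "d \<bullet> e = Some d'" "e \<in> units" "f' \<in> Elt D" "Tgt Y d' = Src D f'"
  shows "(d, emb e \<cdot> f') \<sim> (d', f')"
  using mulD[OF assms(1)] assms unfolding unit_equiv_def splittings_def by auto

lemma unit_equiv_refl: "z \<in> splittings x \<Longrightarrow> z \<sim> z"
proof (cases z)
  fix d f assume z: "z \<in> splittings x" "z = (d, f)"
  then have df: "d \<in> Elt Y" "f \<in> Elt D" "Tgt Y d = Src D f"
    by (auto dest: splittingsD)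
  then have "(d, emb (One Y (Tgt Y d)) \<cdot> f) \<sim> (d, f)"
    using one_unit[of "Tgt Y d"] one_right[of d "Tgt Y d"] by (intro unit_equivI) auto
  then show "z \<sim> z"
    using df z by (simp add: emb_one)
qed

lemma unit_equiv_sym: "z \<sim> z' \<Longrightarrow> z' \<sim> z"
proof (cases z; cases z')
  fix d f d' f' assume z: "z \<sim> z'" "z = (d, f)" "z' = (d', f')"
  then obtain e where e: "e \<in> units" "d \<bullet> e = Some d'" "f = emb e \<cdot> f'"
    "f \<in> Elt D" "f' \<in> Elt D" "Tgt Y d = Src D f" "Tgt Y d' = Src D f'"
    using unit_equivE by blast
  obtain e' where e': "e' \<in> units" "e \<bullet> e' = Some (One Y (Src Y e))" "e' \<bullet> e = Some (One Y (Tgt Y e))"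
    "e \<in> Elt Y" "e' \<in> Elt Y" "Src Y e' = Tgt Y e" "Tgt Y e' = Src Y e"
    using e(1) by (rule unitE) blast
  have types: "Tgt Y e = Src D f'" "Src Y e = Tgt Y d"
    using mulD[OF e(2)] e by auto
  have "d' \<bullet> e' = Some d"
    using mul_assoc[OF e(2) e'(2)] mulD[OF e(2)] by (simp add: one_right)
  then have "(d', emb e' \<cdot> f) \<sim> (d, f)"
    using e e' by (intro unit_equivI) auto
  moreover have "emb e' \<cdot> f = emb e' \<cdot> emb e \<cdot> f'"
    unfolding e(3) using e(5) e' types by (intro cmp_assoc[symmetric]) auto
  moreover have "\<dots> = f'"
    using e(5) e' types emb_mul[OF e'(3)] by (simp add: emb_one)
  ultimately show "z' \<sim> z"
    using z by simp
qed

lemma unit_equiv_trans: "\<lbrakk>z \<sim> z'; z' \<sim> z''\<rbrakk> \<Longrightarrow> z \<sim> z''"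
proof (cases z; cases z'; cases z'')
  fix d f d' f' d'' f''
  assume z: "z \<sim> z'" "z' \<sim> z''" "z = (d, f)" "z' = (d', f')" "z'' = (d'', f'')"
  obtain e where e: "e \<in> units" "d \<bullet> e = Some d'" "f = emb e \<cdot> f'"
    using z unit_equivE by blast
  obtain e' where e': "e' \<in> units" "d' \<bullet> e' = Some d''" "f' = emb e' \<cdot> f''" "f'' \<in> Elt D" "Tgt Y d'' = Src D f''"
    using z(2) unfolding z by (rule unit_equivE) blast
  obtain ee where ee: "e \<bullet> e' = Some ee" "d \<bullet> ee = Some d''"
    using e(2) e'(2) by (rule mul_assocE) blast
  have "emb ee \<cdot> f'' = f"
    using mulD[OF ee(1)] mulD[OF e'(2)] e e'
    by (simp add: cmp_assoc flip: emb_mul[OF ee(1)])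
  moreover have "(d, emb ee \<cdot> f'') \<sim> (d'', f'')"
    using ee(2) unit_mul_unit[OF ee(1)] e(1) e'(1,4,5) by (intro unit_equivI)
  ultimately show "z \<sim> z''"
    using z by simp
qed

lemma full_slide_unit_equiv:
  assumes "full_slide a d m u" "full_slide a d' m' u'" "(d, f) \<sim> (d', f')"
  shows "(m, emb u \<cdot> f) \<sim> (m', emb u' \<cdot> f')"
proof -
  obtain e where e: "e \<in> units" "d \<bullet> e = Some d'" "f = emb e \<cdot> f'"
    "f \<in> Elt D" "f' \<in> Elt D" "Tgt Y d = Src D f" "Tgt Y d' = Src D f'"
    using assms(3) by (rule unit_equivE) blast
  obtain u1 where u1: "u \<bullet> e = Some u1" "full_slide a d' m u1"
    using assms(1) e(2,1) by (rule full_slide_unit_right) blast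
  obtain e2 where e2: "e2 \<in> units" "m \<bullet> e2 = Some m'" "e2 \<bullet> u' = Some u1"
    using u1(2) assms(2) by (rule full_slide_unique) blast
  have s': "slide a d' m' u'"
    using assms(2) by (simp add: full_slide_def)
  note types = mulD[OF u1(1)] mulD[OF e2(3)] slideD[OF s']
  have "emb u \<cdot> f = emb u1 \<cdot> f'"
    unfolding e(3) emb_mul[OF u1(1), symmetric] using types e(5,7) by (intro cmp_assoc[symmetric]) auto
  also have "\<dots> = emb e2 \<cdot> (emb u' \<cdot> f')"
    unfolding emb_mul[OF e2(3), symmetric] using types e(5,7) by (intro cmp_assoc) auto
  finally show ?thesis
    using unit_equivI[OF e2(2,1), of "emb u' \<cdot> f'"] types e(5,7) by simp
qed

text \<open>A full slide is unique up to a unit only, so one is chosen; by the preceding lemma the choice does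
  not matter up to \<open>unit_equiv\<close>.\<close>

definition absorb where
  "absorb a z = (case SOME r. full_slide a (fst z) (fst r) (snd r) of (m, u) \<Rightarrow> (m, emb u \<cdot> snd z))"

lemma absorbE:
  assumes "a \<in> Elt Y" "(d, f) \<in> splittings (Tgt Y a)"
  obtains m u where "full_slide a d m u" "absorb a (d, f) = (m, emb u \<cdot> f)"
    "absorb a (d, f) \<in> splittings (Src Y a)"
proof -
  have df: "d \<in> Elt Y" "f \<in> Elt D" "Tgt Y d = Src D f" "Tgt Y a = Src Y d"
    using assms(2) by (auto dest: splittingsD)
  then obtain m u where "full_slide a d m u"
    using full_slide_ex assms(1) by blast
  then have "\<exists>r. full_slide a d (fst r) (snd r)"
    by auto
  then have full: "full_slide a d (fst (SOME r. full_slide a d (fst r) (snd r)))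
      (snd (SOME r. full_slide a d (fst r) (snd r)))"
    by (rule someI_ex)
  then have "slide a d (fst (SOME r. full_slide a d (fst r) (snd r)))
      (snd (SOME r. full_slide a d (fst r) (snd r)))"
    by (simp add: full_slide_def)
  note ad = slideD[OF this]
  show ?thesis
    using that[OF full] ad df by (simp add: absorb_def case_prod_beta splittings_def)
qed

lemma absorb_full_slide:
  assumes "full_slide a d m u" "(d, f) \<in> splittings (Tgt Y a)"
  shows "(m, emb u \<cdot> f) \<sim> absorb a (d, f)"
proof -
  have "a \<in> Elt Y"
    using assms slideD by (auto simp: full_slide_def)
  then obtain m' u' where "full_slide a d m' u'" "absorb a (d, f) = (m', emb u' \<cdot> f)"
    using assms(2) by (rule absorbE) blast
  then show ?thesis
    using full_slide_unit_equiv[OF assms(1)] unit_equiv_refl[OF assms(2)] by simp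
qed

lemma head_rest_fold:
  assumes "head_rest g d f"
  obtains x es where "chain Y x es" "g = cls (x, es)"
    "(d, f) \<sim> List.foldr absorb es (One Y (ptgt Y (x, es)), Idt D (ptgt Y (x, es)))"
proof -
  have "\<exists>x es. chain Y x es \<and> g = cls (x, es) \<and>
    (d, f) \<sim> List.foldr absorb es (One Y (ptgt Y (x, es)), Idt D (ptgt Y (x, es)))"
    using assms
  proof induction
    case (head_rest_idt x)
    then have "(One Y x, Idt D x) \<sim> (One Y x, Idt D x)"
      by (intro unit_equiv_refl[of _ x]) (auto simp: splittings_def obj_eq)
    then show ?case
      using head_rest_idt by (intro exI[of _ x] exI[of _ "[]"]) (simp add: germ_cat_simps)
  next
    case (head_rest_cmp g d f a m u)
    then obtain x es where xes: "chain Y x es" "g = cls (x, es)"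
      "(d, f) \<sim> List.foldr absorb es (One Y (ptgt Y (x, es)), Idt D (ptgt Y (x, es)))" (is "_ \<sim> ?z")
      by auto
    obtain d' f' where z: "?z = (d', f')"
      by (cases ?z)
    have "slide a d m u"
      using head_rest_cmp by (simp add: full_slide_def)
    note ad = slideD[OF this] and df = head_restD[OF head_rest_cmp(1)]
    have x: "x = Tgt Y a"
      using df ad xes germ_cat_cls[of "(x, es)"] by simp
    have "(d', f') \<in> splittings (Tgt Y a)"
      using xes(3) ad unfolding z unit_equiv_def by simp
    then obtain m' u' where m': "full_slide a d' m' u'" "absorb a (d', f') = (m', emb u' \<cdot> f')"
      using ad(1) by (blast elim: absorbE)
    have "(m, emb u \<cdot> f) \<sim> absorb a ?z"
      using full_slide_unit_equiv[OF head_rest_cmp(2) m'(1)] xes(3) m'(2) z by simp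
    then show ?case
      using xes(1,2) ad(1) x cls_Cons[of "Src Y a" a es]
      by (intro exI[of _ "Src Y a"] exI[of _ "a # es"]) auto
  qed
  then show ?thesis
    using that by blast
qed

text \<open>The splitting does not depend on the path that represents the morphism: absorbing letters is
  an action of the germ up to units, by the compatibility of full slides with products.\<close>

lemma head_rest_unique:
  assumes "head_rest g d f" "head_rest g d' f'"
  shows "(d, f) \<sim> (d', f')"
proof -
  obtain x es where es: "chain Y x es" "g = cls (x, es)"
    "(d, f) \<sim> List.foldr absorb es (One Y (ptgt Y (x, es)), Idt D (ptgt Y (x, es)))"
    using assms(1) by (rule head_rest_fold) blast
  obtain y fs where fs: "chain Y y fs" "g = cls (y, fs)"
    "(d', f') \<sim> List.foldr absorb fs (One Y (ptgt Y (y, fs)), Idt D (ptgt Y (y, fs)))"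
    using assms(2) by (rule head_rest_fold) blast
  have cong: "(x, es) \<simeq> (y, fs)"
    using es fs cls_eq_iff[of "(y, fs)" "(x, es)"] by simp
  then have tgt: "ptgt Y (x, es) = ptgt Y (y, fs)"
    using cong_paths by blast
  let ?z = "(One Y (ptgt Y (x, es)), Idt D (ptgt Y (x, es)))"
  have z: "?z \<in> splittings (ptgt Y (x, es))"
    using chain_target[OF es(1)] by (simp add: splittings_def obj_eq)
  have "List.foldr absorb (snd (x, es)) ?z \<sim> List.foldr absorb (snd (y, fs)) ?z"
  proof (rule cong_fold[of splittings absorb "(\<sim>)", OF _ _ _ _ _ _ _ cong z])
    show "absorb a z \<in> splittings (Src Y a)" if "a \<in> Elt Y" "z \<in> splittings (Tgt Y a)" for a z
      using that by (cases z) (auto elim: absorbE)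
  next
    fix a z z' assume a: "a \<in> Elt Y" and z: "z \<in> splittings (Tgt Y a)" "z' \<in> splittings (Tgt Y a)" "z \<sim> z'"
    obtain d f d' f' where df: "z = (d, f)" "z' = (d', f')"
      by (cases z; cases z')
    obtain m u where "full_slide a d m u" "absorb a (d, f) = (m, emb u \<cdot> f)"
      using a z(1) unfolding df by (rule absorbE) blast
    moreover obtain m' u' where "full_slide a d' m' u'" "absorb a (d', f') = (m', emb u' \<cdot> f')"
      using a z(2) unfolding df by (rule absorbE) blast
    ultimately show "absorb a z \<sim> absorb a z'"
      using full_slide_unit_equiv z(3) df by simp
  next
    fix a b c z assume ab: "a \<bullet> b = Some c" and z: "z \<in> splittings (Tgt Y b)"
    obtain d f where df: "z = (d, f)"
      by (cases z)
    note types = mulD[OF ab] splittingsD[OF z[unfolded df]]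
    obtain n u where n: "full_slide b d n u" "absorb b (d, f) = (n, emb u \<cdot> f)"
      "absorb b (d, f) \<in> splittings (Src Y b)"
      using types(2) z unfolding df by (rule absorbE) blast
    have "(n, emb u \<cdot> f) \<in> splittings (Tgt Y a)"
      using n types by simp
    then obtain m v where m: "full_slide a n m v" "absorb a (n, emb u \<cdot> f) = (m, emb v \<cdot> (emb u \<cdot> f))"
      using types(1) by (blast elim: absorbE)
    obtain w where w: "v \<bullet> u = Some w" "full_slide c d m w"
      using ab n(1) m(1) by (rule full_slide_mul) blast
    have "slide b d n u"
      using n by (simp add: full_slide_def)
    then have "Tgt Y u = Tgt Y d"
      by (rule slideD)
    note types' = this mulD(1,2,4)[OF w(1)]
    have "emb v \<cdot> (emb u \<cdot> f) = emb w \<cdot> f"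
      unfolding emb_mul[OF w(1), symmetric] using types(7) types' by (intro cmp_assoc[symmetric]) auto
    then show "absorb a (absorb b z) \<sim> absorb c z"
      using absorb_full_slide[OF w(2), of f] z types(6) m(2) n(2) unfolding df by simp
  next
    fix x z assume x: "x \<in> Obj Y" and z: "z \<in> splittings x"
    obtain d f where df: "z = (d, f)"
      by (cases z)
    note types = splittingsD[OF z[unfolded df]]
    have "(d, emb (One Y (Tgt Y d)) \<cdot> f) \<sim> absorb (One Y x) (d, f)"
      using types x z df by (intro absorb_full_slide full_slide_one_left) auto
    then have "(d, f) \<sim> absorb (One Y x) (d, f)"
      using types by (simp add: emb_one)
    then show "absorb (One Y x) z \<sim> z"
      unfolding df by (rule unit_equiv_sym)
  qed (use unit_equiv_refl unit_equiv_sym unit_equiv_trans in blast)+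
  then have "(d, f) \<sim> List.foldr absorb fs ?z"
    using unit_equiv_trans[OF es(3)] by simp
  then show ?thesis
    using unit_equiv_trans unit_equiv_sym[OF fs(3)] unfolding tgt by blast
qed

lemma head_rest_ex:
  assumes "g \<in> Elt D"
  obtains d f where "head_rest g d f"
proof -
  have "\<exists>d f. head_rest g d f"
    using assms
  proof (induction rule: germ_cat_induct)
    case (idt x)
    then show ?case using head_rest_idt by blast
  next
    case (cmp a g)
    then obtain d f where df: "head_rest g d f"
      by blast
    then obtain m u where "full_slide a d m u"
      using full_slide_ex[of a d] cmp head_restD[OF df] by auto
    then show ?case
      using head_rest_cmp df by blast
  qed
  then show ?thesis
    using that by blast
qed

lemma head_rest_emb: "d \<in> Elt Y \<Longrightarrow> head_rest (emb d) d (Idt D (Tgt Y d))"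
  using head_rest_cmp[OF head_rest_idt full_slide_one_right, of "Tgt Y d" d]
  by (simp add: emb_one obj_eq)

text \<open>If \<open>a g = a g'\<close>, the splittings of the two sides agree up to a unit; cancelling \<open>a\<close> in the
  germ shows that the parts of the heads of \<open>g\<close> and \<open>g'\<close> that slid to \<open>a\<close> agree as well.\<close>

lemma emb_left_cancel:
  assumes "emb a \<cdot> g = emb a \<cdot> g'" "a \<in> Elt Y" "g \<in> Elt D" "g' \<in> Elt D"
    "Tgt Y a = Src D g" "Tgt Y a = Src D g'"
  shows "g = g'"
proof -
  obtain d f where df: "head_rest g d f"
    using assms(3) by (rule head_rest_ex)
  obtain d' f' where df': "head_rest g' d' f'"
    using assms(4) by (rule head_rest_ex)
  note types = head_restD[OF df] head_restD[OF df']
  obtain m u where m: "full_slide a d m u"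
    using full_slide_ex[of a d] assms types by auto
  obtain m' u' where m': "full_slide a d' m' u'"
    using full_slide_ex[of a d'] assms types by auto
  have "(m, emb u \<cdot> f) \<sim> (m', emb u' \<cdot> f')"
    using head_rest_unique[OF head_rest_cmp[OF df m]] head_rest_cmp[OF df' m'] assms(1) by simp
  then obtain e where e: "e \<in> units" "m \<bullet> e = Some m'" "emb u \<cdot> f = emb e \<cdot> (emb u' \<cdot> f')"
    by (rule unit_equivE) blast
  obtain t where t: "a \<bullet> t = Some m" "t \<bullet> u = Some d"
    using m by (auto simp: slide_def full_slide_def)
  obtain t' where t': "a \<bullet> t' = Some m'" "t' \<bullet> u' = Some d'"
    using m' by (auto simp: slide_def full_slide_def)
  have te: "t \<bullet> e = Some t'"
    by (rule mul_assoc_cancel[OF t(1) e(2) t'(1)])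
  note mt = mulD[OF t(1)] mulD[OF t(2)] mulD[OF t'(1)] mulD[OF t'(2)] mulD[OF te]
  have "g = emb d \<cdot> f"
    using types by simp
  also have "\<dots> = emb t \<cdot> (emb u \<cdot> f)"
    unfolding emb_mul[OF t(2), symmetric] using mt types by (intro cmp_assoc) auto
  also have "\<dots> = emb t \<cdot> (emb e \<cdot> (emb u' \<cdot> f'))"
    by (simp add: e(3))
  also have "\<dots> = emb t \<cdot> emb e \<cdot> (emb u' \<cdot> f')"
    using mt types by (intro cmp_assoc[symmetric]) auto
  also have "\<dots> = emb t' \<cdot> emb u' \<cdot> f'"
    unfolding emb_mul[OF te] using mt types by (intro cmp_assoc[symmetric]) auto
  also have "\<dots> = g'"
    unfolding emb_mul[OF t'(2)] using types by simp
  finally show ?thesis .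
qed

theorem left_cancellative_germ_cat: "left_cancellative D"
  unfolding left_cancellative_def
proof
  fix f assume "f \<in> Elt D"
  then show "\<forall>g\<in>Elt D. \<forall>h\<in>Elt D. Tgt D f = Src D g \<longrightarrow> Tgt D f = Src D h \<longrightarrow> f \<cdot> g = f \<cdot> h \<longrightarrow> g = h"
  proof (induction rule: germ_cat_induct)
    case (idt x)
    then show ?case
      using cmp_idt(1)[of _ x] by (simp add: obj_eq)
  next
    case (cmp a f)
    show ?case
    proof (intro ballI impI)
      fix g h
      assume gh: "g \<in> Elt D" "h \<in> Elt D" "Tgt D (emb a \<cdot> f) = Src D g" "Tgt D (emb a \<cdot> f) = Src D h"
        "emb a \<cdot> f \<cdot> g = emb a \<cdot> f \<cdot> h"
      have types: "Tgt D f = Src D g" "Tgt D f = Src D h"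
        using cmp.hyps gh(3,4) by simp_all
      have "emb a \<cdot> (f \<cdot> g) = emb a \<cdot> f \<cdot> g"
        using cmp.hyps gh(1) types by (intro cmp_assoc[symmetric]) auto
      also have "\<dots> = emb a \<cdot> (f \<cdot> h)"
        unfolding gh(5) using cmp.hyps gh(2) types by (intro cmp_assoc) auto
      finally have "f \<cdot> g = f \<cdot> h"
        using cmp.hyps gh(1,2) types by - (rule emb_left_cancel[of a "f \<cdot> g"], auto)
      then show "g = h"
        using cmp.IH gh(1,2) types by blast
    qed
  qed
qed

text \<open>Writing \<open>g = s k\<close> and sliding the head of \<open>k\<close> into \<open>s\<close> computes a head of \<open>g\<close> that \<open>s\<close>
  divides by construction.\<close>

lemma head_rest_divides:
  assumes "head_rest g d f" "s \<in> Elt Y" "cat_divides D (emb s) g"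
  shows "s \<preceq> d"
proof -
  obtain k where k: "k \<in> Elt D" "Tgt Y s = Src D k" "g = emb s \<cdot> k"
    using assms by (auto simp: cat_divides_def)
  obtain d' f' where df': "head_rest k d' f'"
    using k(1) by (rule head_rest_ex)
  obtain m u where m: "full_slide s d' m u"
    using full_slide_ex[of s d'] assms(2) k head_restD[OF df'] by auto
  have "(m, emb u \<cdot> f') \<sim> (d, f)"
    using head_rest_unique[OF head_rest_cmp[OF df' m]] assms(1) k(3) by simp
  then obtain e where "m \<bullet> e = Some d"
    by (rule unit_equivE) blast
  moreover have "s \<preceq> m"
    using m slideD(9) by (auto simp: full_slide_def)
  ultimately show ?thesis
    using gdvd_trans divides_iff by blast
qed

text \<open>Absorbing a letter changes the head in a way that does not depend on the rest, so the head of
  \<open>a g\<close> is determined by \<open>a\<close> and the head of \<open>g\<close>.  This is what makes the head a greatest divisor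
  behind every left factor.\<close>

lemma head_rest_mult:
  assumes "a \<in> Elt D" "head_rest g d f" "Tgt D a = Src D g"
  shows "\<exists>m k k'. head_rest (a \<cdot> g) m k \<and> head_rest (a \<cdot> emb d) m k'"
  using assms(1,3)
proof (induction rule: germ_cat_induct)
  case (idt x)
  note types = head_restD[OF assms(2)]
  have "Idt D x \<cdot> g = g" "Idt D x \<cdot> emb d = emb d"
    using idt types by (simp_all add: obj_eq)
  then show ?case
    using assms(2) head_rest_emb types by metis
next
  case (cmp b a)
  note types = head_restD[OF assms(2)]
  obtain m k k' where m: "head_rest (a \<cdot> g) m k" "head_rest (a \<cdot> emb d) m k'"
    using cmp by auto
  obtain n u where "full_slide b m n u"
    using full_slide_ex[of b m] cmp head_restD[OF m(1)] types by auto
  then have "head_rest (emb b \<cdot> (a \<cdot> g)) n (emb u \<cdot> k)" "head_rest (emb b \<cdot> (a \<cdot> emb d)) n (emb u \<cdot> k')"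
    using head_rest_cmp m by blast+
  moreover have "emb b \<cdot> (a \<cdot> g) = emb b \<cdot> a \<cdot> g" "emb b \<cdot> (a \<cdot> emb d) = emb b \<cdot> a \<cdot> emb d"
    using cmp types by (simp_all add: cmp_assoc)
  ultimately show ?case
    by auto
qed

lemma head_greatest_divisor:
  assumes "head_rest g d f"
  shows "greatest_divisor d g"
proof -
  note types = head_restD[OF assms]
  have "cat_divides D (emb r) (a \<cdot> emb d)"
    if a: "a \<in> Elt D" "r \<in> Elt Y" "Tgt D a = Src D g" "cat_divides D (emb r) (a \<cdot> g)" for a r
  proof -
    obtain m k k' where m: "head_rest (a \<cdot> g) m k" "head_rest (a \<cdot> emb d) m k'"
      using head_rest_mult[OF a(1) assms a(3)] by blast
    have "r \<preceq> m"
      using head_rest_divides[OF m(1)] a by simp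
    moreover have "cat_divides D (emb m) (a \<cdot> emb d)"
      using head_restD[OF m(2)] dividesI[of k' "emb m"] by simp
    ultimately show ?thesis
      using divides_trans[of "emb r" "emb m"] a emb_divides_iff[of r m] head_restD[OF m(2)] by simp
  qed
  moreover have "cat_divides D (emb d) g"
    using types dividesI[of f "emb d"] by simp
  ultimately show ?thesis
    using types by (auto simp: greatest_divisor_def)
qed

lemma full_slide_head:
  assumes "full_slide a d m u"
  shows "greatest_divisor m (emb a \<cdot> emb d)"
proof -
  have "slide a d m u"
    using assms by (simp add: full_slide_def)
  then show ?thesis
    using head_greatest_divisor[OF head_rest_cmp[OF head_rest_emb assms]] slideD by blast
qed

end

section \<open>Uniqueness of normal decompositions\<close>

context category
begin

text \<open>For \<open>i\<close> beyond the length this is the value of the whole path, in accordance with the prolongation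
  of a path by identities.\<close>

definition prefix_value :: "('o, 'e) path \<Rightarrow> nat \<Rightarrow> 'e" where
  "prefix_value p i = path_value D (fst p, take i (snd p))"

lemma chain_take_drop:
  assumes "chain D x es"
  shows "chain D x (take i es)" "chain D (ptgt D (x, take i es)) (drop i es)"
  using assms chain_append[of D x "take i es" "drop i es"] by simp_all

lemma prefix_value_in:
  assumes "chain D x es"
  shows "prefix_value (x, es) i \<in> Elt D" "Src D (prefix_value (x, es) i) = x"
    "Tgt D (prefix_value (x, es) i) = ptgt D (x, take i es)"
  using path_value_in[OF chain_take_drop(1)[OF assms]] by (simp_all add: prefix_value_def)

lemma prefix_value_drop:
  assumes "chain D x es"
  shows "path_value D (x, es) = prefix_value (x, es) i \<cdot> path_value D (ptgt D (x, take i es), drop i es)"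
  using path_value_append[of x "take i es" "drop i es"] assms by (simp add: prefix_value_def)

lemma prefix_value_Suc:
  assumes "chain D x es"
  shows "prefix_value (x, es) (Suc i) = prefix_value (x, es) i \<cdot> pad_nth D (x, es) i"
    "pad_nth D (x, es) i \<in> Elt D" "Src D (pad_nth D (x, es) i) = Tgt D (prefix_value (x, es) i)"
proof -
  have "prefix_value (x, es) (Suc i) = prefix_value (x, es) i \<cdot> pad_nth D (x, es) i \<and>
    pad_nth D (x, es) i \<in> Elt D \<and> Src D (pad_nth D (x, es) i) = Tgt D (prefix_value (x, es) i)"
  proof (cases "i < length es")
    case True
    let ?e = "es ! i"
    have take: "take (Suc i) es = take i es @ [?e]"
      using True by (simp add: take_Suc_conv_app_nth)
    have "chain D x (take i es @ [?e])"
      using chain_take_drop(1)[OF assms, of "Suc i"] take by simp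
    then have "chain D (ptgt D (x, take i es)) [?e]"
      and "prefix_value (x, es) (Suc i) = prefix_value (x, es) i \<cdot> path_value D (ptgt D (x, take i es), [?e])"
      using path_value_append by (simp_all add: prefix_value_def take chain_append)
    then show ?thesis
      using True prefix_value_in[OF assms] by (auto simp: pad_nth_def)
  next
    case False
    then show ?thesis
      using prefix_value_in[OF assms, of i] tgt_obj[of "prefix_value (x, es) i"]
      by (simp add: pad_nth_def prefix_value_def)
  qed
  then show "prefix_value (x, es) (Suc i) = prefix_value (x, es) i \<cdot> pad_nth D (x, es) i"
    "pad_nth D (x, es) i \<in> Elt D" "Src D (pad_nth D (x, es) i) = Tgt D (prefix_value (x, es) i)"
    by auto
qed

lemma prefix_value_mono:
  assumes "chain D x es" "i \<le> j"
  shows "cat_divides D (prefix_value (x, es) i) (prefix_value (x, es) j)"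
proof -
  have "take j es = take i es @ take (j - i) (drop i es)"
    using assms(2) by (metis le_add_diff_inverse take_add)
  moreover have chain: "chain D x (take j es)"
    using assms(1) by (rule chain_take_drop)
  ultimately have "chain D (ptgt D (x, take i es)) (take (j - i) (drop i es))"
    and "prefix_value (x, es) j = prefix_value (x, es) i \<cdot>
      path_value D (ptgt D (x, take i es), take (j - i) (drop i es))"
    using path_value_append[of x "take i es" "take (j - i) (drop i es)"]
    by (simp_all add: prefix_value_def chain_append)
  then show ?thesis
    using path_value_in prefix_value_in[OF assms(1)] by (auto intro: dividesI)
qed

text \<open>A greedy path packs as much as possible into its first entries: a divisor that is a product of
  \<open>n\<close> elements of the family already divides the product of the first \<open>n\<close> entries.\<close>

lemma greedy_prefix:
  assumes "left_cancellative D" "S \<subseteq> Elt D" "chain D x es" "successively (greedy_pair D S) es"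
    "chain D x fs" "set fs \<subseteq> sharp D S"
    "cat_divides D (path_value D (x, fs)) (path_value D (x, es))"
  shows "cat_divides D (path_value D (x, fs)) (prefix_value (x, es) (length fs))"
  using assms(5-7)
proof (induction fs rule: rev_induct)
  case Nil
  then show ?case by (auto simp: prefix_value_def intro: divides_refl)
next
  case (snoc s fs)
  let ?F = "path_value D (x, fs)" and ?n = "length fs"
  have fs: "chain D x fs" "chain D (ptgt D (x, fs)) [s]"
    using snoc.prems by (simp_all add: chain_append)
  then have F: "?F \<in> Elt D" "Src D ?F = x" "s \<in> Elt D" "Tgt D ?F = Src D s"
    using path_value_in[of x fs] by auto
  have Fs: "path_value D (x, fs @ [s]) = ?F \<cdot> s"
    using path_value_append[OF snoc.prems(1)] F fs by simp
  have "cat_divides D ?F (path_value D (x, es))"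
    using snoc.prems(3) Fs F divides_trans[of ?F "?F \<cdot> s"] dividesI[of s ?F] by simp
  then have "cat_divides D ?F (prefix_value (x, es) ?n)"
    using snoc.IH fs(1) snoc.prems(2) by simp
  then obtain k where k: "k \<in> Elt D" "Tgt D ?F = Src D k" "prefix_value (x, es) ?n = ?F \<cdot> k"
    by (auto simp: cat_divides_def)
  show ?case
  proof (cases "?n < length es")
    case False
    then show ?thesis
      using snoc.prems(3) by (simp add: prefix_value_def)
  next
    case True
    let ?y = "ptgt D (x, take ?n es)" and ?b = "es ! ?n" and ?bs = "drop (Suc ?n) es"
    have drop: "drop ?n es = ?b # ?bs"
      using True by (simp add: Cons_nth_drop_Suc)
    have y: "?y = Tgt D k" "chain D (Tgt D k) (?b # ?bs)"
      using prefix_value_in[OF assms(3), of ?n] k F chain_take_drop(2)[OF assms(3), of ?n] drop by simp_all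
    let ?v = "path_value D (Tgt D k, ?b # ?bs)"
    have v: "?v \<in> Elt D" "Src D ?v = Tgt D k"
      using path_value_in[OF y(2)] by auto
    have "path_value D (x, es) = ?F \<cdot> k \<cdot> ?v"
      using prefix_value_drop[OF assms(3), of ?n] k(3) drop y(1) by simp
    also have "\<dots> = ?F \<cdot> (k \<cdot> ?v)"
      using F k v by (intro cmp_assoc) auto
    finally have "cat_divides D (?F \<cdot> s) (?F \<cdot> (k \<cdot> ?v))"
      using snoc.prems(3) Fs by simp
    then have "cat_divides D s (k \<cdot> ?v)"
      using divides_cancel[OF assms(1)] F k v by simp
    moreover have "successively (greedy_pair D S) (?b # ?bs)"
    proof -
      have "successively (greedy_pair D S) (take ?n es @ drop ?n es)"
        using assms(4) by simp
      then show ?thesis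
        unfolding successively_append_iff drop by blast
    qed
    ultimately have "cat_divides D s (k \<cdot> ?b)"
      using greedy_path_head[of S ?b ?bs s k] assms(2) snoc.prems(2) k(1) y(2) by simp
    then have "cat_divides D (?F \<cdot> s) (?F \<cdot> (k \<cdot> ?b))"
      using F by (intro divides_mult)
    moreover have "prefix_value (x, es) (Suc ?n) = ?F \<cdot> k \<cdot> ?b"
      using prefix_value_Suc(1)[OF assms(3), of ?n] k(3) True by (simp add: pad_nth_def)
    moreover have "\<dots> = ?F \<cdot> (k \<cdot> ?b)"
      using F k y(2) by (intro cmp_assoc) auto
    ultimately show ?thesis
      using Fs by simp
  qed
qed

lemma normal_prefix_divides:
  assumes "left_cancellative D" "S \<subseteq> Elt D" "normal_path D S (x, es)" "normal_path D S (x, fs)"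
    "path_value D (x, es) = path_value D (x, fs)"
  shows "cat_divides D (prefix_value (x, fs) i) (prefix_value (x, es) i)"
proof -
  have es: "chain D x es" "successively (greedy_pair D S) es"
    and fs: "chain D x fs" "set fs \<subseteq> sharp D S"
    using assms(3,4) by (auto simp: normal_path_def successively_conv_nth)
  have "cat_divides D (prefix_value (x, fs) i) (path_value D (x, fs))"
    using prefix_value_mono[OF fs(1), of i "max i (length fs)"] by (simp add: prefix_value_def)
  then have "cat_divides D (prefix_value (x, fs) i) (prefix_value (x, es) (length (take i fs)))"
    using greedy_prefix[OF assms(1,2) es chain_take_drop(1)[OF fs(1)], of i]
      set_take_subset[of i fs] fs(2) assms(5)
    by (simp add: prefix_value_def del: length_take)
  moreover have "cat_divides D (prefix_value (x, es) (length (take i fs))) (prefix_value (x, es) i)"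
    by (rule prefix_value_mono[OF es(1)]) simp
  ultimately show ?thesis
    using divides_trans prefix_value_in[OF fs(1)] by blast
qed

end

context germ_category
begin

text \<open>For two normal decompositions of one element the products of the first \<open>i\<close> entries divide each
  other, hence differ by a unit; these units are the deformation.\<close>

theorem normal_paths_deformation:
  assumes lc: "left_cancellative D" and p: "normal_path D (emb ` Elt Y) p" and q: "normal_path D (emb ` Elt Y) q"
    and eq: "path_value D p = path_value D q"
  shows "deformation Y p q"
proof (cases p; cases q)
  fix x es y fs assume pq: "p = (x, es)" "q = (y, fs)"
  have chain: "chain D x es" "chain D y fs"
    using p q pq by (auto simp: normal_path_def)
  then have y: "y = x" and tgt: "ptgt D (x, fs) = ptgt D (x, es)"
    using path_value_in eq pq by metis+
  note chain = chain[unfolded y] and pq = pq[unfolded y]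
  let ?P = "prefix_value (x, es)" and ?Q = "prefix_value (x, fs)"
  have "\<exists>e\<in>units. Tgt D (?P i) = Src Y e \<and> ?Q i = ?P i \<cdot> emb e" for i
  proof -
    have "cat_divides D (?P i) (?Q i)" "cat_divides D (?Q i) (?P i)"
      using normal_prefix_divides[OF lc emb_subset] p q eq pq by auto
    then obtain f where "f \<in> cat_invertibles D" "Tgt D (?P i) = Src D f" "?Q i = ?P i \<cdot> f"
      using mutual_divides[OF lc] prefix_value_in[OF chain(1)] by metis
    moreover from this obtain e where "e \<in> units" "f = emb e"
      by (blast elim: invertible_in_emb)
    ultimately show ?thesis
      using unit_in by auto
  qed
  then obtain e where e: "\<And>i. e i \<in> units" "\<And>i. Tgt D (?P i) = Src Y (e i)" "\<And>i. ?Q i = ?P i \<cdot> emb (e i)"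
    by metis
  have e_in: "e i \<in> Elt Y" for i
    using e(1) by (rule unit_in)
  let ?l = "max (length es) (length fs)"
  have one: "e i \<in> One Y ` Obj Y" if "?P i = ?Q i" for i
  proof -
    have P: "?P i \<in> Elt D" "Tgt D (?P i) \<in> Obj Y"
      using prefix_value_in(1)[OF chain(1), of i] tgt_obj[of "?P i"] by (simp_all only: obj_eq)
    have "?P i \<cdot> emb (e i) = ?P i \<cdot> Idt D (Tgt D (?P i))"
      using e(3)[of i] that P by simp
    then have "emb (e i) = Idt D (Tgt D (?P i))"
      using lcancel[OF lc, of "?P i"] P e_in e(2) by (simp add: obj_eq)
    then have "emb (e i) = emb (One Y (Tgt D (?P i)))"
      using P by (simp add: emb_one)
    then have "e i = One Y (Tgt D (?P i))"
      by (rule emb_inj) (use e_in P(2) in auto)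
    then show ?thesis
      using P(2) by blast
  qed
  have "e 0 \<in> One Y ` Obj Y"
    by (rule one) (simp add: prefix_value_def)
  moreover have "e ?l \<in> One Y ` Obj Y"
    by (rule one) (use eq in \<open>simp add: prefix_value_def pq\<close>)
  moreover have "Tgt D (emb (e i)) = Src D (pad_nth D (x, fs) i)" for i
    using prefix_value_Suc(3)[OF chain(2), of i] e(2,3) e_in prefix_value_in[OF chain(1)] by simp
  moreover have P_Suc: "Tgt D (pad_nth D (x, es) i) = Tgt D (?P (Suc i))" for i
    using prefix_value_Suc[OF chain(1), of i] prefix_value_in[OF chain(1)] by simp
  moreover have "emb (e i) \<cdot> pad_nth D (x, fs) i = pad_nth D (x, es) i \<cdot> emb (e (Suc i))" for i
  proof (rule lcancel[OF lc, of "?P i"])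
    note P = prefix_value_in[OF chain(1), of i] prefix_value_Suc[OF chain(1), of i]
    note Q = prefix_value_in[OF chain(2), of i] prefix_value_Suc[OF chain(2), of i]
    have t: "Tgt Y (e i) = Src D (pad_nth D (x, fs) i)"
      using \<open>Tgt D (emb (e i)) = Src D (pad_nth D (x, fs) i)\<close> e_in by simp
    have "?P i \<cdot> (emb (e i) \<cdot> pad_nth D (x, fs) i) = ?P i \<cdot> emb (e i) \<cdot> pad_nth D (x, fs) i"
      using P Q e(2)[of i] e_in[of i] t by (intro cmp_assoc[symmetric]) auto
    also have "\<dots> = ?P i \<cdot> pad_nth D (x, es) i \<cdot> emb (e (Suc i))"
      using e(3)[of i] e(3)[of "Suc i"] P(4) Q(4) by simp
    also have "\<dots> = ?P i \<cdot> (pad_nth D (x, es) i \<cdot> emb (e (Suc i)))"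
      using P(1,5,6) e(2)[of "Suc i"] e_in[of "Suc i"] P_Suc[of i] by (intro cmp_assoc) auto
    finally show "?P i \<cdot> (emb (e i) \<cdot> pad_nth D (x, fs) i) = ?P i \<cdot> (pad_nth D (x, es) i \<cdot> emb (e (Suc i)))" .
    show "?P i \<in> Elt D"
      by (rule P(1))
    show "emb (e i) \<cdot> pad_nth D (x, fs) i \<in> Elt D" "Tgt D (?P i) = Src D (emb (e i) \<cdot> pad_nth D (x, fs) i)"
      using Q(5) e_in t e(2) by auto
    show "pad_nth D (x, es) i \<cdot> emb (e (Suc i)) \<in> Elt D"
      "Tgt D (?P i) = Src D (pad_nth D (x, es) i \<cdot> emb (e (Suc i)))"
      using P(5,6) P_Suc[of i] e(2)[of "Suc i"] e_in by auto
  qed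
  moreover have "Src D (emb (e i)) = Tgt D (?P i)" for i
    using e(2) e_in by simp
  ultimately show ?thesis
    unfolding deformation_def Let_def pq using e(1) chain by (auto intro!: exI[of _ e])
qed

end

section \<open>Reductions and normal paths\<close>

lemma successively_iff_split:
  "successively Q es \<longleftrightarrow> (\<forall>as a d bs. es = as @ a # d # bs \<longrightarrow> Q a d)"
proof
  assume "successively Q es"
  then show "\<forall>as a d bs. es = as @ a # d # bs \<longrightarrow> Q a d"
    by (auto simp: successively_append_iff)
next
  assume "\<forall>as a d bs. es = as @ a # d # bs \<longrightarrow> Q a d"
  then show "successively Q es"
  proof (induction es)
    case (Cons e es)
    then have "successively Q es"
      by (metis append_Cons)
    moreover have "Q e (hd es)" if "es \<noteq> []"
      using that Cons.prems by (cases es) (auto dest: spec[of _ "[]"])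
    ultimately show ?case
      by (cases es) auto
  qed simp
qed

context cancellative_germ
begin

definition reductions :: "(('o, 'e) path \<times> ('o, 'e) path) set" where
  "reductions = {((Src Y a, [a, d]), (Src Y a, [m, u])) | a d m u. slide a d m u \<and> \<not> m \<preceq> a}"

definition reductions_bar :: "(('o, 'e) path \<times> ('o, 'e) path) set" where
  "reductions_bar = {\<sigma> \<in> reductions. snd \<sigma> \<in> irr_paths Y reductions}"

lemma avoiding_pairs:
  assumes "\<And>a d. Q a d \<Longrightarrow> a \<in> Elt Y \<and> d \<in> Elt Y \<and> Tgt Y a = Src Y d"
  shows "(x, es) \<in> avoiding_paths Y {(Src Y a, [a, d]) | a d. Q a d} \<longleftrightarrow>
    chain Y x es \<and> successively (\<lambda>a d. \<not> Q a d) es"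
proof -
  have "(\<exists>u\<in>{(Src Y a, [a, d]) | a d. Q a d}. subpath Y u (x, es)) \<longleftrightarrow>
    \<not> successively (\<lambda>a d. \<not> Q a d) es" if "chain Y x es"
  proof
    assume "\<exists>u\<in>{(Src Y a, [a, d]) | a d. Q a d}. subpath Y u (x, es)"
    then obtain a d p q where "Q a d" "(x, es) = p \<odot> (Src Y a, [a, d]) \<odot> q"
      unfolding subpath_def by blast
    then have "es = snd p @ a # d # snd q"
      by (simp add: pcat_def)
    then show "\<not> successively (\<lambda>a d. \<not> Q a d) es"
      using \<open>Q a d\<close> unfolding successively_iff_split by blast
  next
    assume "\<not> successively (\<lambda>a d. \<not> Q a d) es"
    then obtain as a d bs where es: "es = as @ a # d # bs" "Q a d"
      unfolding successively_iff_split by blast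
    then have "composable Y (x, as) (Src Y a, [a, d])" "composable Y (Src Y a, [a, d]) (Tgt Y d, bs)"
      "(x, es) = (x, as) \<odot> (Src Y a, [a, d]) \<odot> (Tgt Y d, bs)"
      using that by (auto simp: chain_append dest: chain_start)
    then have "subpath Y (Src Y a, [a, d]) (x, es)"
      unfolding subpath_def by blast
    then show "\<exists>u\<in>{(Src Y a, [a, d]) | a d. Q a d}. subpath Y u (x, es)"
      using es by blast
  qed
  then show ?thesis
    by (auto simp: avoiding_paths_def)
qed

lemma irr_reductions:
  "(x, es) \<in> irr_paths Y reductions \<longleftrightarrow> chain Y x es \<and> successively tight es"
proof -
  have "fst ` reductions = {(Src Y a, [a, d]) | a d. \<not> tight a d}"
    by (force simp: reductions_def tight_def image_iff)
  moreover have "a \<in> Elt Y \<and> d \<in> Elt Y \<and> Tgt Y a = Src Y d" if "\<not> tight a d" for a d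
    using that slideD(1,2,5) unfolding tight_def by blast
  ultimately show ?thesis
    using avoiding_pairs[of "\<lambda>a d. \<not> tight a d" x es] by (simp add: irr_paths_def)
qed

lemma reductions_bar_eq:
  "reductions_bar =
     {((Src Y a, [a, d]), (Src Y a, [m, u])) | a d m u. slide a d m u \<and> \<not> m \<preceq> a \<and> tight m u}"
proof -
  have "(Src Y a, [m, u]) \<in> irr_paths Y reductions \<longleftrightarrow> tight m u" if "slide a d m u" for a d m u
    using slideD[OF that] by (simp add: irr_reductions)
  then show ?thesis
    unfolding reductions_bar_def reductions_def by fastforce
qed

end

context germ_category
begin

lemma reduction_cong: "\<sigma> \<in> reductions_bar \<Longrightarrow> fst \<sigma> \<simeq> snd \<sigma>"
proof -
  assume "\<sigma> \<in> reductions_bar"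
  then obtain a d m u where \<sigma>: "\<sigma> = ((Src Y a, [a, d]), (Src Y a, [m, u]))" and s: "slide a d m u"
    by (auto simp: reductions_bar_eq)
  note ad = slideD[OF s]
  have "cls (Src Y a, [a, d]) = emb a \<cdot> emb d" "cls (Src Y a, [m, u]) = emb m \<cdot> emb u"
    using ad cls_Cons[of "Src Y a" a "[d]"] cls_Cons[of "Src Y a" m "[u]"] by (simp_all add: germ_emb_def)
  then have "cls (Src Y a, [a, d]) = cls (Src Y a, [m, u])"
    using slide_cmp[OF s] by simp
  then show "fst \<sigma> \<simeq> snd \<sigma>"
    using ad \<sigma> cls_eq_iff[of "(Src Y a, [m, u])"] by simp
qed

text \<open>A slide of \<open>(a, d)\<close> is a divisor of \<open>a d\<close> in the germ, so greediness, tested behind an identity,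
  excludes proper slides.  The converse, for arbitrary left factors, relies on heads.\<close>

lemma greedy_pair_tight:
  assumes "a \<in> Elt Y" "d \<in> Elt Y" "Tgt Y a = Src Y d" "greedy_pair D (emb ` Elt Y) (emb a) (emb d)"
  shows "tight a d"
  unfolding tight_def
proof (intro allI impI)
  fix m u assume s: "slide a d m u"
  note ad = slideD[OF s]
  have "cat_divides D (emb m) (Idt D (Src Y a) \<cdot> emb a \<cdot> emb d)"
    using ad slide_cmp[OF s] by (auto simp: obj_eq intro: dividesI)
  then have "cat_divides D (emb m) (Idt D (Src Y a) \<cdot> emb a)"
    using assms(4)[unfolded greedy_pair_def, rule_format, of "emb m" "Idt D (Src Y a)"] ad(1,3)
    by (simp add: obj_eq)
  then show "m \<preceq> a"
    using ad by (simp add: emb_divides_iff)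
qed

end

context full_slide_germ
begin

lemma tight_greedy_pair:
  assumes "a \<in> Elt Y" "d \<in> Elt Y" "Tgt Y a = Src Y d" "tight a d"
  shows "greedy_pair D (emb ` Elt Y) (emb a) (emb d)"
proof -
  obtain m u where m: "full_slide a d m u"
    using full_slide_ex assms by blast
  have s: "slide a d m u"
    using m by (simp add: full_slide_def)
  then have ma: "m \<preceq> a" "m \<in> Elt Y" "Src Y m = Src Y a"
    using assms(4) slideD[OF s] by (auto simp: tight_def)
  have "cat_divides D (emb r) (c \<cdot> emb a)"
    if c: "r \<in> Elt Y" "c \<in> Elt D" "Tgt D c = Src D (emb a)" "cat_divides D (emb r) (c \<cdot> emb a \<cdot> emb d)" for r c
  proof -
    have "c \<cdot> emb a \<cdot> emb d = c \<cdot> (emb a \<cdot> emb d)"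
      using c assms by (intro cmp_assoc) auto
    then have "cat_divides D (emb r) (c \<cdot> emb m)"
      using full_slide_head[OF m] c assms by (auto simp: greatest_divisor_def)
    moreover have "cat_divides D (c \<cdot> emb m) (c \<cdot> emb a)"
      using ma c assms by (intro divides_mult) (auto simp: emb_divides_iff)
    ultimately show ?thesis
      using divides_trans c(1) by auto
  qed
  then show ?thesis
    by (auto simp: greedy_pair_def)
qed

lemma normal_emb_path_iff:
  assumes "chain Y x es"
  shows "normal_path D (emb ` Elt Y) (x, map emb es) \<longleftrightarrow> successively tight es"
proof -
  have elts: "set es \<subseteq> Elt Y"
    using assms by (induction es arbitrary: x) auto
  have "successively (greedy_pair D (emb ` Elt Y)) (map emb es) \<longleftrightarrow> successively tight es"
    using assms
  proof (induction es arbitrary: x)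
    case (Cons a es)
    then show ?case
      using greedy_pair_tight[of a "hd es"] tight_greedy_pair[of a "hd es"] by (cases es) auto
  qed simp
  moreover have "set (map emb es) \<subseteq> sharp D (emb ` Elt Y)"
    using elts emb_in_sharp by auto
  ultimately show ?thesis
    using emb_chain[OF assms] by (simp add: normal_path_def successively_conv_nth)
qed

text \<open>If a pair can be reduced at all, its full slide is a reduction with an irreducible result.\<close>

lemma not_tight_reduces:
  assumes "\<not> tight a d" "full_slide a d m u"
  shows "((Src Y a, [a, d]), (Src Y a, [m, u])) \<in> reductions_bar"
proof -
  obtain m' u' where m': "slide a d m' u'" "\<not> m' \<preceq> a"
    using assms(1) by (auto simp: tight_def)
  then have "m' \<preceq> m"
    using assms(2) by (auto simp: full_slide_def)
  then have "\<not> m \<preceq> a"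
    using m'(2) gdvd_trans by blast
  then show ?thesis
    using assms(2) full_slide_tight by (auto simp: reductions_bar_eq full_slide_def)
qed

text \<open>Hence passing to the reductions with irreducible results does not change which pairs are
  reducible, and the irreducible paths are those all of whose consecutive pairs are greedy.\<close>

theorem irr_reductions_bar:
  "irr_paths Y reductions_bar =
     {p \<in> paths Y. normal_path D (emb ` Elt Y) (germ_emb_path Y p)}"
proof -
  have not_tight: "a \<in> Elt Y \<and> d \<in> Elt Y \<and> Tgt Y a = Src Y d" if "\<not> tight a d" for a d
    using that slideD(1,2,5) unfolding tight_def by blast
  have "fst ` reductions_bar = {(Src Y a, [a, d]) | a d. \<not> tight a d}" (is "?L = ?R")
  proof
    show "?L \<subseteq> ?R"
      by (auto simp: reductions_bar_eq tight_def, blast)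
    show "?R \<subseteq> ?L"
    proof
      fix p assume "p \<in> ?R"
      then obtain a d where ad: "p = (Src Y a, [a, d])" "\<not> tight a d"
        by blast
      then obtain m u where "full_slide a d m u"
        using not_tight full_slide_ex by blast
      then show "p \<in> ?L"
        using not_tight_reduces ad by force
    qed
  qed
  then have "(x, es) \<in> irr_paths Y reductions_bar \<longleftrightarrow> chain Y x es \<and> successively tight es" for x es
    using avoiding_pairs[of "\<lambda>a d. \<not> tight a d" x es] not_tight by (simp add: irr_paths_def)
  then show ?thesis
    using normal_emb_path_iff by (auto simp: germ_emb_path_def)
qed

lemma reduction_step_Cons:
  assumes "(reduction_step Y S)\<^sup>*\<^sup>* (y, es) (y, fs)" "a \<in> Elt Y" "Tgt Y a = y"
  shows "(reduction_step Y S)\<^sup>*\<^sup>* (Src Y a, a # es) (Src Y a, a # fs)"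
proof -
  have fst_step: "fst q = fst p" if "reduction_step Y S p q" for p q
    using that by cases simp
  have "(reduction_step Y S)\<^sup>*\<^sup>* (Src Y a, a # snd p) (Src Y a, a # snd q) \<and> fst q = y"
    if "(reduction_step Y S)\<^sup>*\<^sup>* p q" "fst p = y" for p q
    using that
  proof (induction rule: rtranclp_induct)
    case (step q r)
    from step(2) have "reduction_step Y S (Src Y a, a # snd q) (Src Y a, a # snd r)"
    proof cases
      case (1 w v c d)
      have "fst c = y"
        using step 1 by simp
      have "reduction_step Y S (((Src Y a, [a]) \<odot> c) \<odot> w \<odot> d) (((Src Y a, [a]) \<odot> c) \<odot> v \<odot> d)"
        using 1 \<open>fst c = y\<close> assms(2,3)
        by (intro reduction_step.intros) (cases c; cases w; auto)+
      then show ?thesis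
        using 1 by (simp add: pcat_def)
    qed
    then show ?case
      using step fst_step by (metis rtranclp.rtrancl_into_rtrancl)
  qed simp
  from this[OF assms(1)] show ?thesis
    by simp
qed

text \<open>Inserting a letter in front of a normal path: after the full slide of the first pair, the
  remainder \<open>u\<close> is inserted into the tail.  The first pair of the result is tight again, because
  the head \<open>m\<close> is the greatest divisor of the whole product.\<close>

lemma reduce_Cons:
  "\<lbrakk>chain Y x (a # es); successively tight es\<rbrakk> \<Longrightarrow>
    \<exists>zs. (reduction_step Y reductions_bar)\<^sup>*\<^sup>* (x, a # es) (x, zs) \<and> chain Y x zs \<and>
      cls (x, zs) = cls (x, a # es) \<and> successively tight zs"
proof (induction es arbitrary: x a)
  case Nil
  then show ?case by (intro exI[of _ "[a]"]) simp
next
  case (Cons b es)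
  show ?case
  proof (cases "tight a b")
    case True
    then show ?thesis
      using Cons.prems by (intro exI[of _ "a # b # es"]) simp
  next
    case False
    have types: "a \<in> Elt Y" "b \<in> Elt Y" "Src Y a = x" "Tgt Y a = Src Y b" "chain Y (Tgt Y b) es"
      using Cons.prems by auto
    then obtain m u where m: "full_slide a b m u"
      using full_slide_ex by blast
    have s: "slide a b m u"
      using m by (simp add: full_slide_def)
    note ad = slideD(3,4,6,7,8)[OF s]
    have red: "((x, [a, b]), (x, [m, u])) \<in> reductions_bar"
      using not_tight_reduces[OF False m] types by simp
    have "reduction_step Y reductions_bar ((x, []) \<odot> (x, [a, b]) \<odot> (Tgt Y b, es)) ((x, []) \<odot> (x, [m, u]) \<odot> (Tgt Y b, es))"
      using red types by (intro reduction_step.intros) (auto dest: chain_start)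
    then have step: "reduction_step Y reductions_bar (x, a # b # es) (x, m # u # es)"
      by simp
    have "chain Y (Tgt Y m) (u # es)"
      using ad types by auto
    moreover have "successively tight es"
      using Cons.prems by (cases es) auto
    ultimately obtain zs where zs: "(reduction_step Y reductions_bar)\<^sup>*\<^sup>* (Tgt Y m, u # es) (Tgt Y m, zs)"
      "chain Y (Tgt Y m) zs" "cls (Tgt Y m, zs) = cls (Tgt Y m, u # es)" "successively tight zs"
      using Cons.IH by blast
    have "(reduction_step Y reductions_bar)\<^sup>*\<^sup>* (x, m # u # es) (x, m # zs)"
      using reduction_step_Cons[OF zs(1), of m] ad types by simp
    then have steps: "(reduction_step Y reductions_bar)\<^sup>*\<^sup>* (x, a # b # es) (x, m # zs)"
      using step by (rule converse_rtranclp_into_rtranclp[rotated])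
    have chain: "chain Y x (m # zs)"
      using zs ad types by auto
    have "(x, [a, b]) \<simeq> (x, [m, u])"
      using reduction_cong[OF red] by simp
    then have "(x, [a, b]) \<odot> (Tgt Y b, es) \<simeq> (x, [m, u]) \<odot> (Tgt Y b, es)"
      using types by (intro pcong_comp pcong_refl) (auto dest: chain_start)
    then have cls1: "cls (x, m # u # es) = cls (x, a # b # es)"
      using cls_eqI by auto
    have cls2: "cls (x, m # zs) = cls (x, m # u # es)"
      using cls_Cons[OF chain] cls_Cons[of x m "u # es"] zs(3) ad types chain_start[OF chain]
      by simp
    have "tight m (hd zs)" if "zs \<noteq> []"
    proof -
      obtain z zs' where z: "zs = z # zs'"
        using \<open>zs \<noteq> []\<close> by (cases zs) auto
      have "n \<preceq> m" if n: "slide m z n v" for n v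
      proof -
        note nz = slideD[OF n]
        have "cat_divides D (emb n) (emb m \<cdot> emb z)"
          using nz slide_cmp[OF n] by (auto intro: dividesI)
        moreover have "cat_divides D (emb m \<cdot> emb z) (cls (x, m # zs))"
        proof -
          have "cls (Tgt Y m, zs) = emb z \<cdot> cls (Tgt Y z, zs')"
            using zs(2) unfolding z by (rule cls_Cons)
          moreover have "chain Y (Tgt Y z) zs'"
            using zs(2) z by simp
          ultimately have "cat_divides D (emb z) (cls (Tgt Y m, zs))"
            using germ_cat_cls[of "(Tgt Y z, zs')"] nz dividesI by simp
          then show ?thesis
            using cls_Cons[OF chain] nz by (auto intro: divides_mult)
        qed
        ultimately have "cat_divides D (emb n) (cls (x, a # b # es))"
          using divides_trans cls1 cls2 nz by auto
        moreover have "cls (x, a # b # es) = emb a \<cdot> path_value D (Tgt D (emb a), map emb (b # es))"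
          using cls_Cons[OF Cons.prems(1)] cls_emb_path[of "(Tgt Y a, b # es)"] types
          by (simp add: germ_emb_path_def)
        ultimately have "cat_divides D (emb n) (emb a \<cdot> path_value D (Tgt D (emb a), emb b # map emb es))"
          by simp
        moreover have norm: "normal_path D (emb ` Elt Y) (Src Y b, map emb (b # es))"
          using normal_emb_path_iff[of "Src Y b" "b # es"] Cons.prems types by auto
        ultimately have "cat_divides D (emb n) (emb a \<cdot> emb b)"
          using types nz emb_in_sharp emb_subset
          by - (rule greedy_path_head[of "emb ` Elt Y" "emb b" "map emb es"],
            auto simp: normal_path_def successively_conv_nth)
        moreover have "emb a \<cdot> emb b = Idt D x \<cdot> (emb a \<cdot> emb b)"
          using types by (simp add: obj_eq)
        ultimately have "cat_divides D (emb n) (Idt D x \<cdot> emb m)"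
          using full_slide_head[OF m] nz types unfolding greatest_divisor_def
          by (metis cmp(1,2) emb idt(1,3) obj_eq src_tgt_obj(1))
        then show ?thesis
          using nz ad types emb_divides_iff[of n m] by simp
      qed
      then show ?thesis
        unfolding tight_def z by auto
    qed
    then have "successively tight (m # zs)"
      using zs(4) by (cases zs) auto
    then show ?thesis
      using steps chain cls1 cls2 by auto
  qed
qed

lemma reduces_to_normal:
  assumes "chain Y x es"
  obtains zs where "(reduction_step Y reductions_bar)\<^sup>*\<^sup>* (x, es) (x, zs)" "chain Y x zs"
    "cls (x, zs) = cls (x, es)" "successively tight zs"
proof -
  have "\<exists>zs. (reduction_step Y reductions_bar)\<^sup>*\<^sup>* (x, es) (x, zs) \<and> chain Y x zs \<and>
      cls (x, zs) = cls (x, es) \<and> successively tight zs"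
    using assms
  proof (induction es arbitrary: x)
    case Nil
    then show ?case by (intro exI[of _ "[]"]) simp
  next
    case (Cons a es)
    then obtain ys where ys: "(reduction_step Y reductions_bar)\<^sup>*\<^sup>* (Tgt Y a, es) (Tgt Y a, ys)"
      "chain Y (Tgt Y a) ys" "cls (Tgt Y a, ys) = cls (Tgt Y a, es)" "successively tight ys"
      by auto
    have chain: "chain Y x (a # ys)"
      using Cons.prems ys by simp
    obtain zs where zs: "(reduction_step Y reductions_bar)\<^sup>*\<^sup>* (x, a # ys) (x, zs)" "chain Y x zs"
      "cls (x, zs) = cls (x, a # ys)" "successively tight zs"
      using reduce_Cons[OF chain ys(4)] by blast
    have "(reduction_step Y reductions_bar)\<^sup>*\<^sup>* (x, a # es) (x, a # ys)"
      using reduction_step_Cons[OF ys(1), of a] Cons.prems by simp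
    then have "(reduction_step Y reductions_bar)\<^sup>*\<^sup>* (x, a # es) (x, zs)"
      using zs(1) by simp
    moreover have "cls (x, zs) = cls (x, a # es)"
      using zs(3) ys(3) cls_Cons[OF chain] cls_Cons[OF Cons.prems] by simp
    ultimately show ?case
      using zs by blast
  qed
  then show ?thesis
    using that by blast
qed

theorem full_slides_garside: "garside_germ Y"
  unfolding garside_germ_def garside_family_def
proof (intro conjI ballI)
  show "is_category D"
    by (rule category)
  show "left_cancellative D"
    by (rule left_cancellative_germ_cat)
  show "emb ` Elt Y \<subseteq> Elt D"
    by (rule emb_subset)
  fix g assume "g \<in> Elt D"
  then obtain x es where g: "g = cls (x, es)" "chain Y x es"
    by (auto simp: germ_cat_simps)
  obtain zs where zs: "chain Y x zs" "cls (x, zs) = cls (x, es)" "successively tight zs"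
    using g(2) by (rule reduces_to_normal) blast
  then have "normal_path D (emb ` Elt Y) (x, map emb zs)" "path_value D (x, map emb zs) = g"
    using normal_emb_path_iff cls_emb_path[of "(x, zs)"] g(1) by (simp_all add: germ_emb_path_def)
  then show "\<exists>p. normal_path D (emb ` Elt Y) p \<and> path_value D p = g"
    by blast
qed

text \<open>Both sides of an ambiguity represent the same morphism, and two normal paths with the same value
  are deformations of one another.  So any two congruent paths can be joined, ambiguity or not.\<close>

lemma congruent_resolvable:
  assumes "p \<simeq> q"
  shows "resolvable_upto Y reductions_bar (germ_path_equiv Y) p q"
proof -
  obtain x es where p: "p = (x, es)" "chain Y x es"
    using cong_paths[OF assms] by (cases p) auto
  obtain y fs where q: "q = (y, fs)" "chain Y y fs"
    using cong_paths[OF assms] by (cases q) auto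
  obtain zs where zs: "(reduction_step Y reductions_bar)\<^sup>*\<^sup>* (x, es) (x, zs)" "chain Y x zs"
    "cls (x, zs) = cls (x, es)" "successively tight zs"
    using p(2) by (rule reduces_to_normal) blast
  obtain ws where ws: "(reduction_step Y reductions_bar)\<^sup>*\<^sup>* (y, fs) (y, ws)" "chain Y y ws"
    "cls (y, ws) = cls (y, fs)" "successively tight ws"
    using q(2) by (rule reduces_to_normal) blast
  have "normal_path D (emb ` Elt Y) (germ_emb_path Y (x, zs))"
    "normal_path D (emb ` Elt Y) (germ_emb_path Y (y, ws))"
    using normal_emb_path_iff zs ws by (auto simp: germ_emb_path_def)
  moreover have "path_value D (germ_emb_path Y (x, zs)) = path_value D (germ_emb_path Y (y, ws))"
    using cls_emb_path[of "(x, zs)"] cls_emb_path[of "(y, ws)"] zs ws cls_eqI[OF assms] p q by simp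
  ultimately have "germ_path_equiv Y (x, zs) (y, ws)"
    using normal_paths_deformation[OF left_cancellative_germ_cat] zs(2) ws(2)
    by (simp add: germ_path_equiv_def)
  moreover have "(\<lambda>u v. reduction_step Y reductions_bar u v \<or> germ_path_equiv Y u v)\<^sup>*\<^sup>* p (x, zs)"
    unfolding p(1) by (rule predicate2D[OF rtranclp_mono zs(1)]) blast
  moreover have "(\<lambda>u v. reduction_step Y reductions_bar u v \<or> germ_path_equiv Y u v)\<^sup>*\<^sup>* q (y, ws)"
    unfolding q(1) by (rule predicate2D[OF rtranclp_mono ws(1)]) blast
  ultimately show ?thesis
    unfolding resolvable_upto_def by blast
qed

theorem full_slides_resolvable:
  "all_ambiguities_resolvable Y reductions_bar (germ_path_equiv Y)"
  unfolding all_ambiguities_resolvable_def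
proof (intro conjI allI impI)
  fix \<sigma> \<tau> a b c assume amb: "overlap_ambiguity Y reductions_bar \<sigma> \<tau> a b c"
  have \<sigma>: "a \<odot> b \<simeq> snd \<sigma>" and \<tau>: "b \<odot> c \<simeq> snd \<tau>"
    and comp: "composable Y a b" "composable Y b c"
    using amb reduction_cong[of \<sigma>] reduction_cong[of \<tau>] by (auto simp: overlap_ambiguity_def)
  have paths: "a \<in> paths Y" "c \<in> paths Y" "composable Y (a \<odot> b) c" "composable Y a (b \<odot> c)"
    using comp by (auto simp: composable_def pcat_path ptgt_pcat)
  have "a \<odot> b \<odot> c \<simeq> snd \<sigma> \<odot> c"
    using \<sigma> paths by (intro pcong_comp pcong_refl)
  moreover have "a \<odot> b \<odot> c \<simeq> a \<odot> snd \<tau>"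
    unfolding pcat_assoc using \<tau> paths by (intro pcong_comp pcong_refl)
  ultimately show "resolvable_upto Y reductions_bar (germ_path_equiv Y) (snd \<sigma> \<odot> c) (a \<odot> snd \<tau>)"
    using congruent_resolvable pcong_sym pcong_trans by metis
next
  fix \<sigma> \<tau> a b c assume amb: "inclusion_ambiguity Y reductions_bar \<sigma> \<tau> a b c"
  have \<sigma>: "b \<simeq> snd \<sigma>" and \<tau>: "a \<odot> b \<odot> c \<simeq> snd \<tau>"
    and comp: "composable Y a b" "composable Y b c"
    using amb reduction_cong[of \<sigma>] reduction_cong[of \<tau>] by (auto simp: inclusion_ambiguity_def)
  have paths: "a \<in> paths Y" "c \<in> paths Y" "composable Y (a \<odot> b) c"
    using comp by (auto simp: composable_def pcat_path ptgt_pcat)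
  have "a \<odot> b \<odot> c \<simeq> a \<odot> snd \<sigma> \<odot> c"
    using \<sigma> paths comp by (intro pcong_comp pcong_refl)
  then show "resolvable_upto Y reductions_bar (germ_path_equiv Y) (a \<odot> snd \<sigma> \<odot> c) (snd \<tau>)"
    using \<tau> congruent_resolvable pcong_sym pcong_trans by metis
qed

end

section \<open>Resolvable ambiguities give full slides\<close>

context germ_category
begin

text \<open>The counterpart in the germ of prolonging a path of the generated category by identities.\<close>

definition entry :: "('a, 'b) path \<Rightarrow> nat \<Rightarrow> 'b" where
  "entry p i = (if i < length (snd p) then snd p ! i else One Y (ptgt Y p))"

lemma entry_Nil: "entry (x, []) i = One Y x"
  and entry_Cons_0 [simp]: "entry (x, a # es) 0 = a"
  and entry_Cons_Suc: "entry (x, a # es) (Suc i) = entry (Tgt Y a, es) i"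
  by (simp_all add: entry_def)

lemma chain_entry:
  assumes "chain Y x es"
  shows "entry (x, es) i \<in> Elt Y \<and> Tgt Y (entry (x, es) i) = Src Y (entry (x, es) (Suc i)) \<and>
    Src Y (entry (x, es) 0) = x"
  using assms
proof (induction es arbitrary: x i)
  case Nil
  then show ?case by (simp add: entry_Nil)
next
  case (Cons a es)
  then show ?case
    by (cases i) (auto simp: entry_Cons_Suc)
qed

lemma entry_path:
  assumes "p \<in> paths Y"
  shows "entry p i \<in> Elt Y" "Tgt Y (entry p i) = Src Y (entry p (Suc i))" "Src Y (entry p 0) = fst p"
  using chain_entry[of "fst p" "snd p"] assms by (auto simp: paths_def)

lemma pad_nth_emb:
  assumes "p \<in> paths Y"
  shows "pad_nth D (germ_emb_path Y p) i = emb (entry p i)"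
proof (cases p)
  case (Pair x es)
  then show ?thesis
    using assms emb_chain[of x es] chain_target[of Y x es]
    by (simp add: pad_nth_def entry_def germ_emb_path_def emb_one)
qed

text \<open>The units of a deformation of paths in the germ, prolonged by identities.  All the products
  involved are defined in the germ.\<close>

lemma path_equiv_units:
  assumes "germ_path_equiv Y p q"
  obtains e where "e 0 = One Y (fst p)" "\<And>i. e i \<in> units"
    "\<And>i. \<exists>c. e i \<bullet> entry q i = Some c \<and> entry p i \<bullet> e (Suc i) = Some c"
proof -
  have p: "p \<in> paths Y" and q: "q \<in> paths Y" and fst: "fst p = fst q"
    using assms by (auto simp: germ_path_equiv_def deformation_def germ_emb_path_def)
  define l where "l = max (length (snd p)) (length (snd q))"
  show ?thesis
  proof (cases "l = 0")
    case True
    then have "entry p i = One Y (fst p)" "entry q i = One Y (fst p)" for i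
      using fst by (auto simp: l_def entry_def ptgt_def)
    moreover have "fst p \<in> Obj Y"
      using p by (rule fst_obj)
    ultimately show ?thesis
      using that[of "\<lambda>i. One Y (fst p)"] one_left[of "One Y (fst p)"] one_unit by simp
  next
    case False
    obtain e where e: "\<And>i. i \<le> l \<Longrightarrow> e i \<in> units" "e 0 \<in> One Y ` Obj Y" "e l \<in> One Y ` Obj Y"
      and rel: "\<And>i. i < l \<Longrightarrow> Tgt D (emb (e i)) = Src D (emb (entry q i)) \<and>
        Tgt D (emb (entry p i)) = Src D (emb (e (Suc i))) \<and>
        emb (e i) \<cdot> emb (entry q i) = emb (entry p i) \<cdot> emb (e (Suc i))"
      using assms unfolding germ_path_equiv_def deformation_def Let_def pad_nth_emb[OF p] pad_nth_emb[OF q]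
      by (auto simp: l_def germ_emb_path_def)
    have e_in: "e i \<in> Elt Y" if "i \<le> l" for i
      using e(1)[OF that] by (rule unit_in)
    have types: "Tgt Y (e i) = Src Y (entry q i)" "Tgt Y (entry p i) = Src Y (e (Suc i))" if "i < l" for i
      using rel[OF that] e_in[of i] e_in[of "Suc i"] that entry_path(1)[OF p] entry_path(1)[OF q] by auto
    have prod: "\<exists>c. e i \<bullet> entry q i = Some c \<and> entry p i \<bullet> e (Suc i) = Some c" if i: "i < l" for i
    proof -
      obtain c where c: "e i \<bullet> entry q i = Some c"
        using e(1)[OF less_imp_le[OF i]] entry_path(1)[OF q] types(1)[OF i] by (rule unit_mul) blast
      then have "emb (entry p i) \<cdot> emb (e (Suc i)) = emb c"
        using rel[OF that] emb_mul[OF c] by simp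
      then have "entry p i \<bullet> e (Suc i) = Some c"
        using emb_mul_iff[of "entry p i" "e (Suc i)" c] entry_path(1)[OF p] e_in[of "Suc i"]
          mulD(3)[OF c] types(2)[OF that] that by simp
      then show ?thesis
        using c by blast
    qed
    have "e 0 = One Y (fst p)"
      using e(2) types(1)[of 0] False entry_path(3)[OF q] fst by auto
    moreover have l: "e l = One Y (ptgt Y p)" "ptgt Y q = ptgt Y p"
    proof -
      obtain k where k: "l = Suc k"
        using False by (cases l) auto
      obtain y where y: "e l = One Y y" "y \<in> Obj Y"
        using e(3) by auto
      have p_l: "entry p l = One Y (ptgt Y p)" and q_l: "entry q l = One Y (ptgt Y q)"
        by (simp_all add: entry_def l_def)
      have "y = Src Y (entry p l)"
        using types(2)[of k] entry_path(2)[OF p, of k] y k by simp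
      then have "y = ptgt Y p"
        using p_l ptgt_obj[OF p] by simp
      moreover obtain c where c: "e k \<bullet> entry q k = Some c" "entry p k \<bullet> e l = Some c"
        using prod[of k] k by auto
      have "Tgt Y (entry q k) = y"
        using mulD(6)[OF c(1)] mulD(6)[OF c(2)] y by simp
      then have "y = ptgt Y q"
        using entry_path(2)[OF q, of k] k q_l ptgt_obj[OF q] by simp
      ultimately show "e l = One Y (ptgt Y p)" "ptgt Y q = ptgt Y p"
        using y by auto
    qed
    moreover define e' where "e' i = e (min i l)" for i
    moreover have "\<exists>c. e' i \<bullet> entry q i = Some c \<and> entry p i \<bullet> e' (Suc i) = Some c" for i
    proof (cases "i < l")
      case True
      then show ?thesis
        using prod[OF True] by (simp add: e'_def min_def)
    next
      case False
      then have "entry p i = One Y (ptgt Y p)" "entry q i = One Y (ptgt Y p)"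
        "e' i = One Y (ptgt Y p)" "e' (Suc i) = One Y (ptgt Y p)"
        using l by (auto simp: entry_def l_def e'_def min_def)
      then show ?thesis
        using one_left[of "One Y (ptgt Y p)" "ptgt Y p"] ptgt_obj[OF p] by simp
    qed
    ultimately show ?thesis
      using that[of e'] e(1) by simp
  qed
qed

abbreviation "step u v \<equiv> reduction_step Y reductions_bar u v \<or> germ_path_equiv Y u v"

lemma reduction_stepE:
  assumes "reduction_step Y reductions_bar p q"
  obtains x as c d m u bs where "p = (x, as @ c # d # bs)" "q = (x, as @ m # u # bs)"
    "slide c d m u" "\<not> m \<preceq> c" "tight m u" "p \<in> paths Y" "q \<in> paths Y"
  using assms
proof cases
  case (1 w v a b)
  obtain c d m u where w: "w = (Src Y c, [c, d])" "v = (Src Y c, [m, u])" and s: "slide c d m u" "\<not> m \<preceq> c" "tight m u"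
    using 1(3) by (auto simp: reductions_bar_eq)
  obtain x as y bs where ab: "a = (x, as)" "b = (y, bs)"
    by (cases a; cases b)
  note cd = slideD[OF s(1)]
  have chain: "chain Y x as" "ptgt Y (x, as) = Src Y c" "y = Tgt Y d" "chain Y y bs"
    using 1(4,5) w ab by auto
  have "p \<in> paths Y"
    unfolding 1(1) w ab using chain cd(1,2,5) by (simp add: chain_append)
  moreover have "q \<in> paths Y"
    unfolding 1(2) w ab using chain cd(1,3,4,6-8) by (simp add: chain_append)
  ultimately show ?thesis
    using that[of x as c d bs m u] s 1 w ab by simp
qed

lemma entry_replace:
  assumes "Tgt Y u = Tgt Y d"
  shows "entry (x, as @ m # u # bs) i =
    (if i = length as then m else if i = Suc (length as) then u else entry (x, as @ c # d # bs) i)"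
proof -
  have "ptgt Y (x, as @ m # u # bs) = ptgt Y (x, as @ c # d # bs)"
    using assms by (simp add: ptgt_append)
  then show ?thesis
    by (auto simp: entry_def nth_append nth_Cons')
qed

text \<open>Reductions and deformations never decrease the first entry.\<close>

lemma step_first_entry:
  assumes "step p q" "p \<in> paths Y"
  shows "q \<in> paths Y \<and> entry p 0 \<preceq> entry q 0"
  using assms(1)
proof
  assume "reduction_step Y reductions_bar p q"
  then obtain x as c d m u bs where r: "p = (x, as @ c # d # bs)" "q = (x, as @ m # u # bs)"
    "slide c d m u" "q \<in> paths Y"
    by (rule reduction_stepE) blast
  have "entry p 0 \<preceq> entry q 0"
    using entry_replace[OF slideD(8)[OF r(3)], of x as m bs 0 c] entry_path(1)[OF assms(2), of 0]
      slideD(9)[OF r(3)] r(1,2) gdvd_refl by (cases as) auto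
  then show ?thesis
    using r by simp
next
  assume pq: "germ_path_equiv Y p q"
  then obtain e where e: "e 0 = One Y (fst p)" "\<And>i. e i \<in> units"
    "\<And>i. \<exists>c. e i \<bullet> entry q i = Some c \<and> entry p i \<bullet> e (Suc i) = Some c"
    by (rule path_equiv_units) blast
  then show ?thesis
    using pq divides_iff one_left mulD(5) entry_path(3) by (metis germ_path_equiv_def mulD(1,2,4) one(3) fst_obj assms(2))
qed

lemma steps_first_entry:
  assumes "(\<lambda>u v. step u v)\<^sup>*\<^sup>* p q" "p \<in> paths Y"
  shows "q \<in> paths Y \<and> entry p 0 \<preceq> entry q 0"
  using assms
proof (induction rule: rtranclp_induct)
  case base
  then show ?case
    using entry_path(1) gdvd_refl by blast
next
  case (step q r)
  then show ?case
    using step_first_entry gdvd_trans by blast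
qed

subsection \<open>Paths that remain a rearrangement of a pair\<close>

text \<open>\<open>confined a b M p\<close> describes the paths that the pair \<open>(a, b)\<close> can turn into: up to units, a
  slide \<open>(a \<bullet> s, y)\<close> of the pair followed by invertible entries, with first entry below \<open>M\<close>.
  If \<open>M\<close> bounds the results of all reductions of \<open>(a, b)\<close>, this class is closed under steps: a
  reduction can only take place in the first pair, and it comes from a reduction of \<open>(a, b)\<close>.\<close>

definition bounds_reductions :: "'b \<Rightarrow> 'b \<Rightarrow> 'b \<Rightarrow> bool" where
  "bounds_reductions a b M \<longleftrightarrow> (\<forall>m u. slide a b m u \<longrightarrow> \<not> m \<preceq> a \<longrightarrow> tight m u \<longrightarrow> m \<preceq> M)"

definition confined :: "'b \<Rightarrow> 'b \<Rightarrow> 'b \<Rightarrow> ('a, 'b) path \<Rightarrow> bool" where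
  "confined a b M p \<longleftrightarrow> p \<in> paths Y \<and> entry p 0 \<preceq> M \<and> (\<forall>i\<ge>2. entry p i \<in> units) \<and>
     (\<exists>s y e. a \<bullet> s = Some (entry p 0) \<and> s \<bullet> y = Some b \<and> e \<in> units \<and> entry p 1 \<bullet> e = Some y)"

lemma confined_path_equiv:
  assumes "confined a b M p" "germ_path_equiv Y p q"
  shows "confined a b M q"
proof -
  obtain s y h where s: "a \<bullet> s = Some (entry p 0)" "s \<bullet> y = Some b" "h \<in> units" "entry p 1 \<bullet> h = Some y"
    and p: "p \<in> paths Y" "entry p 0 \<preceq> M" "\<And>i. i \<ge> 2 \<Longrightarrow> entry p i \<in> units"
    using assms(1) by (auto simp: confined_def)
  have q: "q \<in> paths Y" "fst q = fst p"
    using assms(2) by (auto simp: germ_path_equiv_def deformation_def germ_emb_path_def)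
  obtain e where e: "e 0 = One Y (fst p)" "\<And>i. e i \<in> units"
    "\<And>i. \<exists>c. e i \<bullet> entry q i = Some c \<and> entry p i \<bullet> e (Suc i) = Some c"
    using assms(2) by (rule path_equiv_units) blast
  have q0: "entry p 0 \<bullet> e 1 = Some (entry q 0)"
    using e(3)[of 0] e(1) one_left entry_path(1,3)[OF q(1)] q(2) by simp
  obtain c where c: "e 1 \<bullet> entry q 1 = Some c" "entry p 1 \<bullet> e 2 = Some c"
    using e(3)[of 1] by (auto simp: numeral_2_eq_2)
  obtain s' where s': "s \<bullet> e 1 = Some s'" "a \<bullet> s' = Some (entry q 0)"
    using s(1) q0 by (rule mul_assocE) blast
  obtain e2' where e2': "e2' \<in> units" "e 2 \<bullet> e2' = Some (One Y (Src Y (e 2)))" "Tgt Y e2' = Src Y (e 2)"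
    using e(2)[of 2] by (rule unitE) blast
  have types: "Src Y h = Src Y (e 2)" "h \<in> Elt Y"
    using mulD(4)[OF c(2)] mulD(4)[OF s(4)] unit_in s(3) by auto
  obtain h' where h': "e2' \<bullet> h = Some h'"
    using e2'(1) types(2) by (rule unit_mul) (simp add: e2'(3) types(1))
  have h: "e 2 \<bullet> h' = Some h"
    using mul_assoc[OF e2'(2) h'] one_left[of h] types by simp
  have ch': "c \<bullet> h' = Some y"
    using mul_assoc[OF c(2) h] s(4) by simp
  obtain y' where y': "entry q 1 \<bullet> h' = Some y'" "e 1 \<bullet> y' = Some y"
    using c(1) ch' by (rule mul_assocE) blast
  have "s' \<bullet> y' = Some b"
    using mul_assoc[OF s'(1) y'(2)] s(2) by simp
  moreover have "h' \<in> units"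
    using unit_mul_unit[OF h' e2'(1) s(3)] .
  moreover have "entry q 0 \<preceq> M"
    using mul_unit_dvd[OF q0 e(2)] p(2) gdvd_trans by blast
  moreover have "entry q i \<in> units" if "i \<ge> 2" for i
  proof -
    obtain c where "e i \<bullet> entry q i = Some c" "entry p i \<bullet> e (Suc i) = Some c"
      using e(3) by blast
    then show ?thesis
      using unit_mul_unit unit_factor(2) p(3)[OF that] e(2) by blast
  qed
  ultimately show ?thesis
    using q(1) s'(2) y'(1) by (auto simp: confined_def)
qed

lemma confined_reduction_step:
  assumes "confined a b M p" "reduction_step Y reductions_bar p q" "bounds_reductions a b M"
  shows "confined a b M q"
proof -
  obtain s y h where s: "a \<bullet> s = Some (entry p 0)" "s \<bullet> y = Some b" "h \<in> units" "entry p 1 \<bullet> h = Some y"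
    and p: "entry p 0 \<preceq> M" "\<And>i. i \<ge> 2 \<Longrightarrow> entry p i \<in> units"
    using assms(1) by (auto simp: confined_def)
  obtain x as c d m u bs where r: "p = (x, as @ c # d # bs)" "q = (x, as @ m # u # bs)"
    "slide c d m u" "\<not> m \<preceq> c" "tight m u" "q \<in> paths Y"
    using assms(2) by (rule reduction_stepE) blast
  obtain t where t: "c \<bullet> t = Some m" "t \<bullet> u = Some d"
    using r(3) by (auto simp: slide_def)
  \<comment> \<open>Behind the first entry the right member \<open>d\<close> of the reduced pair would be a unit, and then so
    would be the factor \<open>t\<close> that slides.\<close>
  have "as = []"
  proof (rule ccontr)
    assume "as \<noteq> []"
    then have "Suc (length as) \<ge> 2"
      by (cases as) auto
    then have "d \<in> units"
      using p(2)[of "Suc (length as)"] r(1) by (simp add: entry_def nth_append)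
    then have "m \<preceq> c"
      using mul_unit_dvd[OF t(1)] unit_factor(1)[OF t(2)] by blast
    then show False
      using r(4) by simp
  qed
  then have entries: "entry p 0 = c" "entry p 1 = d" "entry q 0 = m" "entry q 1 = u"
    "\<And>i. i \<ge> 2 \<Longrightarrow> entry q i = entry p i"
    using r(1,2) entry_replace[OF slideD(8)[OF r(3)], of x as m bs _ c]
    by (auto simp: entry_def)
  obtain s' where s': "s \<bullet> t = Some s'" "a \<bullet> s' = Some m"
    using s(1) t(1) entries(1) mul_assocE by metis
  obtain y' where y': "u \<bullet> h = Some y'" "t \<bullet> y' = Some y"
    using t(2) s(4) entries(2) mul_assocE by metis
  have s'y': "s' \<bullet> y' = Some b"
    using mul_assoc[OF s'(1) y'(2)] s(2) by simp
  obtain h' where "y' \<bullet> h' = Some u"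
    using y'(1) s(3) by (rule unit_right_inverse) blast
  then have "tight m y'"
    by (rule tight_unit_right[OF r(5)])
  moreover have "slide a b m y'"
    using s'(2) s'y' by (auto simp: slide_def)
  moreover have "\<not> m \<preceq> a"
    using r(4) s(1) entries(1) gdvd_trans divides_iff by metis
  ultimately have "m \<preceq> M"
    using assms(3) by (auto simp: bounds_reductions_def)
  then show ?thesis
    unfolding confined_def entries using r(6) s'(2) s'y' y'(1) s(3) p(2) entries(5) by auto
qed

lemma confined_steps:
  assumes "(\<lambda>u v. step u v)\<^sup>*\<^sup>* p q" "confined a b M p" "bounds_reductions a b M"
  shows "confined a b M q"
  using assms
proof (induction rule: rtranclp_induct)
  case (step q r)
  then show ?case
    using confined_path_equiv confined_reduction_step by blast
qed

text \<open>If \<open>p\<close> and \<open>q\<close> can be joined, the first entry of \<open>p\<close> can only grow on the way, while that of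
  \<open>q\<close> stays below \<open>M\<close>.\<close>

lemma resolvable_bound:
  assumes "resolvable_upto Y reductions_bar (germ_path_equiv Y) p q" "p \<in> paths Y"
    "confined a b M q" "bounds_reductions a b M"
  shows "entry p 0 \<preceq> M"
proof -
  obtain p' q' where p': "(\<lambda>u v. step u v)\<^sup>*\<^sup>* p p'" and q': "(\<lambda>u v. step u v)\<^sup>*\<^sup>* q q'"
    and "germ_path_equiv Y p' q'"
    using assms(1) unfolding resolvable_upto_def by blast
  then have "entry p 0 \<preceq> entry q' 0"
    using steps_first_entry[OF p' assms(2)] step_first_entry[of p' q'] gdvd_trans by blast
  moreover have "entry q' 0 \<preceq> M"
    using confined_steps[OF q' assms(3,4)] by (simp add: confined_def)
  ultimately show ?thesis
    by (rule gdvd_trans)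
qed

lemma confined_pair:
  assumes "a \<in> Elt Y" "b \<in> Elt Y" "Tgt Y a = Src Y b" "a \<preceq> M"
  shows "confined a b M (Src Y a, [a, b])" "confined a b M (Src Y a, [a, b, One Y (Tgt Y b)])"
proof -
  have "entry (Src Y a, [a, b]) i \<in> units" "entry (Src Y a, [a, b, One Y (Tgt Y b)]) i \<in> units" if "i \<ge> 2" for i
  proof -
    obtain j where "i = Suc (Suc j)"
      using \<open>i \<ge> 2\<close> by (metis add_2_eq_Suc le_Suc_ex)
    then show "entry (Src Y a, [a, b]) i \<in> units" "entry (Src Y a, [a, b, One Y (Tgt Y b)]) i \<in> units"
      using one_unit[of "Tgt Y b"] assms(2) by (cases j; auto simp: entry_def)+
  qed
  moreover have "a \<bullet> One Y (Tgt Y a) = Some a" "One Y (Tgt Y a) \<bullet> b = Some b"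
    "b \<bullet> One Y (Tgt Y b) = Some b" "One Y (Tgt Y b) \<in> units"
    using assms by (auto intro: one_left one_right one_unit)
  ultimately show "confined a b M (Src Y a, [a, b])" "confined a b M (Src Y a, [a, b, One Y (Tgt Y b)])"
    using assms unfolding confined_def by (auto simp: entry_Cons_Suc)
qed

lemma tight_unit:
  assumes "u \<in> units"
  shows "tight a u"
  unfolding tight_def slide_def using assms mul_unit_dvd unit_factor(1) by blast

text \<open>Any slide \<open>(m, u)\<close> of \<open>(a, b)\<close>, with \<open>b = t \<bullet> u\<close>, is compared with the reductions of \<open>(a, b)\<close> through
  the ambiguity of the path \<open>(a, t, u)\<close>: composing \<open>a\<close> with \<open>t\<close> leads to a first entry above \<open>m\<close>,
  composing \<open>t\<close> with \<open>u\<close> leads to a path confined by \<open>(a, b)\<close>.\<close>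

lemma slide_bound:
  assumes "all_ambiguities_resolvable Y reductions_bar (germ_path_equiv Y)"
    "bounds_reductions a b M" "a \<preceq> M" "slide a b m u"
  shows "m \<preceq> M"
proof (cases "m \<preceq> a \<or> u \<in> units")
  case True
  then show ?thesis
    using assms tight_unit gdvd_trans unfolding bounds_reductions_def by blast
next
  case False
  obtain t where t: "a \<bullet> t = Some m" "t \<bullet> u = Some b"
    using assms(4) by (auto simp: slide_def)
  note at = mulD[OF t(1)] and tu = mulD[OF t(2)]
  \<comment> \<open>Both products are reductions: \<open>m\<close> does not divide \<open>a\<close>, and \<open>b\<close> does not divide \<open>t\<close> as \<open>u\<close> is no
    unit; a trailing identity makes the results irreducible.\<close>
  let ?\<sigma> = "((Src Y a, [a, t]), (Src Y a, [m, One Y (Tgt Y t)]))"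
    and ?\<tau> = "((Src Y t, [t, u]), (Src Y t, [b, One Y (Tgt Y u)]))"
  have "slide a t m (One Y (Tgt Y t))" "slide t u b (One Y (Tgt Y u))"
    using t at tu one_right unfolding slide_def by blast+
  moreover have "tight m (One Y (Tgt Y t))" "tight b (One Y (Tgt Y u))"
    using at tu by (auto intro!: tight_unit one_unit)
  moreover have "\<not> b \<preceq> t"
  proof
    assume "b \<preceq> t"
    then obtain v where v: "b \<bullet> v = Some t"
      by (auto simp: divides_iff)
    have "u \<bullet> v = Some (One Y (Tgt Y t))"
      using mul_assoc_cancel[OF t(2) v] one_right tu(1) by blast
    then show False
      using False right_inverse_unit(1) tu(1) by simp
  qed
  ultimately have "?\<sigma> \<in> reductions_bar" "?\<tau> \<in> reductions_bar"
    using False by (auto simp: reductions_bar_eq)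
  then have "overlap_ambiguity Y reductions_bar ?\<sigma> ?\<tau> (Src Y a, [a]) (Src Y t, [t]) (Src Y u, [u])"
    using at tu by (auto simp: overlap_ambiguity_def)
  then have "resolvable_upto Y reductions_bar (germ_path_equiv Y)
      (Src Y a, [m, One Y (Tgt Y t), u]) (Src Y a, [a, b, One Y (Tgt Y u)])"
    using assms(1) unfolding all_ambiguities_resolvable_def by fastforce
  moreover have "(Src Y a, [m, One Y (Tgt Y t), u]) \<in> paths Y"
    using at tu by simp
  moreover have "confined a b M (Src Y a, [a, b, One Y (Tgt Y u)])"
    using confined_pair(2)[of a b M] at tu assms(3) by simp
  ultimately have "entry (Src Y a, [m, One Y (Tgt Y t), u]) 0 \<preceq> M"
    using assms(2) by (rule resolvable_bound)
  then show ?thesis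
    by simp
qed

text \<open>An irreducible pair bounds its own slides by \<open>slide_bound\<close>, so it is its own full slide; for a
  reducible one, any reduction with an irreducible result is a full slide.\<close>

theorem resolvable_has_full_slides:
  assumes "all_ambiguities_resolvable Y reductions_bar (germ_path_equiv Y)"
  shows "has_full_slides"
  unfolding has_full_slides_def
proof (intro ballI impI)
  fix a b assume ab: "a \<in> Elt Y" "b \<in> Elt Y" "Tgt Y a = Src Y b"
  show "\<exists>m u. full_slide a b m u"
  proof (cases "\<exists>m u. slide a b m u \<and> \<not> m \<preceq> a \<and> tight m u")
    case False
    then have "bounds_reductions a b a"
      by (auto simp: bounds_reductions_def)
    then have "m \<preceq> a" if "slide a b m u" for m u
      using slide_bound[OF assms] that ab gdvd_refl by blast
    moreover have "slide a b a b"
      unfolding slide_def using ab one_left[of b "Tgt Y a"] one_right[of a "Tgt Y a"]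
      by (intro exI[of _ "One Y (Tgt Y a)"]) simp
    ultimately show ?thesis
      by (auto simp: full_slide_def)
  next
    case True
    then obtain m\<^sub>0 u\<^sub>0 where m\<^sub>0: "slide a b m\<^sub>0 u\<^sub>0" "\<not> m\<^sub>0 \<preceq> a" "tight m\<^sub>0 u\<^sub>0"
      by blast
    note types = slideD[OF m\<^sub>0(1)]
    \<comment> \<open>Two reductions of the pair itself form an inclusion ambiguity; as \<open>(m\<^sub>0, u\<^sub>0)\<close> is irreducible,
      its resolution shows that \<open>m\<^sub>0\<close> bounds the results of all of them.\<close>
    have "m \<preceq> m\<^sub>0" if m: "slide a b m u" "\<not> m \<preceq> a" "tight m u" for m u
    proof (cases "(m, u) = (m\<^sub>0, u\<^sub>0)")
      case True
      then show ?thesis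
        using types(3) gdvd_refl by simp
    next
      case False
      let ?\<sigma> = "((Src Y a, [a, b]), (Src Y a, [m, u]))"
        and ?\<tau> = "((Src Y a, [a, b]), (Src Y a, [m\<^sub>0, u\<^sub>0]))"
      have "?\<sigma> \<in> reductions_bar" "?\<tau> \<in> reductions_bar"
        using m m\<^sub>0 by (auto simp: reductions_bar_eq)
      then have "inclusion_ambiguity Y reductions_bar ?\<sigma> ?\<tau> (Src Y a, []) (Src Y a, [a, b]) (Tgt Y b, [])"
        using False ab by (auto simp: inclusion_ambiguity_def)
      then have "resolvable_upto Y reductions_bar (germ_path_equiv Y)
          ((Src Y a, []) \<odot> snd ?\<sigma> \<odot> (Tgt Y b, [])) (snd ?\<tau>)"
        using assms unfolding all_ambiguities_resolvable_def by blast
      then have "resolvable_upto Y reductions_bar (germ_path_equiv Y) (Src Y a, [m, u]) (Src Y m\<^sub>0, [m\<^sub>0, u\<^sub>0])"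
        using types(6) by simp
      moreover have "(Src Y a, [m, u]) \<in> paths Y"
        using slideD[OF m(1)] by simp
      moreover have "confined m\<^sub>0 u\<^sub>0 m\<^sub>0 (Src Y m\<^sub>0, [m\<^sub>0, u\<^sub>0])"
        using confined_pair(1)[of m\<^sub>0 u\<^sub>0 m\<^sub>0] types gdvd_refl by simp
      moreover have "bounds_reductions m\<^sub>0 u\<^sub>0 m\<^sub>0"
        using m\<^sub>0(3) by (auto simp: bounds_reductions_def tight_def)
      ultimately have "entry (Src Y a, [m, u]) 0 \<preceq> m\<^sub>0"
        by (rule resolvable_bound)
      then show ?thesis
        by simp
    qed
    then have "bounds_reductions a b m\<^sub>0"
      by (auto simp: bounds_reductions_def)
    then have "full_slide a b m\<^sub>0 u\<^sub>0"
      using m\<^sub>0(1) slide_bound[OF assms] types(9) by (auto simp: full_slide_def)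
    then show ?thesis
      by blast
  qed
qed

end

section \<open>Normal forms for a Groebner--Shirshov basis\<close>

text \<open>The sum of the coefficients over a set of paths; it vanishes on the ideal \<open>(R)\<close> if the set is a
  union of congruence classes.\<close>

definition class_sum :: "'w set \<Rightarrow> ('w \<Rightarrow>\<^sub>0 'k::field) \<Rightarrow> 'k" where
  "class_sum Q f = (\<Sum>w\<in>Poly_Mapping.keys f. if w \<in> Q then Poly_Mapping.lookup f w else 0)"

lemma class_sum_superset:
  assumes "finite K" "Poly_Mapping.keys f \<subseteq> K"
  shows "class_sum Q f = (\<Sum>w\<in>K. if w \<in> Q then Poly_Mapping.lookup f w else 0)"
  unfolding class_sum_def using assms by (intro sum.mono_neutral_left) (auto simp: in_keys_iff)

lemma class_sum_zero [simp]: "class_sum Q 0 = 0"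
  by (simp add: class_sum_def)

lemma class_sum_add: "class_sum Q (f + g) = class_sum Q f + class_sum Q g"
proof -
  let ?K = "Poly_Mapping.keys f \<union> Poly_Mapping.keys g"
  have "class_sum Q (f + g) = (\<Sum>w\<in>?K. if w \<in> Q then Poly_Mapping.lookup (f + g) w else 0)"
    using Poly_Mapping.keys_add[of f g] by (intro class_sum_superset) auto
  also have "\<dots> = (\<Sum>w\<in>?K. (if w \<in> Q then Poly_Mapping.lookup f w else 0) +
      (if w \<in> Q then Poly_Mapping.lookup g w else 0))"
    by (intro sum.cong) (auto simp: lookup_add)
  also have "\<dots> = class_sum Q f + class_sum Q g"
    using class_sum_superset[of ?K f Q] class_sum_superset[of ?K g Q] by (simp add: sum.distrib)
  finally show ?thesis .
qed

lemma class_sum_single: "class_sum Q (Poly_Mapping.single w c) = (if w \<in> Q then c else 0)"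
  by (simp add: class_sum_def)

lemma class_sum_sum: "finite J \<Longrightarrow> class_sum Q (\<Sum>i\<in>J. F i) = (\<Sum>i\<in>J. class_sum Q (F i))"
  by (induction J rule: finite_induct) (simp_all add: class_sum_add)

lemma keys_single_diff:
  fixes u v :: 'w
  assumes "u \<noteq> v"
  shows "Poly_Mapping.keys (Poly_Mapping.single u 1 - Poly_Mapping.single v (1 :: 'k::field)) = {u, v}"
  using assms by (auto simp: in_keys_iff lookup_minus lookup_single when_def split: if_splits)

context presentation
begin

lemma rel_ideal_keys:
  "rel_ideal X R x y (f :: ('o, 'e) path \<Rightarrow>\<^sub>0 'k::field) \<Longrightarrow>
     Poly_Mapping.keys f \<subseteq> {w \<in> paths X. fst w = x \<and> ptgt X w = y}"
proof (induction rule: rel_ideal.induct)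
  case (rel_ideal_rel u v)
  have "u \<in> paths X" "v \<in> paths X" "fst v = fst u" "ptgt X v = ptgt X u"
    using rel_ideal_rel relations by (auto simp: is_relations_def parallel_def)
  moreover have "Poly_Mapping.keys (Poly_Mapping.single u 1 - Poly_Mapping.single v (1 :: 'k)) \<subseteq> {u, v}"
    by (auto simp: in_keys_iff lookup_minus lookup_single when_def split: if_splits)
  ultimately show ?case
    by blast
next
  case (rel_ideal_add x y f g)
  then show ?case
    using Poly_Mapping.keys_add[of f g] by blast
next
  case (rel_ideal_mult x y f a b c)
  show ?case
  proof
    fix z assume "z \<in> Poly_Mapping.keys (\<Sum>w\<in>Poly_Mapping.keys f.
      Poly_Mapping.single (a \<odot> w \<odot> b) (c * Poly_Mapping.lookup f w))"
    then have "(\<Sum>w\<in>Poly_Mapping.keys f.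
        Poly_Mapping.lookup (Poly_Mapping.single (a \<odot> w \<odot> b) (c * Poly_Mapping.lookup f w)) z) \<noteq> 0"
      by (simp add: in_keys_iff lookup_sum)
    then obtain w where "w \<in> Poly_Mapping.keys f"
      "Poly_Mapping.lookup (Poly_Mapping.single (a \<odot> w \<odot> b) (c * Poly_Mapping.lookup f w)) z \<noteq> 0"
      by (meson sum.not_neutral_contains_not_neutral)
    then have w: "z = a \<odot> w \<odot> b" "w \<in> paths X" "fst w = x" "ptgt X w = y"
      using rel_ideal_mult.IH by (auto simp: lookup_single when_def split: if_splits)
    then have "composable X a w" "composable X (a \<odot> w) b"
      using rel_ideal_mult.hyps by (auto simp: composable_def pcat_path ptgt_pcat)
    then show "z \<in> {w \<in> paths X. fst w = fst a \<and> ptgt X w = ptgt X b}"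
      using w by (simp add: pcat_path ptgt_pcat)
  qed
qed simp

lemma rel_ideal_class_sum:
  "\<lbrakk>rel_ideal X R x y (f :: ('o, 'e) path \<Rightarrow>\<^sub>0 'k::field); \<forall>u v. u \<simeq> v \<longrightarrow> (u \<in> Q \<longleftrightarrow> v \<in> Q)\<rbrakk>
    \<Longrightarrow> class_sum Q f = 0"
proof (induction arbitrary: Q rule: rel_ideal.induct)
  case (rel_ideal_rel u v)
  have "u \<in> Q \<longleftrightarrow> v \<in> Q"
    using rel_ideal_rel.prems pcong_rel[OF rel_ideal_rel.hyps, of X] by blast
  have diff: "Poly_Mapping.single u 1 - Poly_Mapping.single v (1 :: 'k) =
      Poly_Mapping.single u 1 + Poly_Mapping.single v (- 1)"
    by (simp add: single_uminus)
  show ?case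
    unfolding diff using \<open>u \<in> Q \<longleftrightarrow> v \<in> Q\<close> by (simp add: class_sum_add class_sum_single)
next
  case (rel_ideal_add x y f g)
  have "class_sum Q f = 0" "class_sum Q g = 0"
    using rel_ideal_add.IH rel_ideal_add.prems by blast+
  then show ?case
    by (simp add: class_sum_add)
next
  case (rel_ideal_mult x y f a b c)
  \<comment> \<open>The words that the context \<open>a _ b\<close> maps into \<open>Q\<close> again form a union of congruence classes.\<close>
  let ?Q = "{w \<in> paths X. fst w = x \<and> ptgt X w = y \<and> a \<odot> w \<odot> b \<in> Q}"
  have keys: "w \<in> paths X \<and> fst w = x \<and> ptgt X w = y" if "w \<in> Poly_Mapping.keys f" for w
    using rel_ideal_keys[OF rel_ideal_mult.hyps(1)] that by auto
  have closed: "u \<in> ?Q \<Longrightarrow> v \<in> ?Q" if "u \<simeq> v" for u v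
  proof -
    assume u: "u \<in> ?Q"
    note uv = cong_paths[OF that]
    have "a \<odot> u \<odot> b \<simeq> a \<odot> v \<odot> b"
      using u uv that rel_ideal_mult.hyps
      by (intro pcong_comp pcong_refl) (auto simp: composable_def pcat_path ptgt_pcat)
    then show "v \<in> ?Q"
      using u uv rel_ideal_mult.prems by auto
  qed
  then have "\<forall>u v. u \<simeq> v \<longrightarrow> (u \<in> ?Q \<longleftrightarrow> v \<in> ?Q)"
    using pcong_sym by (intro allI impI iffI) blast+
  then have "class_sum ?Q f = 0"
    by (rule rel_ideal_mult.IH)
  have "class_sum Q (\<Sum>w\<in>Poly_Mapping.keys f. Poly_Mapping.single (a \<odot> w \<odot> b) (c * Poly_Mapping.lookup f w)) =
      (\<Sum>w\<in>Poly_Mapping.keys f. c * (if w \<in> ?Q then Poly_Mapping.lookup f w else 0))"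
    unfolding class_sum_sum[OF finite_keys] class_sum_single using keys by (intro sum.cong) auto
  also have "\<dots> = c * class_sum ?Q f"
    by (simp add: class_sum_def sum_distrib_left)
  finally show ?case
    using \<open>class_sum ?Q f = 0\<close> by simp
qed simp

lemma cong_rel_ideal:
  "u \<simeq> v \<Longrightarrow> rel_ideal X R (fst u) (ptgt X u)
     (Poly_Mapping.single u 1 - Poly_Mapping.single v (1 :: 'k::field))"
proof (induction rule: pcong.induct)
  have mult: "rel_ideal X R (fst a) (ptgt X b)
      (Poly_Mapping.single (a \<odot> u \<odot> b) c - Poly_Mapping.single (a \<odot> v \<odot> b) (c :: 'k))"
    if "rel_ideal X R x y (Poly_Mapping.single u 1 - Poly_Mapping.single v (1 :: 'k))"
      "a \<in> paths X" "ptgt X a = x" "b \<in> paths X" "fst b = y" for x y u v a b and c :: 'k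
  proof (cases "u = v")
    case True
    then show ?thesis
      using that by (auto intro: rel_ideal_zero simp: fst_obj ptgt_obj)
  next
    case False
    have "rel_ideal X R (fst a) (ptgt X b)
      (\<Sum>w\<in>Poly_Mapping.keys (Poly_Mapping.single u 1 - Poly_Mapping.single v (1 :: 'k)).
        Poly_Mapping.single (a \<odot> w \<odot> b)
          (c * Poly_Mapping.lookup (Poly_Mapping.single u 1 - Poly_Mapping.single v (1 :: 'k)) w))"
      using that by (rule rel_ideal_mult)
    then show ?thesis
      unfolding keys_single_diff[OF False] using False
      by (simp add: lookup_minus lookup_single when_def single_uminus)
  qed
  {
    case (pcong_refl p)
    then show ?case by (simp add: rel_ideal_zero fst_obj ptgt_obj)
  next
    case (pcong_rel u v)
    then show ?case by (rule rel_ideal_rel)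
  next
    case (pcong_sym p q)
    note pq = cong_paths[OF pcong_sym.hyps]
    have "rel_ideal X R (fst p) (ptgt X p)
        (Poly_Mapping.single ((fst p, []) \<odot> p \<odot> (ptgt X p, [])) (- 1) -
         Poly_Mapping.single ((fst p, []) \<odot> q \<odot> (ptgt X p, [])) (- 1 :: 'k))"
      using mult[OF pcong_sym.IH, of "(fst p, [])" "(ptgt X p, [])" "- 1"] pq by (simp add: fst_obj ptgt_obj)
    moreover have "(fst p, []) \<odot> p \<odot> (ptgt X p, []) = p" "(fst p, []) \<odot> q \<odot> (ptgt X p, []) = q"
      using pq by (simp_all add: pcat_def prod_eq_iff)
    ultimately show ?case
      using pq by (simp add: single_uminus)
  next
    case (pcong_trans p q r)
    note pq = cong_paths[OF pcong_trans.hyps(1)]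
    have "rel_ideal X R (fst p) (ptgt X p)
       ((Poly_Mapping.single p 1 - Poly_Mapping.single q 1) +
        (Poly_Mapping.single q 1 - Poly_Mapping.single r (1 :: 'k)))"
      using pcong_trans.IH pq by (intro rel_ideal_add) auto
    then show ?case
      by simp
  next
    case (pcong_comp p q p' q')
    note pq = cong_paths[OF pcong_comp.hyps(1)] cong_paths[OF pcong_comp.hyps(2)]
    have comp: "ptgt X p = fst p'" "composable X p p'"
      using pcong_comp.hyps(3) by (auto simp: composable_def)
    have "rel_ideal X R (fst p) (ptgt X p')
        (Poly_Mapping.single ((fst p, []) \<odot> p \<odot> p') 1 - Poly_Mapping.single ((fst p, []) \<odot> q \<odot> p') (1 :: 'k))"
      using mult[OF pcong_comp.IH(1), of "(fst p, [])" p' 1] pq comp by (simp add: fst_obj)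
    moreover have "rel_ideal X R (fst q) (ptgt X p')
        (Poly_Mapping.single (q \<odot> p' \<odot> (ptgt X p', [])) 1 - Poly_Mapping.single (q \<odot> q' \<odot> (ptgt X p', [])) (1 :: 'k))"
      using mult[OF pcong_comp.IH(2), of q "(ptgt X p', [])" 1] pq comp by (simp add: ptgt_obj)
    ultimately have "rel_ideal X R (fst p) (ptgt X p')
        ((Poly_Mapping.single (p \<odot> p') 1 - Poly_Mapping.single (q \<odot> p') 1) +
         (Poly_Mapping.single (q \<odot> p') 1 - Poly_Mapping.single (q \<odot> q') (1 :: 'k)))"
      using pq by (intro rel_ideal_add) (simp_all add: pcat_def)
    then show ?case
      using comp by (simp add: ptgt_pcat)
  }
qed

end

locale groebner_presentation = presentation X R
  for X :: "('o, 'e, 'z) precat_scheme" and R +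
  fixes lt :: "('o, 'e) path \<Rightarrow> ('o, 'e) path \<Rightarrow> bool"
    and G :: "(('o, 'e) path \<Rightarrow>\<^sub>0 'k::field) set"
  assumes admissible: "admissible_order X lt"
    and basis: "gs_basis X R lt G"
begin

lemma lt_wf: "wfp (\<lambda>u v. parallel X u v \<and> lt u v)"
  and lt_trans: "\<lbrakk>parallel X u v; parallel X v w; lt u v; lt v w\<rbrakk> \<Longrightarrow> lt u w"
  and lt_total: "\<lbrakk>parallel X u v; u \<noteq> v\<rbrakk> \<Longrightarrow> lt u v \<or> lt v u"
  and lt_mult: "\<lbrakk>parallel X u v; composable X a u; composable X u b; lt u v\<rbrakk>
    \<Longrightarrow> lt (a \<odot> u \<odot> b) (a \<odot> v \<odot> b)"
  using admissible unfolding admissible_order_def by blast+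

lemma lt_asym: "\<lbrakk>parallel X u v; lt u v\<rbrakk> \<Longrightarrow> \<not> lt v u"
  using wfp_imp_asymp[OF lt_wf] by (auto simp: parallel_def dest: asympD)

lemma leading_word:
  assumes "rel_ideal X R x y f" "f \<noteq> 0"
  shows "leading_word lt f \<in> Poly_Mapping.keys f"
    "\<And>v. \<lbrakk>v \<in> Poly_Mapping.keys f; v \<noteq> leading_word lt f\<rbrakk> \<Longrightarrow> lt v (leading_word lt f)"
proof -
  let ?max = "\<lambda>K w. w \<in> K \<and> (\<forall>v\<in>K. v \<noteq> w \<longrightarrow> lt v w)"
  have par: "parallel X u v" if "u \<in> Poly_Mapping.keys f" "v \<in> Poly_Mapping.keys f" for u v
    using rel_ideal_keys[OF assms(1)] that by (auto simp: parallel_def)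
  have ex: "\<exists>w. ?max K w" if "finite K" "K \<noteq> {}" "K \<subseteq> Poly_Mapping.keys f" for K
    using that
  proof (induction rule: finite_ne_induct)
    case (insert u K)
    then obtain w where w: "w \<in> K" "\<forall>v\<in>K. v \<noteq> w \<longrightarrow> lt v w"
      by auto
    show ?case
    proof (cases "lt u w")
      case True
      then show ?thesis
        using w insert by (intro exI[of _ w]) auto
    next
      case False
      have uw: "lt w u"
        using False lt_total[OF par[of u w]] w insert by auto
      have "lt v u" if "v \<in> K" for v
      proof (cases "v = w")
        case False
        then show ?thesis
          using lt_trans[OF par[of v w] par[of w u]] w insert uw that by auto
      qed (use uw in simp)
      then show ?thesis
        by (intro exI[of _ u]) auto
    qed
  qed auto
  have "\<exists>!w. ?max (Poly_Mapping.keys f) w"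
  proof (rule ex_ex1I)
    show "\<exists>w. ?max (Poly_Mapping.keys f) w"
      using assms(2) by (intro ex) auto
    show "w = w'" if "?max (Poly_Mapping.keys f) w" "?max (Poly_Mapping.keys f) w'" for w w'
    proof (rule ccontr)
      assume "w \<noteq> w'"
      then have "lt w w'" "lt w' w"
        using that by auto
      then show False
        using lt_asym[OF par[of w w']] that by auto
    qed
  qed
  then have "?max (Poly_Mapping.keys f) (leading_word lt f)"
    unfolding leading_word_def by (rule theI')
  then show "leading_word lt f \<in> Poly_Mapping.keys f"
    "\<And>v. \<lbrakk>v \<in> Poly_Mapping.keys f; v \<noteq> leading_word lt f\<rbrakk> \<Longrightarrow> lt v (leading_word lt f)"
    by blast+
qed

text \<open>The leading word of the difference of two congruent irreducible words is one of the two, yet it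
  contains the leading word of a basis element unless the difference vanishes.\<close>

lemma irreducible_unique:
  assumes "v \<in> irr_words X lt G" "w \<in> irr_words X lt G" "v \<simeq> w"
  shows "v = w"
proof (rule ccontr)
  assume "v \<noteq> w"
  let ?f = "Poly_Mapping.single v 1 - Poly_Mapping.single w (1 :: 'k)"
  have keys: "Poly_Mapping.keys ?f = {v, w}"
    using \<open>v \<noteq> w\<close> by (rule keys_single_diff)
  then have "?f \<noteq> 0"
    by (metis insert_not_empty keys_zero)
  moreover have ideal: "rel_ideal X R (fst v) (ptgt X v) ?f"
    using assms(3) by (rule cong_rel_ideal)
  ultimately obtain g where "g \<in> G" "subpath X (leading_word lt g) (leading_word lt ?f)"
    using basis unfolding gs_basis_def by blast
  moreover have "leading_word lt ?f \<in> irr_words X lt G"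
    using leading_word(1)[OF ideal \<open>?f \<noteq> 0\<close>] keys assms by auto
  ultimately show False
    by (auto simp: irr_words_def avoiding_paths_def)
qed

text \<open>A reducible path contains the leading word \<open>u\<close> of a basis element \<open>g\<close>.  The coefficients of \<open>g\<close>
  over the congruence class of \<open>u\<close> sum up to zero, so this class contains a smaller word to replace
  \<open>u\<close> by.\<close>

lemma irreducible_exists:
  assumes "p \<in> paths X"
  shows "\<exists>w\<in>irr_words X lt G. p \<simeq> w"
  using lt_wf assms
proof (induction p rule: wfp_induct_rule)
  case (less p)
  show ?case
  proof (cases "p \<in> irr_words X lt G")
    case True
    then show ?thesis
      using less.prems pcong_refl by blast
  next
    case False
    then obtain g where g: "g \<in> G" "subpath X (leading_word lt g) p"
      using less.prems by (auto simp: irr_words_def avoiding_paths_def)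
    let ?u = "leading_word lt g"
    have "g \<noteq> 0 \<and> Poly_Mapping.lookup g ?u = 1 \<and> (\<exists>x y. rel_ideal X R x y g)"
      using basis g(1) by (simp add: gs_basis_def)
    then obtain x y where ideal: "rel_ideal X R x y g" and "g \<noteq> 0" and coeff: "Poly_Mapping.lookup g ?u = 1"
      by auto
    obtain a b where ab: "composable X a ?u" "composable X ?u b" "p = a \<odot> ?u \<odot> b"
      using g(2) by (auto simp: subpath_def)
    have u: "?u \<in> Poly_Mapping.keys g"
      using leading_word(1)[OF ideal \<open>g \<noteq> 0\<close>] .
    have "\<exists>v\<in>Poly_Mapping.keys g. v \<noteq> ?u \<and> ?u \<simeq> v"
    proof (rule ccontr)
      assume none: "\<not> ?thesis"
      have refl: "?u \<simeq> ?u"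
        using ab(1) by (intro pcong_refl) (simp add: composable_def)
      have "class_sum {v. ?u \<simeq> v} g = 0"
        using ideal by (rule rel_ideal_class_sum) (metis mem_Collect_eq pcong_sym pcong_trans)
      moreover have "class_sum {v. ?u \<simeq> v} g =
          (\<Sum>w\<in>Poly_Mapping.keys g. if w = ?u then Poly_Mapping.lookup g w else 0)"
        unfolding class_sum_def using none refl by (intro sum.cong) auto
      ultimately show False
        using u coeff by simp
    qed
    then obtain v where v: "v \<in> Poly_Mapping.keys g" "v \<noteq> ?u" "?u \<simeq> v"
      by blast
    note uv = cong_paths[OF v(3)]
    have "lt v ?u"
      using leading_word(2)[OF ideal \<open>g \<noteq> 0\<close> v(1,2)] .
    have comp: "composable X a v" "composable X v b" "composable X (a \<odot> ?u) b"
      "composable X (a \<odot> v) b"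
      using ab uv by (auto simp: composable_def pcat_path ptgt_pcat)
    have "lt (a \<odot> v \<odot> b) p"
      unfolding ab(3) using uv comp \<open>lt v ?u\<close> by (intro lt_mult) (auto simp: parallel_def)
    moreover have cong: "p \<simeq> a \<odot> v \<odot> b"
      unfolding ab(3) using v(3) ab(1,2) comp
      by (intro pcong_comp pcong_refl) (auto simp: composable_def)
    ultimately have "\<exists>w\<in>irr_words X lt G. a \<odot> v \<odot> b \<simeq> w"
      using cong_paths[OF cong] by (intro less.IH) (auto simp: parallel_def)
    then show ?thesis
      using cong pcong_trans by blast
  qed
qed

end

lemma groebner_normal_form:
  assumes "presents A \<Gamma> R \<gamma>" "admissible_order \<Gamma> lt" "gs_basis \<Gamma> R lt G"
    and ev: "ev = word_value A \<gamma>" and I: "I = irr_words \<Gamma> lt G"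
  shows "a \<in> Elt A \<Longrightarrow> normal_form ev I a \<in> I \<and> ev (normal_form ev I a) = a"
    and "w \<in> I \<Longrightarrow> ev w \<in> Elt A \<and> normal_form ev I (ev w) = w"
proof -
  interpret groebner_presentation \<Gamma> R lt G
    using assms by unfold_locales (auto simp: presents_def)
  have word_values: "ev ` paths \<Gamma> = Elt A" "\<And>p q. \<lbrakk>p \<in> paths \<Gamma>; q \<in> paths \<Gamma>\<rbrakk> \<Longrightarrow> ev p = ev q \<longleftrightarrow> pcong \<Gamma> R p q"
    using assms(1) by (auto simp: presents_def ev)
  have I_paths: "I \<subseteq> paths \<Gamma>"
    by (auto simp: I irr_words_def avoiding_paths_def)
  have ex1: "\<exists>!w. w \<in> I \<and> ev w = a" if a: "a \<in> Elt A" for a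
  proof -
    have "a \<in> ev ` paths \<Gamma>"
      using a word_values(1) by simp
    then obtain p where p: "p \<in> paths \<Gamma>" "ev p = a"
      by auto
    then obtain w where w: "w \<in> I" "pcong \<Gamma> R p w"
      using irreducible_exists I by blast
    then have "ev w = a"
      using word_values(2)[of p w] p I_paths by auto
    moreover have "v = w" if "v \<in> I" "ev v = a" for v
      using irreducible_unique[of v w] word_values(2)[of v w] that w(1) \<open>ev w = a\<close> I_paths I by auto
    ultimately show ?thesis
      using w(1) by blast
  qed
  show "a \<in> Elt A \<Longrightarrow> normal_form ev I a \<in> I \<and> ev (normal_form ev I a) = a"
    unfolding normal_form_def using ex1 by (rule theI')
  show "w \<in> I \<Longrightarrow> ev w \<in> Elt A \<and> normal_form ev I (ev w) = w"
  proof
    assume w: "w \<in> I"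
    then show "ev w \<in> Elt A"
      using word_values(1) I_paths by blast
    then show "normal_form ev I (ev w) = w"
      unfolding normal_form_def using ex1 w by (intro the1_equality) auto
  qed
qed

section \<open>Solid Garside families present their category\<close>

context full_slide_germ
begin

text \<open>Splitting off the head of a path of length \<open>n + 1\<close> leaves a rest that a path of length \<open>n\<close>
  represents; this is the measure for inductions along heads.\<close>

lemma head_rest_length:
  "\<lbrakk>chain Y x es; length es = Suc n\<rbrakk> \<Longrightarrow>
    \<exists>d y ys. head_rest (cls (x, es)) d (cls (y, ys)) \<and> chain Y y ys \<and> length ys = n"
proof (induction n arbitrary: x es)
  case 0
  then obtain a where a: "es = [a]" "a \<in> Elt Y" "Src Y a = x"
    by (cases es) auto
  then have "cls (x, es) = emb a"
    by (simp add: germ_emb_def)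
  then show ?case
    using head_rest_emb[OF a(2)] a(2) unfolding germ_cat_simps by fastforce
next
  case (Suc n)
  then obtain a fs where es: "es = a # fs" "length fs = Suc n"
    by (cases es) auto
  have chain: "chain Y x (a # fs)" "chain Y (Tgt Y a) fs" "a \<in> Elt Y"
    using Suc.prems es by auto
  obtain d y ys where d: "head_rest (cls (Tgt Y a, fs)) d (cls (y, ys))" "chain Y y ys" "length ys = n"
    using Suc.IH[OF chain(2) es(2)] by blast
  have "Src Y d = Tgt Y a"
    using head_restD(5)[OF d(1)] germ_cat_cls[of "(Tgt Y a, fs)"] chain(2) by simp
  then obtain m u where m: "full_slide a d m u"
    using full_slide_ex[of a d] chain(3) head_restD(2)[OF d(1)] by auto
  then have s: "slide a d m u"
    by (simp add: full_slide_def)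
  have "Tgt Y u = y"
    using slideD(8)[OF s] head_restD(4)[OF d(1)] germ_cat_cls[of "(y, ys)"] d(2) by simp
  then have u: "chain Y (Src Y u) (u # ys)"
    using slideD(4)[OF s] d(2) by simp
  have "head_rest (cls (x, es)) m (cls (Src Y u, u # ys))"
    using head_rest_cmp[OF d(1) m] cls_Cons[OF chain(1)] cls_Cons[OF u] \<open>Tgt Y u = y\<close> es(1) by simp
  then show ?case
    using u d(3) by (intro exI[of _ m] exI[of _ "Src Y u"] exI[of _ "u # ys"]) simp
qed

end

context solid_embedding
begin

lemma emb_path_value_fold:
  "path_value D (x, map emb es) = List.foldr (\<lambda>a. Cmp D (emb a)) es (Idt D (ptgt D (x, map emb es)))"
  by (simp add: path_value_def foldr_map comp_def)

lemma emb_path_lift: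
  "\<lbrakk>chain D x fs; set fs \<subseteq> emb ` Elt Y\<rbrakk> \<Longrightarrow> \<exists>es. fs = map emb es \<and> chain Y x es"
proof (induction fs arbitrary: x)
  case Nil
  then show ?case by (auto simp: obj_eq)
next
  case (Cons f fs)
  then obtain a es where "f = emb a" "a \<in> Elt Y" "fs = map emb es" "chain Y (Tgt D f) es"
    by fastforce
  then show ?case
    using Cons.prems by (intro exI[of _ "a # es"]) (auto simp: obj_eq)
qed

lemma greatest_divisor_dvd:
  assumes "greatest_divisor s g" "greatest_divisor r g" "g \<in> Elt D"
  shows "r \<preceq> s"
proof -
  have s: "Src D (emb s) = Src D g"
    using assms(1) divides_src[of "emb s" g] by (simp add: greatest_divisor_def)
  have obj: "Src D g \<in> Obj D"
    using assms(3) by (rule src_obj)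
  have "cat_divides D (emb r) (Idt D (Src D g) \<cdot> g)"
    using assms(2,3) by (simp add: greatest_divisor_def)
  then have "cat_divides D (emb r) (Idt D (Src D g) \<cdot> emb s)"
    using assms(1,2) obj by (simp add: greatest_divisor_def)
  then show ?thesis
    using assms(1,2) s by (simp add: greatest_divisor_def emb_divides_iff)
qed

text \<open>The functor from the generated category to \<open>D\<close> sends the head of a morphism to the greatest
  divisor of its image.  So two morphisms with the same image have the same head up to a unit, and
  cancelling the heads in \<open>D\<close> yields a pair of shorter morphisms with the same image.\<close>

theorem solid_garside_presents:
  assumes garside: "garside_family D (emb ` Elt Y)" and generating: "generating_family D (emb ` Elt Y)"
  shows "isomorphic_cats D (germ_cat Y)"
proof -
  interpret K: full_slide_germ Y
    by unfold_locales (rule garside_has_full_slides[OF garside])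
  have lc: "left_cancellative D"
    using garside by (simp add: garside_family_def)
  define val where "val p = path_value D (fst p, map emb (snd p))" for p
  define F where "F c = val (SOME p. p \<in> c)" for c

  have val_cong: "val p = val q" if "pcong Y (germ_relations Y) p q" for p q
  proof -
    note pq = K.cong_paths[OF that]
    have chains: "chain Y (fst p) (snd p)" "chain Y (fst q) (snd q)"
      using pq by (auto simp: paths_def)
    have "List.foldr (\<lambda>a. Cmp D (emb a)) (snd p) (Idt D (ptgt Y p)) =
        List.foldr (\<lambda>a. Cmp D (emb a)) (snd q) (Idt D (ptgt Y p))"
    proof (rule K.cong_fold[of "\<lambda>x. {c \<in> Elt D. Src D c = x}" _ "(=)", OF _ _ _ _ _ _ _ that])
      fix a b c z assume ab: "a \<bullet> b = Some c" and z: "z \<in> {c \<in> Elt D. Src D c = Tgt Y b}"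
      show "emb a \<cdot> (emb b \<cdot> z) = emb c \<cdot> z"
        unfolding emb_mul[OF ab, symmetric] using mulD[OF ab] z by (intro cmp_assoc[symmetric]) auto
    qed (use pq in \<open>auto simp: emb_one obj_eq ptgt_obj\<close>)
    moreover have "ptgt D (fst p, map emb (snd p)) = ptgt Y p" "ptgt D (fst q, map emb (snd q)) = ptgt Y p"
      using emb_chain[OF chains(1)] emb_chain[OF chains(2)] pq by (cases p; cases q; auto)+
    ultimately show ?thesis
      by (simp add: val_def emb_path_value_fold)
  qed
  have F_cls: "F (K.cls p) = val p" if "p \<in> paths Y" for p
    unfolding F_def using val_cong[OF K.some_cls[OF that]] by simp
  have val_in: "val p \<in> Elt D \<and> Src D (val p) = fst p \<and> Tgt D (val p) = ptgt Y p" if "p \<in> paths Y" for p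
  proof (cases p)
    case (Pair x es)
    then show ?thesis
      using that emb_chain[of x es] path_value_in[of x "map emb es"] by (simp add: val_def)
  qed
  have F_in: "F f \<in> Elt D" "Src D (F f) = Src K.D f" "Tgt D (F f) = Tgt K.D f" if "f \<in> Elt K.D" for f
    using that val_in F_cls by (auto simp: K.germ_cat_simps(2) K.germ_cat_cls)
  have F_idt: "F (Idt K.D x) = Idt D x" if "x \<in> Obj Y" for x
    using F_cls[of "(x, [])"] that by (simp add: K.germ_cat_simps val_def)
  have F_cmp: "F (Cmp K.D f g) = F f \<cdot> F g" if fg: "f \<in> Elt K.D" "g \<in> Elt K.D" "Tgt K.D f = Src K.D g" for f g
  proof -
    obtain x es y fs where p: "f = K.cls (x, es)" "chain Y x es" "g = K.cls (y, fs)" "chain Y y fs"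
      using fg(1,2) by (auto simp: K.germ_cat_simps(2))
    have comp: "composable Y (x, es) (y, fs)"
      using p fg(3) K.germ_cat_cls[of "(x, es)"] K.germ_cat_cls[of "(y, fs)"] by simp
    then have "Cmp K.D f g = K.cls (x, es @ fs)" "chain Y x (es @ fs)"
      using K.germ_cat_cmp[OF comp] p by (simp_all add: chain_append)
    then show ?thesis
      using F_cls p comp emb_chain[of x "es @ fs"] emb_chain[of x es] path_value_append[of x "map emb es" "map emb fs"]
      by (simp add: val_def)
  qed
  have F_emb: "F (K.emb a) = emb a" if "a \<in> Elt Y" for a
    using F_cls[of "(Src Y a, [a])"] that cmp_idt(2)[of "emb a" "Tgt Y a"]
    by (simp add: germ_emb_def val_def)

  have F_in_emb: "f = K.emb c" if "f \<in> Elt K.D" "F f = emb c" "c \<in> Elt Y" for f c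
    using that
  proof (induction arbitrary: c rule: K.germ_cat_induct)
    case (idt x)
    then have "emb c = emb (One Y x)"
      using F_idt by (simp add: emb_one)
    then have "c = One Y x"
      by (rule emb_inj) (use idt in auto)
    then show ?case
      using idt K.emb_one by simp
  next
    case (cmp a g)
    have F: "F (Cmp K.D (K.emb a) g) = emb a \<cdot> F g"
      using F_cmp[of "K.emb a" g] F_emb cmp by simp
    then have "emb a \<cdot> F g \<in> emb ` Elt Y"
      using cmp.prems by (metis imageI)
    then obtain d where d: "F g = emb d" "d \<in> Elt Y"
      using emb_solid[of "emb a" "F g"] F_in cmp.hyps by auto
    have ad: "Tgt Y a = Src Y d"
      using F_in(2)[OF cmp.hyps(2)] d cmp.hyps by simp
    have "a \<bullet> d = Some c"
      using F d cmp.prems cmp.hyps ad emb_mul_iff[of a d c] by simp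
    then show ?case
      using K.emb_mul cmp.IH[OF d] by simp
  qed

  have F_head: "greatest_divisor d (F g)" if "K.head_rest g d f" for g d f
    using that
  proof (induction rule: K.head_rest.induct)
    case (head_rest_idt x)
    then show ?case
      using divides_refl[of "Idt D x"] by (simp add: greatest_divisor_def F_idt emb_one obj_eq)
  next
    case (head_rest_cmp g d f a m u)
    have s: "slide a d m u"
      using head_rest_cmp.hyps by (simp add: full_slide_def)
    note ad = slideD[OF s] and g = K.head_restD[OF head_rest_cmp.hyps(1)]
    have Fg: "F g \<in> Elt D" "Src D (F g) = Src Y d"
      using F_in g by auto
    have F: "F (Cmp K.D (K.emb a) g) = emb a \<cdot> F g"
      using F_cmp[of "K.emb a" g] F_emb ad g by simp
    have m: "greatest_divisor m (emb a \<cdot> emb d)"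
      using garside head_rest_cmp.hyps(2) by (rule full_slide_greatest_divisor)
    have "cat_divides D (emb a \<cdot> emb d) (emb a \<cdot> F g)"
      using head_rest_cmp.IH ad by (intro divides_mult) (auto simp: greatest_divisor_def)
    then have "cat_divides D (emb m) (emb a \<cdot> F g)"
      using m divides_trans ad by (auto simp: greatest_divisor_def)
    moreover have "cat_divides D (emb r) (c \<cdot> emb m)"
      if c: "c \<in> Elt D" "r \<in> Elt Y" "Tgt D c = Src D (emb a \<cdot> F g)" "cat_divides D (emb r) (c \<cdot> (emb a \<cdot> F g))" for c r
    proof -
      have "cat_divides D (emb r) (c \<cdot> emb a \<cdot> F g)"
        using c ad Fg by (simp add: cmp_assoc)
      then have "cat_divides D (emb r) (c \<cdot> emb a \<cdot> emb d)"
        using head_rest_cmp.IH c ad Fg by (simp add: greatest_divisor_def)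
      then have "cat_divides D (emb r) (c \<cdot> (emb a \<cdot> emb d))"
        using c ad Fg by (simp add: cmp_assoc)
      then show ?thesis
        using m c ad Fg by (simp add: greatest_divisor_def)
    qed
    ultimately show ?case
      unfolding F using ad by (auto simp: greatest_divisor_def)
  qed

  have F_inj_path: "K.cls (x, es) = g"
    if "chain Y x es" "length es = n" "g \<in> Elt K.D" "F (K.cls (x, es)) = F g" for x es n g
    using that
  proof (induction n arbitrary: x es g)
    case 0
    then have "F g = emb (One Y x)" "x \<in> Obj Y"
      using F_idt[of x] by (auto simp: K.germ_cat_simps emb_one)
    then show ?case
      using F_in_emb[OF 0(3)] K.emb_one 0 by (simp add: K.germ_cat_simps)
  next
    case (Suc n)
    obtain d y ys where d: "K.head_rest (K.cls (x, es)) d (K.cls (y, ys))" "chain Y y ys" "length ys = n"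
      using K.head_rest_length[OF Suc.prems(1,2)] by blast
    obtain d' g' where d': "K.head_rest g d' g'"
      using Suc.prems(3) by (rule K.head_rest_ex)
    note f = K.head_restD[OF d(1)] and g = K.head_restD[OF d']
    let ?f' = "K.cls (y, ys)"
    have "greatest_divisor d (F g)" "greatest_divisor d' (F g)"
      using F_head[OF d(1)] F_head[OF d'] Suc.prems(4) by simp_all
    then have "d \<preceq> d'" "d' \<preceq> d"
      using greatest_divisor_dvd F_in(1)[OF g(1)] by blast+
    then obtain e where e: "d \<bullet> e = Some d'"
      by (rule mutual_dvd) blast
    note types = mulD[OF e]
    have eg: "Cmp K.D (K.emb e) g' \<in> Elt K.D" "Src K.D (Cmp K.D (K.emb e) g') = Src Y e"
      using types g by auto
    have dg: "Cmp K.D (K.emb d) (Cmp K.D (K.emb e) g') = g"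
    proof -
      have "Cmp K.D (K.emb d) (Cmp K.D (K.emb e) g') = Cmp K.D (Cmp K.D (K.emb d) (K.emb e)) g'"
        using types g by (intro K.cmp_assoc[symmetric]) auto
      then show ?thesis
        using K.emb_mul[OF e] g(6) by simp
    qed
    have "emb d \<cdot> F ?f' = F (K.cls (x, es))"
      using F_cmp[of "K.emb d" ?f'] F_emb f by simp
    also have "\<dots> = emb d \<cdot> F (Cmp K.D (K.emb e) g')"
      using F_cmp[of "K.emb d" "Cmp K.D (K.emb e) g'"] F_emb types eg dg Suc.prems(4) by simp
    finally have "F ?f' = F (Cmp K.D (K.emb e) g')"
      using f eg types F_in[of ?f'] F_in[of "Cmp K.D (K.emb e) g'"] by - (rule lcancel[OF lc, of "emb d"], auto)
    then have "?f' = Cmp K.D (K.emb e) g'"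
      using Suc.IH[OF d(2,3) eg(1)] by simp
    then show ?case
      using f(6) dg by simp
  qed
  have inj: "inj_on F (Elt K.D)"
  proof (rule inj_onI)
    fix f g assume fg: "f \<in> Elt K.D" "g \<in> Elt K.D" "F f = F g"
    then obtain x es where "f = K.cls (x, es)" "chain Y x es"
      by (auto simp: K.germ_cat_simps(2))
    then show "f = g"
      using F_inj_path[of x es "length es" g] fg(2,3) by blast
  qed
  have surj: "F ` Elt K.D = Elt D"
  proof
    show "F ` Elt K.D \<subseteq> Elt D"
      using F_in by auto
    show "Elt D \<subseteq> F ` Elt K.D"
    proof
      fix g assume "g \<in> Elt D"
      then obtain x fs where fs: "chain D x fs" "set fs \<subseteq> emb ` Elt Y" "path_value D (x, fs) = g"
        using generating unfolding generating_family_def by fastforce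
      then obtain es where es: "fs = map emb es" "chain Y x es"
        using emb_path_lift by blast
      then have "F (K.cls (x, es)) = g"
        using F_cls[of "(x, es)"] fs by (simp add: val_def)
      then show "g \<in> F ` Elt K.D"
        using K.germ_cat_cls(1)[of "(x, es)"] es by auto
    qed
  qed
  have bij: "bij_betw F (Elt K.D) (Elt D)"
    using inj surj by (simp add: bij_betw_def)
  define H where "H = inv_into (Elt K.D) F"
  have H: "H g \<in> Elt K.D" "F (H g) = g" if "g \<in> Elt D" for g
    using that surj unfolding H_def by (auto intro: inv_into_into f_inv_into_f)
  have HF: "H (F f) = f" if "f \<in> Elt K.D" for f
    using inj that by (simp add: H_def)
  have H_types: "Src K.D (H g) = Src D g" "Tgt K.D (H g) = Tgt D g" if "g \<in> Elt D" for g
    using F_in(2,3)[OF H(1)[OF that]] H(2)[OF that] by simp_all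
  have "is_functor D K.D id H"
    unfolding is_functor_def
  proof (intro conjI ballI impI)
    fix x assume x: "x \<in> Obj D"
    then show "id x \<in> Obj K.D"
      by (simp add: obj_eq K.obj_eq)
    show "H (Idt D x) = Idt K.D (id x)"
      using HF[of "Idt K.D x"] F_idt x by (simp add: obj_eq K.obj_eq)
  next
    fix f g assume fg: "f \<in> Elt D" "g \<in> Elt D" "Tgt D f = Src D g"
    then have "F (Cmp K.D (H f) (H g)) = f \<cdot> g" "Cmp K.D (H f) (H g) \<in> Elt K.D"
      using F_cmp H H_types by simp_all
    then show "H (f \<cdot> g) = Cmp K.D (H f) (H g)"
      using HF by metis
  qed (use H H_types in auto)
  moreover have "bij_betw id (Obj D) (Obj K.D)"
    by (simp add: obj_eq K.obj_eq)
  moreover have "bij_betw H (Elt D) (Elt K.D)"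
    unfolding H_def using bij by (rule bij_betw_inv_into)
  ultimately show ?thesis
    unfolding isomorphic_cats_def by blast
qed

end

section \<open>The germ of a section\<close>

text \<open>The presentation of \<open>A\<close> appears as the bijection \<open>ev\<close> between the irreducible words and the
  morphisms of \<open>A\<close>.\<close>

locale section_setting =
  fixes C :: "('o, 'm) cat" and A :: "('p, 'n) cat"
    and P\<^sub>o :: "'o \<Rightarrow> 'p" and P :: "'m \<Rightarrow> 'n" and E :: "'n \<Rightarrow> 'm"
    and ev :: "'w \<Rightarrow> 'n" and I B :: "'w set" and one :: "'o \<Rightarrow> 'm"
  assumes C: "is_category C" and A: "is_category A"
    and P_functor: "is_functor C A P\<^sub>o P"
    and sect: "\<forall>a\<in>Elt A. E a \<in> Elt C \<and> P (E a) = a"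
    and nf_ev: "\<And>a. a \<in> Elt A \<Longrightarrow> normal_form ev I a \<in> I \<and> ev (normal_form ev I a) = a"
    and ev_nf: "\<And>w. w \<in> I \<Longrightarrow> ev w \<in> Elt A \<and> normal_form ev I (ev w) = w"
    and B: "B \<subseteq> I"
begin

abbreviation "\<Upsilon> \<equiv> section_germ C A P E ev I B one"

lemma section_germ_simps:
  "Elt \<Upsilon> = (\<lambda>w. E (ev w)) ` B" "Src \<Upsilon> = Src C" "Tgt \<Upsilon> = Tgt C"
  "Obj \<Upsilon> = Src C ` Elt \<Upsilon> \<union> Tgt C ` Elt \<Upsilon>"
  by (simp_all add: section_germ_def Let_def)

lemma ev_in: "w \<in> B \<Longrightarrow> ev w \<in> Elt A"
  using ev_nf B by blast

lemma elt_in_C: "\<alpha> \<in> Elt \<Upsilon> \<Longrightarrow> \<alpha> \<in> Elt C"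
  using sect ev_in by (auto simp: section_germ_simps)

lemma P_E: "w \<in> B \<Longrightarrow> P (E (ev w)) = ev w"
  using sect ev_in by blast

lemma functorD:
  "f \<in> Elt C \<Longrightarrow> P f \<in> Elt A \<and> Src A (P f) = P\<^sub>o (Src C f) \<and> Tgt A (P f) = P\<^sub>o (Tgt C f)"
  "\<lbrakk>f \<in> Elt C; g \<in> Elt C; Tgt C f = Src C g\<rbrakk> \<Longrightarrow> P (Cmp C f g) = Cmp A (P f) (P g)"
  using P_functor by (auto simp: is_functor_def)

lemma product_in_A:
  assumes "\<alpha> \<in> Elt C" "\<beta> \<in> Elt C" "Tgt C \<alpha> = Src C \<beta>"
  shows "Cmp A (P \<alpha>) (P \<beta>) \<in> Elt A"
proof -
  interpret category A
    by unfold_locales (rule A)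
  show ?thesis
    using functorD(1) assms by simp
qed

lemma Mul_value:
  "Mul \<Upsilon> \<alpha> \<beta> = Some \<gamma> \<Longrightarrow> \<gamma> = E (ev (normal_form ev I (Cmp A (P \<alpha>) (P \<beta>))))"
  by (auto simp: section_germ_def Let_def split: if_splits)

text \<open>The partial product of the germ is the restriction of the product of \<open>C\<close>: it is defined as soon
  as the product of \<open>C\<close> lies in the germ.\<close>

lemma Mul_iff:
  "Mul \<Upsilon> \<alpha> \<beta> = Some \<gamma> \<longleftrightarrow>
     \<alpha> \<in> Elt \<Upsilon> \<and> \<beta> \<in> Elt \<Upsilon> \<and> \<gamma> \<in> Elt \<Upsilon> \<and> Tgt C \<alpha> = Src C \<beta> \<and> Cmp C \<alpha> \<beta> = \<gamma>"
proof -
  let ?ab = "Cmp A (P \<alpha>) (P \<beta>)"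
  let ?w = "normal_form ev I ?ab"
  have Mul: "Mul \<Upsilon> \<alpha> \<beta> = (if \<alpha> \<in> Elt \<Upsilon> \<and> \<beta> \<in> Elt \<Upsilon> \<and> Tgt C \<alpha> = Src C \<beta> \<and> ?w \<in> B \<and> E ?ab = Cmp C \<alpha> \<beta>
      then Some (E (ev ?w)) else None)"
    by (simp add: section_germ_def Let_def)
  show ?thesis
  proof
    assume prod: "Mul \<Upsilon> \<alpha> \<beta> = Some \<gamma>"
    then have ab: "\<alpha> \<in> Elt \<Upsilon>" "\<beta> \<in> Elt \<Upsilon>" "Tgt C \<alpha> = Src C \<beta>" "?w \<in> B" "E ?ab = Cmp C \<alpha> \<beta>" "\<gamma> = E (ev ?w)"
      unfolding Mul by (auto split: if_splits)
    have "ev ?w = ?ab"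
      using nf_ev product_in_A ab(1-3) elt_in_C by blast
    moreover have "\<gamma> \<in> Elt \<Upsilon>"
      unfolding section_germ_simps ab(6) using ab(4) by (rule imageI)
    ultimately show "\<alpha> \<in> Elt \<Upsilon> \<and> \<beta> \<in> Elt \<Upsilon> \<and> \<gamma> \<in> Elt \<Upsilon> \<and> Tgt C \<alpha> = Src C \<beta> \<and> Cmp C \<alpha> \<beta> = \<gamma>"
      using ab by simp
  next
    assume r: "\<alpha> \<in> Elt \<Upsilon> \<and> \<beta> \<in> Elt \<Upsilon> \<and> \<gamma> \<in> Elt \<Upsilon> \<and> Tgt C \<alpha> = Src C \<beta> \<and> Cmp C \<alpha> \<beta> = \<gamma>"
    then obtain v where v: "v \<in> B" "\<gamma> = E (ev v)"
      by (auto simp: section_germ_simps)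
    have "P \<gamma> = ?ab"
      using functorD(2) r elt_in_C by blast
    then have "ev v = ?ab"
      using P_E v by simp
    moreover have "normal_form ev I (ev v) = v"
      using ev_nf v(1) B by blast
    ultimately show "Mul \<Upsilon> \<alpha> \<beta> = Some \<gamma>"
      unfolding Mul using r v by simp
  qed
qed

end

locale section_germ_setting = section_setting +
  assumes germ: "is_germ (section_germ C A P E ev I B one)"
    and lc: "germ_left_cancellative (section_germ C A P E ev I B one)"
    and la: "germ_left_associative (section_germ C A P E ev I B one)"
begin

sublocale K: germ_category "section_germ C A P E ev I B one"
  by unfold_locales (rule germ lc la)+

text \<open>Irreducible words and morphisms of \<open>A\<close> determine each other, and \<open>P\<close> recovers the morphism from an
  element of the germ, so a factorization of words \<open>y = y\<^sub>1 y\<^sub>2\<close> with \<open>E\<^sub>y\<^sub>1 \<bullet> E\<^sub>y\<^sub>2\<close> defined is a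
  factorization in the germ.  The reductions thus only depend on the germ.\<close>

lemma germ_reductions_eq: "germ_reductions \<Upsilon> A E ev I B = K.reductions"
proof
  show "germ_reductions \<Upsilon> A E ev I B \<subseteq> K.reductions"
  proof
    fix \<sigma> assume "\<sigma> \<in> germ_reductions \<Upsilon> A E ev I B"
    then obtain x y y\<^sub>1 y\<^sub>2 z where \<sigma>: "\<sigma> = ((Src \<Upsilon> (E (ev x)), [E (ev x), E (ev y)]), (Src \<Upsilon> (E (ev x)), [E (ev z), E (ev y\<^sub>2)]))"
      and B': "x \<in> B" "y \<in> B" "y\<^sub>1 \<in> B" "y\<^sub>2 \<in> B" and y: "ev y = Cmp A (ev y\<^sub>1) (ev y\<^sub>2)"
      and defd: "Mul \<Upsilon> (E (ev x)) (E (ev y\<^sub>1)) \<noteq> None" "Mul \<Upsilon> (E (ev y\<^sub>1)) (E (ev y\<^sub>2)) \<noteq> None"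
      and z: "z = normal_form ev I (Cmp A (ev x) (ev y\<^sub>1))"
      and strict: "germ_strictly_divides \<Upsilon> (E (ev x)) (E (ev z))"
      unfolding germ_reductions_def by blast
    have "Mul \<Upsilon> (E (ev x)) (E (ev y\<^sub>1)) = Some (E (ev z))"
      using defd(1) Mul_value[of "E (ev x)" "E (ev y\<^sub>1)"] P_E B' z by auto
    moreover have "Mul \<Upsilon> (E (ev y\<^sub>1)) (E (ev y\<^sub>2)) = Some (E (ev y))"
    proof -
      have "normal_form ev I (ev y) = y"
        using ev_nf B' B by blast
      then show ?thesis
        using defd(2) Mul_value[of "E (ev y\<^sub>1)" "E (ev y\<^sub>2)"] P_E B' y by auto
    qed
    ultimately have "K.slide (E (ev x)) (E (ev y)) (E (ev z)) (E (ev y\<^sub>2))"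
      by (auto simp: K.slide_def)
    moreover have "\<not> germ_divides \<Upsilon> (E (ev z)) (E (ev x))"
      using strict by (simp add: germ_strictly_divides_def)
    ultimately show "\<sigma> \<in> K.reductions"
      unfolding \<sigma> K.reductions_def by blast
  qed
next
  show "K.reductions \<subseteq> germ_reductions \<Upsilon> A E ev I B"
  proof
    fix \<sigma> assume "\<sigma> \<in> K.reductions"
    then obtain a d m u where \<sigma>: "\<sigma> = ((Src \<Upsilon> a, [a, d]), (Src \<Upsilon> a, [m, u]))"
      and s: "K.slide a d m u" and strict: "\<not> germ_divides \<Upsilon> m a"
      unfolding K.reductions_def by blast
    obtain t where t: "Mul \<Upsilon> a t = Some m" "Mul \<Upsilon> t u = Some d"
      using s by (auto simp: K.slide_def)
    note at = t(1)[unfolded Mul_iff] and tu = t(2)[unfolded Mul_iff]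
    obtain x y y\<^sub>1 y\<^sub>2 where B': "x \<in> B" "y \<in> B" "y\<^sub>1 \<in> B" "y\<^sub>2 \<in> B"
      and E: "a = E (ev x)" "d = E (ev y)" "t = E (ev y\<^sub>1)" "u = E (ev y\<^sub>2)"
      using at tu unfolding section_germ_simps by blast
    have "P d = Cmp A (P t) (P u)"
      using functorD(2) tu elt_in_C by blast
    then have y: "ev y = Cmp A (ev y\<^sub>1) (ev y\<^sub>2)"
      using P_E B' E by simp
    have "Tgt A (P t) = Src A (P u)"
      using functorD(1) tu elt_in_C by metis
    then have types: "Tgt A (ev y\<^sub>1) = Src A (ev y\<^sub>2)"
      using P_E B' E by simp
    define z where "z = normal_form ev I (Cmp A (ev x) (ev y\<^sub>1))"
    have m: "m = E (ev z)"
      using Mul_value[OF t(1)] P_E B' E by (simp add: z_def)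
    have "germ_strictly_divides \<Upsilon> (E (ev x)) (E (ev z))"
      using K.slideD(9)[OF s] strict E m by (simp add: germ_strictly_divides_def)
    moreover have "Tgt \<Upsilon> (E (ev x)) = Src \<Upsilon> (E (ev y))"
      using K.slideD(5)[OF s] E by simp
    ultimately show "\<sigma> \<in> germ_reductions \<Upsilon> A E ev I B"
      unfolding germ_reductions_def \<sigma> using B' E m types y t z_def
      by (intro CollectI exI[of _ x] exI[of _ y] exI[of _ y\<^sub>1] exI[of _ y\<^sub>2] exI[of _ z]) simp
  qed
qed

lemma germ_reductions_bar_eq: "germ_reductions_bar \<Upsilon> A E ev I B = K.reductions_bar"
  by (simp add: germ_reductions_bar_def K.reductions_bar_def germ_reductions_eq)

theorem garside_iff_full_slides: "garside_germ \<Upsilon> \<longleftrightarrow> K.has_full_slides"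
proof
  assume "garside_germ \<Upsilon>"
  then show "K.has_full_slides"
    unfolding garside_germ_def by (rule K.garside_has_full_slides)
next
  assume "K.has_full_slides"
  then interpret full_slide_germ \<Upsilon>
    by unfold_locales
  show "garside_germ \<Upsilon>"
    by (rule full_slides_garside)
qed

theorem garside_iff_resolvable:
  "garside_germ \<Upsilon> \<longleftrightarrow>
     all_ambiguities_resolvable \<Upsilon> (germ_reductions_bar \<Upsilon> A E ev I B) (germ_path_equiv \<Upsilon>)"
proof
  assume "garside_germ \<Upsilon>"
  then interpret full_slide_germ \<Upsilon>
    by unfold_locales (simp add: garside_iff_full_slides)
  show "all_ambiguities_resolvable \<Upsilon> (germ_reductions_bar \<Upsilon> A E ev I B) (germ_path_equiv \<Upsilon>)"
    unfolding germ_reductions_bar_eq by (rule full_slides_resolvable)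
next
  assume "all_ambiguities_resolvable \<Upsilon> (germ_reductions_bar \<Upsilon> A E ev I B) (germ_path_equiv \<Upsilon>)"
  then show "garside_germ \<Upsilon>"
    unfolding germ_reductions_bar_eq garside_iff_full_slides by (rule K.resolvable_has_full_slides)
qed

theorem irr_paths_normal:
  assumes "garside_germ \<Upsilon>"
  shows "irr_paths \<Upsilon> (germ_reductions_bar \<Upsilon> A E ev I B) =
    {p \<in> paths \<Upsilon>. normal_path (germ_cat \<Upsilon>) (germ_emb \<Upsilon> ` Elt \<Upsilon>) (germ_emb_path \<Upsilon> p)}"
proof -
  interpret full_slide_germ \<Upsilon>
    using assms by unfold_locales (simp add: garside_iff_full_slides)
  show ?thesis
    unfolding germ_reductions_bar_eq by (rule irr_reductions_bar)
qed

text \<open>If the germ is a solid family in \<open>C\<close>, its units are the identities of \<open>C\<close>, and its inclusion into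
  \<open>C\<close> is a solid embedding.\<close>

theorem solid_garside_isomorphic:
  assumes solid: "solid_family C (Elt \<Upsilon>)" and "generating_family C (Elt \<Upsilon>)" "garside_family C (Elt \<Upsilon>)"
  shows "isomorphic_cats C (germ_cat \<Upsilon>)"
proof -
  interpret D: category C
    by unfold_locales (rule C)
  have idt: "Idt C x \<in> Elt \<Upsilon>" if "x \<in> Obj C" for x
    using solid that by (auto simp: solid_family_def)
  have obj: "Obj C = Obj \<Upsilon>"
  proof
    show "Obj C \<subseteq> Obj \<Upsilon>"
    proof
      fix x assume x: "x \<in> Obj C"
      then have "x = Src C (Idt C x)"
        by simp
      then show "x \<in> Obj \<Upsilon>"
        unfolding section_germ_simps(4) using idt[OF x] by blast
    qed
    show "Obj \<Upsilon> \<subseteq> Obj C"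
      using D.src_obj D.tgt_obj elt_in_C by (auto simp: section_germ_simps(4))
  qed
  have one: "One \<Upsilon> x = Idt C x" if x: "x \<in> Obj \<Upsilon>" for x
  proof -
    have "Mul \<Upsilon> (One \<Upsilon> x) (Idt C x) = Some (Idt C x)"
      using K.one_left[of "Idt C x" x] idt[of x] x obj by (simp add: section_germ_simps(2))
    then have "Cmp C (One \<Upsilon> x) (Idt C x) = Idt C x"
      by (simp add: Mul_iff)
    moreover have "One \<Upsilon> x \<in> Elt C" "Tgt C (One \<Upsilon> x) = x"
      using K.one[OF x] elt_in_C by (simp_all add: section_germ_simps(3))
    ultimately show ?thesis
      by simp
  qed
  interpret solid_embedding \<Upsilon> C "\<lambda>\<alpha>. \<alpha>"
  proof
    show "g \<in> (\<lambda>\<alpha>. \<alpha>) ` Elt \<Upsilon>"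
      if "f \<in> Elt C" "g \<in> Elt C" "Tgt C f = Src C g" "Cmp C f g \<in> (\<lambda>\<alpha>. \<alpha>) ` Elt \<Upsilon>" for f g
      using solid that unfolding solid_family_def by auto
  qed (use obj one elt_in_C in \<open>auto simp: section_germ_simps(2,3) Mul_iff\<close>)
  show ?thesis
    using solid_garside_presents assms by simp
qed

end

theorem theorem3p12:
  fixes C :: "('o, 'm) cat" and A :: "('p, 'n) cat"
    and P\<^sub>o :: "'o \<Rightarrow> 'p" and P :: "'m \<Rightarrow> 'n" and E :: "'n \<Rightarrow> 'm"
    and \<Gamma> :: "('p, 'x) precat" and R :: "(('p, 'x) path \<times> ('p, 'x) path) set"
    and \<gamma> :: "'x \<Rightarrow> 'n"
    and lt :: "('p, 'x) path \<Rightarrow> ('p, 'x) path \<Rightarrow> bool"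
    and G :: "(('p, 'x) path \<Rightarrow>\<^sub>0 'k::field) set"
    and I B :: "('p, 'x) path set"
    and ev :: "('p, 'x) path \<Rightarrow> 'n"
    and one :: "'o \<Rightarrow> 'm"
    and \<Upsilon> :: "('o, 'm) germ"
    and S :: "(('o, 'm) path \<times> ('o, 'm) path) set"
  assumes "is_category C" and "is_category A"
    and "surjective_functor C A P\<^sub>o P"
    and "\<forall>a\<in>Elt A. E a \<in> Elt C \<and> P (E a) = a"
    and "presents A \<Gamma> R \<gamma>"
    and "admissible_order \<Gamma> lt"
    and "gs_basis \<Gamma> R lt G"
    and "ev = word_value A \<gamma>"
    and "I = irr_words \<Gamma> lt G"
    and "B \<subseteq> I"
    and "\<Upsilon> = section_germ C A P E ev I B one"
    and "is_germ \<Upsilon>"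
    and "germ_left_cancellative \<Upsilon>"
    and "germ_left_associative \<Upsilon>"
    and "S = germ_reductions_bar \<Upsilon> A E ev I B"
  shows "(garside_germ \<Upsilon> \<longleftrightarrow> all_ambiguities_resolvable \<Upsilon> S (germ_path_equiv \<Upsilon>)) \<and>
    (garside_germ \<Upsilon> \<longrightarrow>
       irr_paths \<Upsilon> S =
         {p \<in> paths \<Upsilon>. normal_path (germ_cat \<Upsilon>) (germ_emb \<Upsilon> ` Elt \<Upsilon>) (germ_emb_path \<Upsilon> p)}) \<and>
    (left_cancellative (germ_cat \<Upsilon>) \<longrightarrow>
       (\<forall>p q. normal_path (germ_cat \<Upsilon>) (germ_emb \<Upsilon> ` Elt \<Upsilon>) p \<longrightarrow>
              normal_path (germ_cat \<Upsilon>) (germ_emb \<Upsilon> ` Elt \<Upsilon>) q \<longrightarrow>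
              path_value (germ_cat \<Upsilon>) p = path_value (germ_cat \<Upsilon>) q \<longrightarrow>
              deformation \<Upsilon> p q)) \<and>
    (solid_family C (Elt \<Upsilon>) \<longrightarrow> generating_family C (Elt \<Upsilon>) \<longrightarrow> garside_family C (Elt \<Upsilon>) \<longrightarrow>
       isomorphic_cats C (germ_cat \<Upsilon>))"
proof -
  interpret section_germ_setting C A P\<^sub>o P E ev I B one
  proof (unfold_locales)
    show "is_functor C A P\<^sub>o P"
      using assms(3) by (simp add: surjective_functor_def)
    show "normal_form ev I a \<in> I \<and> ev (normal_form ev I a) = a" if "a \<in> Elt A" for a
      using groebner_normal_form(1)[OF assms(5-9) that] .
    show "ev w \<in> Elt A \<and> normal_form ev I (ev w) = w" if "w \<in> I" for w
      using groebner_normal_form(2)[OF assms(5-9) that] .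
  qed (use assms in simp_all)
  show ?thesis
    unfolding assms(11,15)
    using garside_iff_resolvable irr_paths_normal K.normal_paths_deformation solid_garside_isomorphic
    by blast
qed

end
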